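(* Let $\nu\geq 0$, $\frac12\leq \alpha<\frac34$ and $0<\gamma<2-\alpha$. Then there exists $G\in C^{2\alpha-1}(\mathbb T^2)$ such that the forced stationary surface quasi-geostrophic equation $$u\cdot\nabla\theta=-\nu\Lambda^{\gamma}\theta+f,\qquad u=\nabla^{\perp}\Lambda^{-1}\theta \qquad \text{on } \mathbb T^2,$$ with external forcing $f=\Delta G$ (derivatives taken in the sense of distributions), has at least two distinct stationary weak solutions $\theta,\widetilde\theta$ satisfying $\Lambda^{-1}\theta\in C^{\alpha}(\mathbb T^2)$ and $\Lambda^{-1}\widetilde\theta\in C^{\alpha}(\mathbb T^2)$.
   Context: $\mathbb T^2=(\mathbb R/2\pi\mathbb Z)^2$ is the two-dimensional torus, with Fourier modes $e^{ik\cdot x}$, $k\in\mathbb Z^2$. The operator $\Lambda=(-\Delta)^{1/2}$ is the Fourier multiplier with symbol $|k|$, and $\Lambda^{s}$ is the multiplier with symbol $|k|^{s}$ (for $s<0$ it acts on zero-mean distributions, or equivalently on nonzero modes only, giving zero-mean output). The notation $\nabla^\perp=(-\partial_{x_2},\partial_{x_1})$ is used, so that $\nabla^{\perp}\Lambda^{-1}\theta=(-\mathcal R_2\theta,\mathcal R_1\theta)$ with $\mathcal R_j=\partial_{x_j}\Lambda^{-1}$ the Riesz transforms. $\dot H^{s}(\mathbb T^2)$ is the homogeneous $L^2$-based Sobolev space of (zero-mean) distributions with norm $\|\Lambda^s \cdot\|_{L^2}$. $C^{\alpha}(\mathbb T^2)$ denotes the usual Hölder space, with $C^0$ the continuous functions.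 For $\psi\in C^\infty(\mathbb T^2)$ and a distribution $h\in\dot H^{-1/2}(\mathbb T^2)$, define the commutator $$[\nabla^{\perp}\Lambda^{-1},\nabla\psi]h=\nabla^{\perp}\Lambda^{-1}\cdot(h\nabla\psi)-\nabla^{\perp}\Lambda^{-1}h\cdot\nabla\psi,$$ where $\nabla^{\perp}\Lambda^{-1}\cdot(v_1,v_2)=-\partial_{x_2}\Lambda^{-1}v_1+\partial_{x_1}\Lambda^{-1}v_2$. If $h\in \dot H^{-1/2}$, then $[\nabla^{\perp}\Lambda^{-1},\nabla\psi]h\in\dot H^{1/2}$. Definition (stationary weak solution). Let $f\in\dot H^{-r}(\mathbb T^2)$ for some $r$. A distribution $\theta\in\dot H^{-1/2}(\mathbb T^2)$ is a stationary weak solution of the equation $u\cdot\nabla\theta=-\nu\Lambda^\gamma\theta+f$, $u=\nabla^\perp\Lambda^{-1}\theta$, if $$\frac12\int_{\mathbb T^2}\Lambda^{-\frac12}\theta\,\Lambda^{\frac12}\big([\nabla^{\perp}\Lambda^{-1},\nabla\psi]\theta\big)\,dx+\nu\int_{\mathbb T^2}\Lambda^{-\frac12}\theta\,\Lambda^{\gamma+\frac12}\psi\,dx=\int_{\mathbb T^2}\Lambda^{-r}f\,\Lambda^{r}\psi\,dx$$ holds for every $\psi\in C^\infty(\mathbb T^2)$. *)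

theory Defs
  imports "HOL-Analysis.Analysis"
begin

section \<open>Smooth functions and distributions on the torus\<close>

text \<open>
  Functions on the torus are functions on the plane that are \<open>2 * pi\<close>-periodic in both variables.
  Everything is real-valued: test functions are real, and a distribution is a real linear
  functional on them.
\<close>

type_synonym plane = "real \<times> real"
type_synonym functional = "(plane \<Rightarrow> real) \<Rightarrow> real"

definition torus_periodic :: "(plane \<Rightarrow> real) \<Rightarrow> bool" where
  "torus_periodic g \<longleftrightarrow> (\<forall>x y. g (x + 2 * pi, y) = g (x, y) \<and> g (x, y + 2 * pi) = g (x, y))"

definition dx1 :: "(plane \<Rightarrow> real) \<Rightarrow> (plane \<Rightarrow> real)" where
  "dx1 g = (\<lambda>(x, y). deriv (\<lambda>s. g (s, y)) x)"

definition dx2 :: "(plane \<Rightarrow> real) \<Rightarrow> (plane \<Rightarrow> real)" where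
  "dx2 g = (\<lambda>(x, y). deriv (\<lambda>s. g (x, s)) y)"

primrec continuously_differentiable :: "nat \<Rightarrow> (plane \<Rightarrow> real) \<Rightarrow> bool" where
  "continuously_differentiable 0 g \<longleftrightarrow> continuous_on UNIV g"
| "continuously_differentiable (Suc n) g \<longleftrightarrow>
     (\<forall>z. g differentiable (at z)) \<and>
     continuously_differentiable n (dx1 g) \<and> continuously_differentiable n (dx2 g)"

definition test_functions :: "(plane \<Rightarrow> real) set" where
  "test_functions = {\<psi>. torus_periodic \<psi> \<and> (\<forall>n. continuously_differentiable n \<psi>)}"

text \<open>The last conjunct is continuity for the Frechet topology of the smooth functions.\<close>

definition torus_distribution :: "functional \<Rightarrow> bool" where
  "torus_distribution T \<longleftrightarrow>
     (\<forall>\<phi>\<in>test_functions. \<forall>\<psi>\<in>test_functions. T (\<lambda>z. \<phi> z + \<psi> z) = T \<phi> + T \<psi>) \<and>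
     (\<forall>c. \<forall>\<psi>\<in>test_functions. T (\<lambda>z. c * \<psi> z) = c * T \<psi>) \<and>
     (\<exists>C N. \<forall>\<psi>\<in>test_functions. \<forall>M.
        (\<forall>a b z. a + b \<le> N \<longrightarrow> \<bar>(dx1 ^^ a) ((dx2 ^^ b) \<psi>) z\<bar> \<le> M) \<longrightarrow> \<bar>T \<psi>\<bar> \<le> C * M)"

text \<open>Values of a functional outside \<open>test_functions\<close> carry no meaning, so equality of
  distributions is tested on \<open>test_functions\<close> only.\<close>

definition dist_eq :: "functional \<Rightarrow> functional \<Rightarrow> bool" where
  "dist_eq S T \<longleftrightarrow> (\<forall>\<psi>\<in>test_functions. S \<psi> = T \<psi>)"

definition torus_measure :: "plane measure" where
  "torus_measure = restrict_space lborel ({0..<2 * pi} \<times> {0..<2 * pi})"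

definition dist_of :: "(plane \<Rightarrow> real) \<Rightarrow> functional" where
  "dist_of g = (\<lambda>\<psi>. \<integral>z. g z * \<psi> z \<partial>torus_measure)"

section \<open>Operations on distributions\<close>

definition ddx1 :: "functional \<Rightarrow> functional" where
  "ddx1 T = (\<lambda>\<psi>. - T (dx1 \<psi>))"

definition ddx2 :: "functional \<Rightarrow> functional" where
  "ddx2 T = (\<lambda>\<psi>. - T (dx2 \<psi>))"

definition dist_laplacian :: "functional \<Rightarrow> functional" where
  "dist_laplacian T = (\<lambda>\<psi>. ddx1 (ddx1 T) \<psi> + ddx2 (ddx2 T) \<psi>)"

definition dist_mult :: "(plane \<Rightarrow> real) \<Rightarrow> functional \<Rightarrow> functional" where
  "dist_mult \<phi> T = (\<lambda>\<psi>. T (\<lambda>z. \<phi> z * \<psi> z))"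

definition phase :: "int \<times> int \<Rightarrow> plane \<Rightarrow> real" where
  "phase k z = of_int (fst k) * fst z + of_int (snd k) * snd z"

text \<open>The coefficient is \<open>T (exp (- i k \<cdot> x)) / (2 * pi)^2\<close>, with \<open>T\<close> extended complex-linearly.\<close>

definition fourier_coeff :: "functional \<Rightarrow> int \<times> int \<Rightarrow> complex" where
  "fourier_coeff T k =
     Complex (T (\<lambda>z. cos (phase k z))) (- T (\<lambda>z. sin (phase k z))) / of_real ((2 * pi)\<^sup>2)"

text \<open>The mode \<open>k = 0\<close> is always removed. For \<open>s > 0\<close> this is the value of \<open>|k| powr s\<close> at
  \<open>0\<close>; for \<open>s = 0\<close> it makes \<open>Lam 0\<close> the projection onto zero-mean distributions.\<close>

definition Lam_symbol :: "real \<Rightarrow> int \<times> int \<Rightarrow> real" where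
  "Lam_symbol s k =
     (if k = 0 then 0 else sqrt ((of_int (fst k))\<^sup>2 + (of_int (snd k))\<^sup>2) powr s)"

text \<open>\<open>Lam s T\<close> is the Fourier series with coefficients \<open>Lam_symbol s k * fourier_coeff T k\<close>,
  paired term by term with the test function. The terms \<open>k\<close> and \<open>- k\<close> are complex conjugate,
  so taking real parts does not change the sum.\<close>

definition Lam :: "real \<Rightarrow> functional \<Rightarrow> functional" where
  "Lam s T = (\<lambda>\<psi>. \<Sum>\<^sub>\<infinity>k\<in>UNIV.
     Re (of_real (Lam_symbol s k) * fourier_coeff T k *
         (\<integral>z. cis (phase k z) * of_real (\<psi> z) \<partial>torus_measure)))"

section \<open>Function spaces\<close>

definition represents_L2 :: "(plane \<Rightarrow> real) \<Rightarrow> functional \<Rightarrow> bool" where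
  "represents_L2 g T \<longleftrightarrow>
     g \<in> borel_measurable torus_measure \<and> integrable torus_measure (\<lambda>z. (g z)\<^sup>2) \<and>
     dist_eq T (dist_of g)"

definition Hdot :: "real \<Rightarrow> functional set" where
  "Hdot s = {T. torus_distribution T \<and> T (\<lambda>z. 1) = 0 \<and> (\<exists>g. represents_L2 g (Lam s T))}"

text \<open>The integral over the torus of the product of two distributions in \<open>L\<^sup>2\<close>; the representing
  functions are unique almost everywhere, so the choice is immaterial.\<close>

definition L2_integral :: "functional \<Rightarrow> functional \<Rightarrow> real" where
  "L2_integral S T =
     (\<integral>z. (SOME g. represents_L2 g S) z * (SOME h. represents_L2 h T) z \<partial>torus_measure)"

text \<open>The Hoelder space of exponent \<open>0 \<le> \<beta> \<le> 1\<close>. For \<open>\<beta> = 0\<close> the estimate only says that the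
  oscillation is bounded, which is automatic for continuous periodic functions.\<close>

definition holder_space :: "real \<Rightarrow> (plane \<Rightarrow> real) set" where
  "holder_space \<beta> = {g. torus_periodic g \<and> continuous_on UNIV g \<and>
     (\<exists>C. \<forall>z w. \<bar>g z - g w\<bar> \<le> C * dist z w powr \<beta>)}"

definition dist_in_holder :: "real \<Rightarrow> functional \<Rightarrow> bool" where
  "dist_in_holder \<beta> T \<longleftrightarrow> (\<exists>g\<in>holder_space \<beta>. dist_eq T (dist_of g))"

section \<open>The commutator and stationary weak solutions\<close>

definition commutator :: "(plane \<Rightarrow> real) \<Rightarrow> functional \<Rightarrow> functional" where
  "commutator \<psi> h = (\<lambda>\<phi>.
     (- ddx2 (Lam (-1) (dist_mult (dx1 \<psi>) h)) \<phi> + ddx1 (Lam (-1) (dist_mult (dx2 \<psi>) h)) \<phi>)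
   - (- dist_mult (dx1 \<psi>) (ddx2 (Lam (-1) h)) \<phi> + dist_mult (dx2 \<psi>) (ddx1 (Lam (-1) h)) \<phi>))"

text \<open>The right-hand side does not depend on the choice of \<open>r\<close> with \<open>f \<in> Hdot (- r)\<close>.\<close>

definition stationary_weak_solution :: "real \<Rightarrow> real \<Rightarrow> functional \<Rightarrow> functional \<Rightarrow> bool" where
  "stationary_weak_solution \<nu> \<gamma> f \<theta> \<longleftrightarrow>
     \<theta> \<in> Hdot (-1/2) \<and>
     (\<exists>r. f \<in> Hdot (- r) \<and>
       (\<forall>\<psi>\<in>test_functions.
          1/2 * L2_integral (Lam (-1/2) \<theta>) (Lam (1/2) (commutator \<psi> \<theta>))
          + \<nu> * L2_integral (Lam (-1/2) \<theta>) (Lam (\<gamma> + 1/2) (dist_of \<psi>))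
          = L2_integral (Lam (- r) f) (Lam r (dist_of \<psi>))))"

end

theory Submission imports Defs begin

text \<open>
  The forcing is not prescribed, and this freedom makes smooth non-unique solutions available at
  every dissipation strength. Write two candidate solutions as \<open>p + m\<close> and \<open>p - m\<close>. They have the same
  forcing exactly when the quadratic terms and the dissipation of \<open>m\<close> balance,

    \<open>u\<^sub>p \<cdot> \<nabla>m + u\<^sub>m \<cdot> \<nabla>p = - \<nu> \<Lambda>\<^sup>\<gamma> m\<close>,

  an equation that is linear in \<open>m\<close>: it says that the background \<open>p\<close> is neutrally stable
  with eigenfunction \<open>m\<close>. Whatever \<open>p\<close> and \<open>m\<close> solve it, the forcing is then read off from the
  equation for \<open>p + m\<close>. For smooth \<open>p\<close> and \<open>m\<close> the forcing is smooth as well, so \<open>G\<close> and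
  \<open>\<Lambda>\<^sup>-\<^sup>1\<theta>\<close> are Lipschitz and lie in all the required Hoelder spaces.

  The background is a Kolmogorov flow, \<open>p = (2 \<nu> / t) cos (2 x\<^sub>2)\<close>, and the perturbation has the
  longer wave length in the first variable: \<open>m\<close> lives on the modes \<open>(1, 2 j)\<close> and \<open>(-1, - 2 j)\<close>, with
  equal coefficients \<open>m\<^sub>j\<close>. With \<open>\<lambda>\<^sub>j = |(1, 2 j)|\<close> and \<open>c\<^sub>j = (1 - 2 / \<lambda>\<^sub>j) m\<^sub>j\<close> the balance follows from the
  three-term recurrence

    \<open>c\<^sub>j\<^sub>+\<^sub>1 - c\<^sub>j\<^sub>-\<^sub>1 = t D\<^sub>j c\<^sub>j\<close>  where  \<open>D\<^sub>j = \<lambda>\<^sub>j\<^sup>\<gamma> / (1 - 2 / \<lambda>\<^sub>j)\<close>,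

  from which \<open>\<nu>\<close> has disappeared. The background mode has length \<open>2\<close>, the mode \<open>(1, 0)\<close> is shorter and
  all modes \<open>(1, 2 j)\<close> with \<open>j \<noteq> 0\<close> are longer. Hence \<open>D\<^sub>0 = - 1\<close> while \<open>D\<^sub>j > 0\<close> for \<open>j \<noteq> 0\<close>; this change of
  sign is what makes a neutral mode possible. By the symmetry \<open>c\<^sub>-\<^sub>j = (-1)\<^sup>j c\<^sub>j\<close> only \<open>j \<ge> 0\<close> matters, and with
  \<open>x\<^sub>j = (-1)\<^sup>j c\<^sub>j\<close> one has to find \<open>t\<close> such that the solution of
  \<open>x\<^sub>j\<^sub>+\<^sub>1 = x\<^sub>j\<^sub>-\<^sub>1 - t D\<^sub>j x\<^sub>j\<close>, \<open>x\<^sub>0 = 1\<close>, \<open>x\<^sub>1 = t / 2\<close>, stays nonnegative. Nonnegativity forces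
  \<open>x\<^sub>j \<le> x\<^sub>j\<^sub>-\<^sub>1 / (t D\<^sub>j)\<close> and hence superpolynomial decay. For the recurrence cut off at a finite
  index, the admissible \<open>t\<close> are the roots of \<open>K(t) = t / 2\<close> for a finite continued fraction \<open>K\<close>, which
  exist by the intermediate value theorem in an interval independent of the cut-off; a limit point
  of these roots works for the full recurrence (\<open>exists_positive_shoot\<close>).

  The remaining work is to evaluate the weak formulation on smooth functions. The operators
  \<open>\<Lambda>\<^sup>s\<close> see a distribution only through its Fourier coefficients, so with rapidly decreasing
  coefficients everything reduces to absolutely convergent sums (\<open>weak_solution_real_series\<close>).
  The \<open>L\<^sup>2\<close> pairing is defined through a choice of representing functions, which is harmless because
  these are unique almost everywhere (\<open>represents_L2_unique\<close>).
\<close>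


section \<open>Rapidly decreasing Fourier coefficients\<close>

text \<open>
  A submultiplicative substitute for \<open>1 + |k|\<close>, so that decay estimates pass to convolutions.
\<close>

definition wt :: "int \<times> int \<Rightarrow> real" where
  "wt k = 1 + \<bar>of_int (fst k)\<bar> + \<bar>of_int (snd k)\<bar>"

lemma wt_ge_1: "1 \<le> wt k"
  by (simp add: wt_def)

lemma wt_pos: "0 < wt k"
  using wt_ge_1[of k] by linarith

lemma wt_uminus [simp]: "wt (- k) = wt k"
  by (simp add: wt_def)

lemma abs_fst_le_wt: "\<bar>of_int (fst k)\<bar> \<le> wt k"
  and abs_snd_le_wt: "\<bar>of_int (snd k)\<bar> \<le> wt k"
  by (auto simp: wt_def)

lemma wt_add_le: "wt (k + l) \<le> wt k * wt l"
proof -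
  have "wt (k + l) \<le> 1 + (\<bar>of_int (fst k)\<bar> + \<bar>of_int (snd k)\<bar>) + (\<bar>of_int (fst l)\<bar> + \<bar>of_int (snd l)\<bar>)"
    by (simp add: wt_def)
  also have "\<dots> \<le> wt k * wt l"
    unfolding wt_def by (simp add: algebra_simps)
  finally show ?thesis .
qed

lemma summable_on_int_inverse_square: "(\<lambda>i::int. 1 / (1 + \<bar>of_int i\<bar>)\<^sup>2 :: real) summable_on UNIV"
proof -
  have s: "summable (\<lambda>n. 1 / real (Suc n) ^ 2)"
    using inverse_power_summable[of 2, where 'a=real]
    by (intro summable_Suc_iff[of "\<lambda>n. 1 / real n ^ 2", THEN iffD2]) (simp add: inverse_eq_divide)
  then have n: "(\<lambda>n::nat. 1 / (1 + real n)\<^sup>2) summable_on UNIV"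
    by (intro norm_summable_imp_summable_on) (simp add: add.commute)
  have 1: "(\<lambda>i::int. 1 / (1 + \<bar>of_int i\<bar>)\<^sup>2 :: real) summable_on range int"
    by (subst summable_on_reindex) (auto simp: o_def n)
  have 2: "(\<lambda>i::int. 1 / (1 + \<bar>of_int i\<bar>)\<^sup>2 :: real) summable_on range (\<lambda>n. - int n)"
    by (subst summable_on_reindex) (auto simp: o_def n inj_on_def)
  have "(UNIV :: int set) = range int \<union> range (\<lambda>n. - int n)"
    by (auto simp: image_def) (metis int_cases2)
  then show ?thesis
    using summable_on_union[OF 1 2] by simp
qed

lemma summable_on_product_nonneg:
  fixes f g :: "_ \<Rightarrow> real"
  assumes "f summable_on A" "g summable_on B" "\<And>x. 0 \<le> f x" "\<And>y. 0 \<le> g y"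
  shows "(\<lambda>(x, y). f x * g y) summable_on (A \<times> B)"
proof (rule summable_on_SigmaI)
  fix x
  show "((\<lambda>y. case (x, y) of (x, y) \<Rightarrow> f x * g y) has_sum (f x * infsum g B)) B"
    using has_sum_cmult_right[OF has_sum_infsum[OF assms(2)], of "f x"] by simp
qed (use assms in \<open>auto intro: summable_on_cmult_left\<close>)

lemma summable_on_wt: "(\<lambda>k. 1 / wt k ^ 4) summable_on UNIV"
proof -
  let ?q = "\<lambda>i::int. 1 / (1 + \<bar>of_int i\<bar>)\<^sup>2 :: real"
  have "(\<lambda>(i, j). ?q i * ?q j) summable_on (UNIV \<times> UNIV)"
    by (intro summable_on_product_nonneg summable_on_int_inverse_square) auto
  then have s: "(\<lambda>k. ?q (fst k) * ?q (snd k)) summable_on UNIV"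
    by (simp add: case_prod_unfold)
  show ?thesis
  proof (rule summable_on_comparison_test[OF s])
    fix k :: "int \<times> int"
    let ?a = "1 + \<bar>real_of_int (fst k)\<bar>" and ?b = "1 + \<bar>real_of_int (snd k)\<bar>"
    have "?a\<^sup>2 * ?b\<^sup>2 \<le> (wt k)\<^sup>2 * (wt k)\<^sup>2"
      by (intro mult_mono power_mono) (auto simp: wt_def)
    then have "?a\<^sup>2 * ?b\<^sup>2 \<le> wt k ^ 4"
      by (simp add: power2_eq_square power4_eq_xxxx mult.assoc)
    moreover have "0 < ?a\<^sup>2 * ?b\<^sup>2"
      by (simp add: add_pos_nonneg)
    ultimately have "1 / wt k ^ 4 \<le> 1 / (?a\<^sup>2 * ?b\<^sup>2)"
      by (intro divide_left_mono mult_pos_pos[OF zero_less_power[OF wt_pos]]) auto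
    then show "1 / wt k ^ 4 \<le> ?q (fst k) * ?q (snd k)" by simp
  qed (auto intro: less_imp_le[OF wt_pos])
qed

definition rapid :: "(int \<times> int \<Rightarrow> complex) \<Rightarrow> bool" where
  "rapid a \<longleftrightarrow> (\<forall>N. \<exists>C. \<forall>k. norm (a k) * wt k ^ N \<le> C)"

lemma rapidE:
  assumes "rapid a"
  obtains C where "0 \<le> C" "\<And>k. norm (a k) * wt k ^ N \<le> C"
proof -
  from assms obtain C where C: "\<And>k. norm (a k) * wt k ^ N \<le> C"
    unfolding rapid_def by meson
  have "0 \<le> norm (a 0) * wt 0 ^ N"
    using wt_pos[of 0] by (intro mult_nonneg_nonneg) auto
  with C[of 0] have "0 \<le> C" by linarith
  with C that show thesis by blast
qed

lemma rapid_summable: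
  assumes "rapid a"
  shows "(\<lambda>k. norm (a k) * wt k ^ N) summable_on UNIV"
proof -
  obtain C where C: "\<And>k. norm (a k) * wt k ^ (N + 4) \<le> C"
    using rapidE[OF assms] by blast
  show ?thesis
  proof (rule summable_on_comparison_test[OF summable_on_cmult_right[OF summable_on_wt, of C]])
    fix k
    have "norm (a k) * wt k ^ N = norm (a k) * wt k ^ (N + 4) / wt k ^ 4"
      using wt_pos[of k] by (simp add: power_add)
    also have "\<dots> \<le> C / wt k ^ 4"
      using C[of k] wt_pos[of k] by (intro divide_right_mono) auto
    finally show "norm (a k) * wt k ^ N \<le> C * (1 / wt k ^ 4)" by simp
    show "0 \<le> norm (a k) * wt k ^ N"
      using wt_pos[of k] by (intro mult_nonneg_nonneg) auto
  qed
qed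

lemma rapid_abs_summable: "rapid a \<Longrightarrow> (\<lambda>k. norm (a k)) summable_on UNIV"
  using rapid_summable[of a 0] by simp

lemma rapid_multiplier:
  assumes a: "rapid a" and le: "\<And>k. norm (b k) \<le> C * wt k ^ M * norm (a k)"
  shows "rapid b"
  unfolding rapid_def
proof (intro allI)
  fix N
  obtain D where D: "\<And>k. norm (a k) * wt k ^ (M + N) \<le> D"
    using rapidE[OF a] by blast
  show "\<exists>D'. \<forall>k. norm (b k) * wt k ^ N \<le> D'"
  proof (intro exI allI)
    fix k
    have "norm (b k) * wt k ^ N \<le> (C * wt k ^ M * norm (a k)) * wt k ^ N"
      using le[of k] wt_pos[of k] by (intro mult_right_mono) auto
    also have "\<dots> = C * (norm (a k) * wt k ^ (M + N))"
      by (simp add: power_add)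
    also have "\<dots> \<le> \<bar>C\<bar> * (norm (a k) * wt k ^ (M + N))"
      using wt_pos[of k] by (intro mult_right_mono) auto
    also have "\<dots> \<le> \<bar>C\<bar> * D"
      using D[of k] by (intro mult_left_mono) auto
    finally show "norm (b k) * wt k ^ N \<le> \<bar>C\<bar> * D" .
  qed
qed

lemma rapid_add:
  assumes "rapid a" "rapid b" shows "rapid (\<lambda>k. a k + b k)"
  unfolding rapid_def
proof (intro allI)
  fix N
  obtain C D where CD: "\<And>k. norm (a k) * wt k ^ N \<le> C" "\<And>k. norm (b k) * wt k ^ N \<le> D"
    using rapidE[OF assms(1)] rapidE[OF assms(2)] by metis
  show "\<exists>C. \<forall>k. norm (a k + b k) * wt k ^ N \<le> C"
  proof (intro exI allI)
    fix k
    have "norm (a k + b k) * wt k ^ N \<le> (norm (a k) + norm (b k)) * wt k ^ N"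
      using wt_pos[of k] by (intro mult_right_mono norm_triangle_ineq) auto
    then show "norm (a k + b k) * wt k ^ N \<le> C + D"
      using CD[of k] by (simp add: distrib_right)
  qed
qed

lemma rapid_cmult: "rapid a \<Longrightarrow> rapid (\<lambda>k. c * a k)"
  by (rule rapid_multiplier[of a _ "norm c" 0]) (auto simp: norm_mult)

lemma rapid_diff: "rapid a \<Longrightarrow> rapid b \<Longrightarrow> rapid (\<lambda>k. a k - b k)"
  using rapid_add[of a "\<lambda>k. -1 * b k"] rapid_cmult[of b "-1"] by simp

lemma Lam_symbol_uminus [simp]: "Lam_symbol s (- k) = Lam_symbol s k"
  by (auto simp: Lam_symbol_def)

lemma Lam_symbol_0 [simp]: "Lam_symbol s 0 = 0"
  by (simp add: Lam_symbol_def)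

lemma Lam_symbol_nonneg: "0 \<le> Lam_symbol s k"
  by (auto simp: Lam_symbol_def)

lemma modulus_bounds:
  assumes "k \<noteq> 0"
  shows "1 \<le> sqrt ((of_int (fst k))\<^sup>2 + (of_int (snd k))\<^sup>2)" "sqrt ((of_int (fst k))\<^sup>2 + (of_int (snd k))\<^sup>2) \<le> wt k"
proof -
  have "1 \<le> (fst k)\<^sup>2 + (snd k)\<^sup>2"
  proof -
    have "(fst k)\<^sup>2 + (snd k)\<^sup>2 \<noteq> 0"
      using assms by (auto simp: sum_power2_eq_zero_iff prod_eq_iff)
    moreover have "0 \<le> (fst k)\<^sup>2 + (snd k)\<^sup>2" by simp
    ultimately show ?thesis by linarith
  qed
  then have "real_of_int 1 \<le> of_int ((fst k)\<^sup>2 + (snd k)\<^sup>2)" by (simp only: of_int_le_iff)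
  then show "1 \<le> sqrt ((real_of_int (fst k))\<^sup>2 + (of_int (snd k))\<^sup>2)" by simp
  have "sqrt ((real_of_int (fst k))\<^sup>2 + (of_int (snd k))\<^sup>2) \<le> \<bar>of_int (fst k)\<bar> + \<bar>of_int (snd k)\<bar>"
    by (rule sqrt_sum_squares_le_sum_abs)
  then show "sqrt ((real_of_int (fst k))\<^sup>2 + (of_int (snd k))\<^sup>2) \<le> wt k"
    by (simp add: wt_def)
qed

lemma Lam_symbol_le: "Lam_symbol s k \<le> wt k ^ nat \<lceil>\<bar>s\<bar>\<rceil>"
proof (cases "k = 0")
  case False
  let ?m = "sqrt ((real_of_int (fst k))\<^sup>2 + (of_int (snd k))\<^sup>2)"
  have "?m powr s \<le> ?m powr (nat \<lceil>\<bar>s\<bar>\<rceil>)"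
    using modulus_bounds[OF False] by (intro powr_mono) linarith+
  also have "\<dots> \<le> wt k powr (nat \<lceil>\<bar>s\<bar>\<rceil>)"
    using modulus_bounds[OF False] by (intro powr_mono2) auto
  also have "\<dots> = wt k ^ nat \<lceil>\<bar>s\<bar>\<rceil>"
    by (rule powr_realpow[OF wt_pos])
  finally show ?thesis using False by (simp add: Lam_symbol_def)
qed (use wt_pos[of k] in auto)

lemma Lam_symbol_neg1_le: "Lam_symbol (-1) k \<le> 1"
proof (cases "k = 0")
  case False
  then show ?thesis
    using modulus_bounds[OF False] by (simp add: Lam_symbol_def powr_minus divide_simps)
qed simp

lemma Lam_symbol_mult: "Lam_symbol s k * Lam_symbol t k = Lam_symbol (s + t) k"
  by (auto simp: Lam_symbol_def powr_add)

lemma Lam_symbol_zero: "k \<noteq> 0 \<Longrightarrow> Lam_symbol 0 k = 1"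
  using modulus_bounds[of k] by (auto simp: Lam_symbol_def)

lemma rapid_Lam: "rapid a \<Longrightarrow> rapid (\<lambda>k. of_real (Lam_symbol s k) * a k)"
  by (rule rapid_multiplier[of a _ 1 "nat \<lceil>\<bar>s\<bar>\<rceil>"])
     (auto simp: norm_mult Lam_symbol_nonneg Lam_symbol_le intro!: mult_right_mono)

text \<open>
  The weight of \<open>n\<close> is at most the product of the weights of \<open>k\<close> and \<open>n - k\<close>, so each power of it
  can be distributed over the two factors; one factor is then bounded and the other one summed.
\<close>

lemma rapid_convolution:
  assumes a: "rapid a" and b: "rapid b"
    and le: "\<And>k l. norm (\<kappa> k l) \<le> C * wt k ^ M * wt l ^ M"
  shows "rapid (\<lambda>n. \<Sum>\<^sub>\<infinity>k. \<kappa> k (n - k) * a k * b (n - k))"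
    and "(\<lambda>k. norm (\<kappa> k (n - k) * a k * b (n - k))) summable_on UNIV"
proof -
  have 0: "0 \<le> C" using le[of 0 0] by (simp add: wt_def) (meson norm_ge_zero order_trans)
  have main: "norm (\<kappa> k (n - k) * a k * b (n - k)) * wt n ^ N \<le> C * B * (norm (a k) * wt k ^ (M + N))"
    if B: "\<And>k. norm (b k) * wt k ^ (M + N) \<le> B" for B N k n
  proof -
    let ?l = "n - k"
    have nn: "0 \<le> wt k" "0 \<le> wt ?l" using wt_pos[of k] wt_pos[of ?l] by auto
    have "wt n ^ N \<le> (wt k * wt ?l) ^ N"
      using wt_add_le[of k ?l] wt_pos[of n] by (intro power_mono) auto
    then have "norm (\<kappa> k ?l * a k * b ?l) * wt n ^ N
        \<le> ((C * wt k ^ M * wt ?l ^ M) * norm (a k) * norm (b ?l)) * (wt k * wt ?l) ^ N"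
      unfolding norm_mult using le[of k ?l] wt_pos[of n] nn 0
      by (intro mult_mono mult_nonneg_nonneg) auto
    also have "\<dots> = C * (norm (a k) * wt k ^ (M + N)) * (norm (b ?l) * wt ?l ^ (M + N))"
      by (simp add: power_add power_mult_distrib)
    also have "\<dots> \<le> C * (norm (a k) * wt k ^ (M + N)) * B"
      using 0 nn by (intro mult_left_mono B) auto
    finally show ?thesis by (simp add: mult_ac)
  qed
  have s: "(\<lambda>k. norm (\<kappa> k (n - k) * a k * b (n - k)) * wt n ^ N) summable_on UNIV" for n N
  proof -
    obtain B where B: "\<And>k. norm (b k) * wt k ^ (M + N) \<le> B"
      using rapidE[OF b] by blast
    show ?thesis
      by (rule summable_on_comparison_test[OF summable_on_cmult_right[OF rapid_summable[OF a, of "M+N"], of "C * B"]])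
         (use main[OF B, of _ n] wt_pos[of n] in \<open>auto intro!: mult_nonneg_nonneg\<close>)
  qed
  show abs: "(\<lambda>k. norm (\<kappa> k (n - k) * a k * b (n - k))) summable_on UNIV" for n
    using s[of n 0] by simp
  show "rapid (\<lambda>n. \<Sum>\<^sub>\<infinity>k. \<kappa> k (n - k) * a k * b (n - k))"
    unfolding rapid_def
  proof (intro allI exI)
    fix N n
    define B where "B = (SOME B. \<forall>k. norm (b k) * wt k ^ (M + N) \<le> B)"
    have B: "norm (b k) * wt k ^ (M + N) \<le> B" for k
      unfolding B_def by (rule someI2_ex) (use rapidE[OF b] in blast)+
    have "norm (\<Sum>\<^sub>\<infinity>k. \<kappa> k (n - k) * a k * b (n - k)) * wt n ^ N
        \<le> (\<Sum>\<^sub>\<infinity>k. norm (\<kappa> k (n - k) * a k * b (n - k))) * wt n ^ N"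
      using wt_pos[of n] by (intro mult_right_mono norm_infsum_bound abs) auto
    also have "\<dots> = (\<Sum>\<^sub>\<infinity>k. norm (\<kappa> k (n - k) * a k * b (n - k)) * wt n ^ N)"
      by (rule infsum_cmult_left'[symmetric])
    also have "\<dots> \<le> (\<Sum>\<^sub>\<infinity>k. C * B * (norm (a k) * wt k ^ (M + N)))"
      by (intro infsum_mono s summable_on_cmult_right rapid_summable a main B)
    finally show "norm (\<Sum>\<^sub>\<infinity>k. \<kappa> k (n - k) * a k * b (n - k)) * wt n ^ N
       \<le> (\<Sum>\<^sub>\<infinity>k. C * B * (norm (a k) * wt k ^ (M + N)))" .
  qed
qed



section \<open>Test functions and integration over the torus\<close>

lemma has_dx1:
  assumes "u differentiable (at (x, y))"
  shows "((\<lambda>s. u (s, y)) has_real_derivative dx1 u (x, y)) (at x)"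
proof -
  have "(u \<circ> (\<lambda>s. (s, y))) differentiable (at x)"
    by (rule differentiable_chain_at) (use assms in auto)
  then show ?thesis
    by (simp add: dx1_def o_def DERIV_deriv_iff_real_differentiable)
qed

lemma has_dx2:
  assumes "u differentiable (at (x, y))"
  shows "((\<lambda>s. u (x, s)) has_real_derivative dx2 u (x, y)) (at y)"
proof -
  have "(u \<circ> (\<lambda>s. (x, s))) differentiable (at y)"
    by (rule differentiable_chain_at) (use assms in auto)
  then show ?thesis
    by (simp add: dx2_def o_def DERIV_deriv_iff_real_differentiable)
qed

lemma dx1_eqI: "(\<And>x y. ((\<lambda>s. u (s, y)) has_real_derivative v (x, y)) (at x)) \<Longrightarrow> dx1 u = v"
  and dx2_eqI: "(\<And>x y. ((\<lambda>s. u (x, s)) has_real_derivative v (x, y)) (at y)) \<Longrightarrow> dx2 u = v"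
  by (auto simp: dx1_def dx2_def fun_eq_iff intro!: DERIV_imp_deriv)

lemma dx_add:
  assumes "\<And>z. f differentiable (at z)" "\<And>z. g differentiable (at z)"
  shows "dx1 (\<lambda>z. f z + g z) = (\<lambda>z. dx1 f z + dx1 g z)"
    and "dx2 (\<lambda>z. f z + g z) = (\<lambda>z. dx2 f z + dx2 g z)"
  by (rule dx1_eqI dx2_eqI, intro derivative_intros has_dx1 has_dx2 assms)+

lemma dx_mult:
  assumes "\<And>z. f differentiable (at z)" "\<And>z. g differentiable (at z)"
  shows "dx1 (\<lambda>z. f z * g z) = (\<lambda>z. f z * dx1 g z + dx1 f z * g z)"
    and "dx2 (\<lambda>z. f z * g z) = (\<lambda>z. f z * dx2 g z + dx2 f z * g z)"
  by (rule dx1_eqI dx2_eqI, intro DERIV_mult' has_dx1 has_dx2 assms)+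

lemma dx_const: "dx1 (\<lambda>z. c) = (\<lambda>z. 0)" "dx2 (\<lambda>z. c) = (\<lambda>z. 0)"
  by (rule dx1_eqI dx2_eqI, auto)+

lemma dx_cos_phase:
    "dx1 (\<lambda>z. cos (phase k z)) = (\<lambda>z. - of_int (fst k) * sin (phase k z))"
    "dx2 (\<lambda>z. cos (phase k z)) = (\<lambda>z. - of_int (snd k) * sin (phase k z))"
proof -
  show "dx1 (\<lambda>z. cos (phase k z)) = (\<lambda>z. - of_int (fst k) * sin (phase k z))"
    by (rule dx1_eqI) (auto simp: phase_def intro!: derivative_eq_intros)
  show "dx2 (\<lambda>z. cos (phase k z)) = (\<lambda>z. - of_int (snd k) * sin (phase k z))"
    by (rule dx2_eqI) (auto simp: phase_def intro!: derivative_eq_intros)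
qed

lemma dx_sin_phase:
    "dx1 (\<lambda>z. sin (phase k z)) = (\<lambda>z. of_int (fst k) * cos (phase k z))"
    "dx2 (\<lambda>z. sin (phase k z)) = (\<lambda>z. of_int (snd k) * cos (phase k z))"
proof -
  show "dx1 (\<lambda>z. sin (phase k z)) = (\<lambda>z. of_int (fst k) * cos (phase k z))"
    by (rule dx1_eqI) (auto simp: phase_def intro!: derivative_eq_intros)
  show "dx2 (\<lambda>z. sin (phase k z)) = (\<lambda>z. of_int (snd k) * cos (phase k z))"
    by (rule dx2_eqI) (auto simp: phase_def intro!: derivative_eq_intros)
qed

lemma continuously_differentiable_mono:
  "continuously_differentiable (Suc n) g \<Longrightarrow> continuously_differentiable n g"
proof (induction n arbitrary: g)
  case 0
  then show ?case
    by (auto simp: continuous_on_eq_continuous_at differentiable_imp_continuous_within)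
next
  case (Suc n)
  have d: "\<forall>z. g differentiable (at z)" "continuously_differentiable (Suc n) (dx1 g)"
    "continuously_differentiable (Suc n) (dx2 g)"
    using Suc.prems by (auto simp only: continuously_differentiable.simps(2)[of "Suc n"])
  show ?case
    unfolding continuously_differentiable.simps using d(1) Suc.IH[OF d(2)] Suc.IH[OF d(3)] by blast
qed

lemma continuously_differentiable_add:
  "continuously_differentiable n f \<Longrightarrow> continuously_differentiable n g \<Longrightarrow>
   continuously_differentiable n (\<lambda>z. f z + g z)"
proof (induction n arbitrary: f g)
  case 0
  then show ?case by (simp add: continuous_on_add)
next
  case (Suc n)
  then have d: "\<And>z. f differentiable (at z)" "\<And>z. g differentiable (at z)"
    by (simp_all del: split_paired_All)
  show ?case
    unfolding continuously_differentiable.simps dx_add[OF d]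
    using Suc.prems by (intro conjI allI differentiable_add d Suc.IH) (simp_all del: split_paired_All)
qed

lemma continuously_differentiable_mult:
  "continuously_differentiable n f \<Longrightarrow> continuously_differentiable n g \<Longrightarrow>
   continuously_differentiable n (\<lambda>z. f z * g z)"
proof (induction n arbitrary: f g)
  case 0
  then show ?case by (simp add: continuous_on_mult)
next
  case (Suc n)
  then have d: "\<And>z. f differentiable (at z)" "\<And>z. g differentiable (at z)"
    by (simp_all del: split_paired_All)
  have n: "continuously_differentiable n f" "continuously_differentiable n g"
    by (rule Suc.prems[THEN continuously_differentiable_mono])+
  have p: "continuously_differentiable n (dx1 f)" "continuously_differentiable n (dx2 f)"
    "continuously_differentiable n (dx1 g)" "continuously_differentiable n (dx2 g)"
    using Suc.prems by (simp_all del: split_paired_All)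
  show ?case
    unfolding continuously_differentiable.simps dx_mult[OF d]
    by (intro conjI allI differentiable_mult d continuously_differentiable_add Suc.IH n p)
qed

lemma continuously_differentiable_const: "continuously_differentiable n (\<lambda>z. c)"
proof (induction n arbitrary: c)
  case 0
  then show ?case by (simp add: continuous_on_const)
next
  case (Suc n)
  show ?case
    unfolding continuously_differentiable.simps dx_const
    by (intro conjI allI Suc differentiable_const)
qed

lemma differentiable_phase: "phase k differentiable (at z)"
  unfolding phase_def[abs_def]
  by (intro bounded_linear_imp_differentiable bounded_linear_add bounded_linear_const_mult
      bounded_linear_fst bounded_linear_snd)

lemma differentiable_cos_sin_phase:
  "(\<lambda>z. cos (phase k z)) differentiable (at z)" "(\<lambda>z. sin (phase k z)) differentiable (at z)"
proof -
  have 1: "(cos :: real \<Rightarrow> real) differentiable (at x)" for x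
    unfolding real_differentiable_def by (rule exI, rule DERIV_cos)
  have 2: "(sin :: real \<Rightarrow> real) differentiable (at x)" for x
    unfolding real_differentiable_def by (rule exI, rule DERIV_sin)
  show "(\<lambda>z. cos (phase k z)) differentiable (at z)"
    using differentiable_chain_at[OF differentiable_phase[of k z] 1] unfolding o_def .
  show "(\<lambda>z. sin (phase k z)) differentiable (at z)"
    using differentiable_chain_at[OF differentiable_phase[of k z] 2] unfolding o_def .
qed

lemma continuous_on_phase [continuous_intros]: "continuous_on S (phase k)"
  unfolding phase_def[abs_def] by (intro continuous_intros)

lemma continuously_differentiable_trig:
  "continuously_differentiable n (\<lambda>z. cos (phase k z)) \<and> continuously_differentiable n (\<lambda>z. sin (phase k z))"
proof (induction n)
  case 0
  show ?case by (simp add: continuous_on_phase continuous_on_cos continuous_on_sin)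
next
  case (Suc n)
  have m: "continuously_differentiable n (\<lambda>z. c * g z)" if "continuously_differentiable n g" for c g
    by (rule continuously_differentiable_mult[OF continuously_differentiable_const that])
  show ?case
    unfolding continuously_differentiable.simps dx_cos_phase dx_sin_phase
    using Suc by (intro conjI allI m differentiable_cos_sin_phase) auto
qed

lemma testD:
  assumes "\<phi> \<in> test_functions"
  shows "torus_periodic \<phi>" "continuously_differentiable n \<phi>"
  using assms unfolding test_functions_def by blast+

lemma testI:
  "torus_periodic \<phi> \<Longrightarrow> (\<And>n. continuously_differentiable n \<phi>) \<Longrightarrow> \<phi> \<in> test_functions"
  unfolding test_functions_def by blast

lemma test_differentiable: "\<phi> \<in> test_functions \<Longrightarrow> \<phi> differentiable (at z)"
  using testD(2)[of \<phi> "Suc 0"] by (simp del: split_paired_All)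

lemma test_continuous: "\<phi> \<in> test_functions \<Longrightarrow> continuous_on UNIV \<phi>"
  using testD(2)[of \<phi> 0] by simp

lemma test_add: "\<phi> \<in> test_functions \<Longrightarrow> \<psi> \<in> test_functions \<Longrightarrow> (\<lambda>z. \<phi> z + \<psi> z) \<in> test_functions"
  by (rule testI, simp add: torus_periodic_def testD(1)[unfolded torus_periodic_def])
     (rule continuously_differentiable_add, (erule testD)+)

lemma test_mult: "\<phi> \<in> test_functions \<Longrightarrow> \<psi> \<in> test_functions \<Longrightarrow> (\<lambda>z. \<phi> z * \<psi> z) \<in> test_functions"
  by (rule testI, simp add: torus_periodic_def testD(1)[unfolded torus_periodic_def])
     (rule continuously_differentiable_mult, (erule testD)+)

lemma test_const: "(\<lambda>z. c) \<in> test_functions"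
  by (rule testI) (simp_all add: torus_periodic_def continuously_differentiable_const)

lemma test_cmult: "\<phi> \<in> test_functions \<Longrightarrow> (\<lambda>z. c * \<phi> z) \<in> test_functions"
  by (rule test_mult[OF test_const])

lemma cis_phase_periodic:
  "cis (phase k (x + 2 * pi, y)) = cis (phase k (x, y))" "cis (phase k (x, y + 2 * pi)) = cis (phase k (x, y))"
proof -
  have *: "phase k (x + 2 * pi, y) = phase k (x, y) + 2 * pi * of_int (fst k)"
    "phase k (x, y + 2 * pi) = phase k (x, y) + 2 * pi * of_int (snd k)"
    by (auto simp: phase_def algebra_simps)
  show "cis (phase k (x + 2 * pi, y)) = cis (phase k (x, y))" "cis (phase k (x, y + 2 * pi)) = cis (phase k (x, y))"
    unfolding * cis_mult[symmetric] by (auto simp: cis_multiple_2pi)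
qed

lemma test_cos: "(\<lambda>z. cos (phase k z)) \<in> test_functions"
  and test_sin: "(\<lambda>z. sin (phase k z)) \<in> test_functions"
proof -
  have "torus_periodic (\<lambda>z. cos (phase k z))" "torus_periodic (\<lambda>z. sin (phase k z))"
    using cis_phase_periodic[of k] by (simp_all add: torus_periodic_def cis.code)
  then show "(\<lambda>z. cos (phase k z)) \<in> test_functions" "(\<lambda>z. sin (phase k z)) \<in> test_functions"
    by (auto intro: testI simp: continuously_differentiable_trig)
qed

lemma deriv_shift: "deriv f (x + c) = deriv (\<lambda>s. f (s + c)) (x::real)"
  by (simp add: deriv_def DERIV_shift)

lemma test_dx1: "\<phi> \<in> test_functions \<Longrightarrow> dx1 \<phi> \<in> test_functions"
  and test_dx2: "\<phi> \<in> test_functions \<Longrightarrow> dx2 \<phi> \<in> test_functions"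
proof -
  assume \<phi>: "\<phi> \<in> test_functions"
  then have p: "\<phi> (x + 2 * pi, y) = \<phi> (x, y)" "\<phi> (x, y + 2 * pi) = \<phi> (x, y)" for x y
    using testD(1) unfolding torus_periodic_def by blast+
  have 1: "torus_periodic (dx1 \<phi>)" "torus_periodic (dx2 \<phi>)"
    unfolding torus_periodic_def dx1_def dx2_def by (simp_all add: deriv_shift p)
  have 2: "continuously_differentiable n (dx1 \<phi>)" "continuously_differentiable n (dx2 \<phi>)" for n
    using testD(2)[OF \<phi>, of "Suc n"] by (simp_all del: split_paired_All)
  show "dx1 \<phi> \<in> test_functions" "dx2 \<phi> \<in> test_functions"
    by (rule testI, rule 1, rule 2)+
qed

lemma space_torus: "space torus_measure = {0..<2 * pi} \<times> {0..<2 * pi}"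
  by (simp add: torus_measure_def space_restrict_space)

lemma square_borel: "{0..<2 * pi} \<times> {0..<2 * pi} \<in> sets (borel :: plane measure)"
  unfolding borel_prod[symmetric] by (intro pair_measureI) auto

lemma emeasure_torus: "emeasure torus_measure (space torus_measure) = ennreal ((2 * pi)\<^sup>2)"
proof -
  have "emeasure torus_measure (space torus_measure) = emeasure (lborel :: plane measure) ({0..<2 * pi} \<times> {0..<2 * pi})"
    unfolding space_torus unfolding torus_measure_def
    by (subst emeasure_restrict_space) (auto simp: square_borel)
  also have "\<dots> = emeasure lborel {0..<2 * pi} * emeasure lborel {0..<2 * pi}"
    unfolding lborel_prod[symmetric] by (rule lborel.emeasure_pair_measure_Times) auto
  finally show ?thesis by (simp add: power2_eq_square ennreal_mult[symmetric])
qed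

interpretation torus: finite_measure torus_measure
  by standard (simp add: emeasure_torus)

lemma measure_torus: "measure torus_measure (space torus_measure) = (2 * pi)\<^sup>2"
  by (simp add: measure_def emeasure_torus)

lemma borel_measurable_torus: "f \<in> borel_measurable borel \<Longrightarrow> f \<in> borel_measurable torus_measure"
  unfolding torus_measure_def by (intro measurable_restrict_space1) simp

lemma continuous_measurable_torus: "continuous_on UNIV f \<Longrightarrow> f \<in> borel_measurable torus_measure"
  by (intro borel_measurable_torus borel_measurable_continuous_onI)

lemma continuous_bounded_torus:
  fixes f :: "plane \<Rightarrow> 'a :: real_normed_vector"
  assumes "continuous_on UNIV f"
  obtains B where "0 \<le> B" "\<And>z. z \<in> space torus_measure \<Longrightarrow> norm (f z) \<le> B"
proof -
  have "compact (f ` ({0..2 * pi} \<times> {0..2 * pi}))"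
    by (intro compact_continuous_image continuous_on_subset[OF assms] compact_Times) auto
  then obtain B where B: "\<And>z. z \<in> {0..2 * pi} \<times> {0..2 * pi} \<Longrightarrow> norm (f z) \<le> B"
    using compact_imp_bounded bounded_iff by (metis imageI)
  have "0 \<le> norm (f (0, 0))" by simp
  also have "\<dots> \<le> B" by (rule B) auto
  finally show thesis
    by (rule that) (rule B, auto simp: space_torus)
qed

lemma integrable_continuous_torus:
  fixes f :: "plane \<Rightarrow> 'a :: {banach, second_countable_topology}"
  assumes "continuous_on UNIV f"
  shows "integrable torus_measure f"
proof -
  obtain B where B: "0 \<le> B" "\<And>z. z \<in> space torus_measure \<Longrightarrow> norm (f z) \<le> B"
    using continuous_bounded_torus[OF assms] by blast
  show ?thesis
    by (rule torus.integrable_const_bound[of _ B])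
       (use B in \<open>auto intro: continuous_measurable_torus assms\<close>)
qed

lemma integral_deriv_period:
  fixes g g' :: "real \<Rightarrow> real"
  assumes "\<And>x. (g has_real_derivative g' x) (at x)" "continuous_on UNIV g'" "0 \<le> (c::real)"
  shows "(\<integral>x. indicator {0..<c} x * g' x \<partial>lborel) = g c - g 0"
proof -
  have "(\<integral>x. indicator {0..<c} x * g' x \<partial>lborel) = (\<integral>x. indicator {0..c} x *\<^sub>R g' x \<partial>lborel)"
  proof (rule integral_cong_AE)
    show "AE x in lborel. indicator {0..<c} x * g' x = indicator {0..c} x *\<^sub>R g' x"
      using AE_lborel_singleton[of c] by eventually_elim (auto simp: indicator_def)
    have "g' \<in> borel_measurable borel"
      by (rule borel_measurable_continuous_onI[OF assms(2)])
    then show "(\<lambda>x. indicator {0..<c} x * g' x) \<in> borel_measurable lborel"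
      "(\<lambda>x. indicator {0..c} x *\<^sub>R g' x) \<in> borel_measurable lborel"
      by simp_all
  qed
  also have "\<dots> = g c - g 0"
  proof (rule integral_FTC_atLeastAtMost)
    show "(g has_vector_derivative g' x) (at x within {0..c})" for x
      using assms(1)[of x] has_field_derivative_at_within
      by (simp add: has_real_derivative_iff_has_vector_derivative[symmetric] has_field_derivative_at_within)
    show "continuous_on {0..c} g'"
      by (rule continuous_on_subset[OF assms(2)]) simp
  qed (rule assms)
  finally show ?thesis .
qed

lemma integral_torus:
  assumes "continuous_on UNIV (f :: plane \<Rightarrow> real)"
  shows "(\<integral>z. f z \<partial>torus_measure) =
    (\<integral>y. indicator {0..<2*pi} y * (\<integral>x. indicator {0..<2*pi} x * f (x, y) \<partial>lborel) \<partial>lborel)"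
    and "(\<integral>z. f z \<partial>torus_measure) =
    (\<integral>x. indicator {0..<2*pi} x * (\<integral>y. indicator {0..<2*pi} y * f (x, y) \<partial>lborel) \<partial>lborel)"
proof -
  let ?Q = "{0..<2 * pi} \<times> {0..<2 * pi}"
  let ?F = "\<lambda>x y. indicator {0..<2*pi} x * indicator {0..<2*pi} y * f (x, y)"
  have Q: "?Q \<inter> space lborel \<in> sets (lborel :: plane measure)" by (simp add: square_borel)
  have ind: "indicator ?Q z *\<^sub>R f z = case_prod ?F z" for z
    by (cases z) (auto simp: indicator_def)
  have "integrable torus_measure f" by (rule integrable_continuous_torus[OF assms])
  then have i: "integrable (lborel \<Otimes>\<^sub>M lborel) (case_prod ?F)"
    unfolding torus_measure_def integrable_restrict_space[OF Q] ind lborel_prod .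
  have e: "(\<integral>z. f z \<partial>torus_measure) = integral\<^sup>L (lborel \<Otimes>\<^sub>M lborel) (case_prod ?F)"
    unfolding torus_measure_def integral_restrict_space[OF Q] ind lborel_prod ..
  have 1: "(\<integral>x. ?F x y \<partial>lborel) = indicator {0..<2*pi} y * (\<integral>x. indicator {0..<2*pi} x * f (x, y) \<partial>lborel)" for y
    unfolding integral_mult_right_zero[symmetric] by (rule Bochner_Integration.integral_cong) (simp_all add: mult_ac)
  have 2: "(\<integral>y. ?F x y \<partial>lborel) = indicator {0..<2*pi} x * (\<integral>y. indicator {0..<2*pi} y * f (x, y) \<partial>lborel)" for x
    unfolding integral_mult_right_zero[symmetric] by (rule Bochner_Integration.integral_cong) (simp_all add: mult_ac)
  show "(\<integral>z. f z \<partial>torus_measure) =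
    (\<integral>y. indicator {0..<2*pi} y * (\<integral>x. indicator {0..<2*pi} x * f (x, y) \<partial>lborel) \<partial>lborel)"
    unfolding e lborel_pair.integral_snd[OF i, symmetric] 1 ..
  show "(\<integral>z. f z \<partial>torus_measure) =
    (\<integral>x. indicator {0..<2*pi} x * (\<integral>y. indicator {0..<2*pi} y * f (x, y) \<partial>lborel) \<partial>lborel)"
    unfolding e lborel_pair.integral_fst[OF i, symmetric] 2 ..
qed

text \<open>
  Integrating over one period in the variable of differentiation first gives zero by periodicity.
  Applied to products with \<open>cos\<close> and \<open>sin\<close> this is integration by parts.
\<close>

lemma integral_dx_eq_0:
  assumes "\<phi> \<in> test_functions"
  shows "(\<integral>z. dx1 \<phi> z \<partial>torus_measure) = 0" "(\<integral>z. dx2 \<phi> z \<partial>torus_measure) = 0"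
proof -
  have p: "\<phi> (0 + 2 * pi, y) = \<phi> (0, y)" "\<phi> (x, 0 + 2 * pi) = \<phi> (x, 0)" for x y
    using assms unfolding test_functions_def torus_periodic_def by blast+
  have c: "continuous_on UNIV (dx1 \<phi>)" "continuous_on UNIV (dx2 \<phi>)"
    using assms test_continuous test_dx1 test_dx2 by blast+
  have c1: "continuous_on UNIV (\<lambda>x. dx1 \<phi> (x, y))" for y
    by (rule continuous_on_compose2[OF c(1)]) (auto intro: continuous_on_Pair)
  have c2: "continuous_on UNIV (\<lambda>y. dx2 \<phi> (x, y))" for x
    by (rule continuous_on_compose2[OF c(2)]) (auto intro: continuous_on_Pair)
  have "(\<integral>x. indicator {0..<2*pi} x * dx1 \<phi> (x, y) \<partial>lborel) = 0" for y
    using integral_deriv_period[OF has_dx1[OF test_differentiable[OF assms]] c1, of "2 * pi" y] p(1)[of y] by simp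
  then show "(\<integral>z. dx1 \<phi> z \<partial>torus_measure) = 0"
    unfolding integral_torus(1)[OF c(1)] by simp
  have "(\<integral>y. indicator {0..<2*pi} y * dx2 \<phi> (x, y) \<partial>lborel) = 0" for x
    using integral_deriv_period[OF has_dx2[OF test_differentiable[OF assms]] c2, of "2 * pi" x] p(2)[of x] by simp
  then show "(\<integral>z. dx2 \<phi> z \<partial>torus_measure) = 0"
    unfolding integral_torus(2)[OF c(2)] by simp
qed



section \<open>Fourier series of smooth functions\<close>

text \<open>
  These are the coefficients of the real smooth functions: the second condition says that the sum of
  the series is real.
\<close>

definition smooth_coeffs :: "(int \<times> int \<Rightarrow> complex) \<Rightarrow> bool" where
  "smooth_coeffs a \<longleftrightarrow> rapid a \<and> (\<forall>k. a (- k) = cnj (a k))"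

lemma smooth_coeffsD:
  assumes "smooth_coeffs a"
  shows "rapid a" "a (- k) = cnj (a k)"
  using assms unfolding smooth_coeffs_def by blast+

definition fourier_series :: "(int \<times> int \<Rightarrow> complex) \<Rightarrow> plane \<Rightarrow> complex" where
  "fourier_series a z = (\<Sum>\<^sub>\<infinity>k. a k * cis (phase k z))"

definition real_series :: "(int \<times> int \<Rightarrow> complex) \<Rightarrow> plane \<Rightarrow> real" where
  "real_series a z = Re (fourier_series a z)"

lemma fourier_series_summable:
  "rapid a \<Longrightarrow> (\<lambda>k. a k * cis (phase k z)) summable_on UNIV"
  by (rule abs_summable_summable) (simp add: norm_mult rapid_abs_summable)

lemma norm_fourier_series_le: "rapid a \<Longrightarrow> norm (fourier_series a z) \<le> (\<Sum>\<^sub>\<infinity>k. norm (a k))"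
  unfolding fourier_series_def by (rule order_trans[OF norm_infsum_bound]) (simp_all add: norm_mult rapid_abs_summable)

lemma norm_cis_diff_le: "norm (cis s - cis t) \<le> \<bar>s - t\<bar>"
proof -
  have "cis s - cis t = cis t * (exp (\<i> * of_real (s - t)) - 1)"
    unfolding cis_conv_exp[symmetric] right_diff_distrib cis_mult by simp
  then have "norm (cis s - cis t) = 2 * \<bar>sin ((s - t) / 2)\<bar>"
    by (simp add: norm_mult dist_exp_i_1 del: of_real_diff)
  also have "\<dots> \<le> 2 * \<bar>(s - t) / 2\<bar>"
    by (intro mult_left_mono abs_sin_x_le_abs_x) simp
  finally show ?thesis by simp
qed

lemma phase_diff_le: "\<bar>phase k z - phase k w\<bar> \<le> wt k * dist z w"
proof -
  have "phase k z - phase k w = of_int (fst k) * (fst z - fst w) + of_int (snd k) * (snd z - snd w)"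
    by (simp add: phase_def algebra_simps)
  also have "\<bar>\<dots>\<bar> \<le> \<bar>of_int (fst k)\<bar> * dist (fst z) (fst w) + \<bar>of_int (snd k)\<bar> * dist (snd z) (snd w)"
    by (rule order_trans[OF abs_triangle_ineq]) (simp add: abs_mult dist_real_def)
  also have "\<dots> \<le> \<bar>of_int (fst k)\<bar> * dist z w + \<bar>of_int (snd k)\<bar> * dist z w"
    by (intro add_mono mult_left_mono dist_fst_le dist_snd_le) auto
  also have "\<dots> \<le> wt k * dist z w"
    by (simp add: wt_def distrib_right)
  finally show ?thesis .
qed

lemma fourier_series_lipschitz:
  assumes a: "rapid a"
  shows "norm (fourier_series a z - fourier_series a w) \<le> (\<Sum>\<^sub>\<infinity>k. norm (a k) * wt k) * dist z w"
proof -
  have s: "(\<lambda>k. norm (a k) * wt k * dist z w) summable_on UNIV"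
    using rapid_summable[OF a, of 1] by (intro summable_on_cmult_left) simp
  have le: "norm (a k * cis (phase k z) - a k * cis (phase k w)) \<le> norm (a k) * wt k * dist z w" for k
  proof -
    have "norm (a k * cis (phase k z) - a k * cis (phase k w)) = norm (a k) * norm (cis (phase k z) - cis (phase k w))"
      by (simp add: norm_mult right_diff_distrib[symmetric])
    also have "\<dots> \<le> norm (a k) * (wt k * dist z w)"
      by (intro mult_left_mono order_trans[OF norm_cis_diff_le phase_diff_le]) auto
    finally show ?thesis by (simp add: mult.assoc)
  qed
  have abs: "(\<lambda>k. norm (a k * cis (phase k z) - a k * cis (phase k w))) summable_on UNIV"
    by (rule summable_on_comparison_test[OF s]) (use le in auto)
  have "fourier_series a z - fourier_series a w = (\<Sum>\<^sub>\<infinity>k. a k * cis (phase k z) - a k * cis (phase k w))"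
    using infsumI[OF has_sum_add[OF has_sum_infsum[OF fourier_series_summable[OF a, of z]]
          has_sum_uminusI[OF has_sum_infsum[OF fourier_series_summable[OF a, of w]]]]]
    by (simp add: fourier_series_def)
  then have "norm (fourier_series a z - fourier_series a w) \<le> (\<Sum>\<^sub>\<infinity>k. norm (a k * cis (phase k z) - a k * cis (phase k w)))"
    using norm_infsum_bound[OF abs] by simp
  also have "\<dots> \<le> (\<Sum>\<^sub>\<infinity>k. norm (a k) * wt k * dist z w)"
    by (intro infsum_mono abs s le)
  finally show ?thesis by (simp add: infsum_cmult_left')
qed

lemma continuous_fourier_series:
  assumes "rapid a" shows "continuous_on S (fourier_series a)"
proof -
  have "0 \<le> (\<Sum>\<^sub>\<infinity>k. norm (a k) * wt k)"
    by (intro infsum_nonneg mult_nonneg_nonneg) (auto intro: less_imp_le[OF wt_pos])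
  then have "(\<Sum>\<^sub>\<infinity>k. norm (a k) * wt k)-lipschitz_on S (fourier_series a)"
    by (intro lipschitz_onI) (auto simp: dist_norm[of "fourier_series a _"] fourier_series_lipschitz[OF assms])
  then show ?thesis by (rule lipschitz_on_continuous_on)
qed

lemma continuous_real_series: "rapid a \<Longrightarrow> continuous_on S (real_series a)"
  unfolding real_series_def[abs_def] by (intro continuous_intros continuous_fourier_series)

lemma fourier_series_periodic: "fourier_series a (x + 2 * pi, y) = fourier_series a (x, y)" "fourier_series a (x, y + 2 * pi) = fourier_series a (x, y)"
  by (simp_all add: fourier_series_def cis_phase_periodic)

text \<open>
  A bounded Lipschitz function is Hoelder continuous of every exponent between 0 and 1: use the
  Lipschitz bound at distances at most 1 and the bound on the function at larger distances.
\<close>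

lemma real_series_holder:
  assumes a: "rapid a" and \<beta>: "0 \<le> \<beta>" "\<beta> \<le> 1"
  shows "real_series a \<in> holder_space \<beta>"
proof -
  define L where "L = (\<Sum>\<^sub>\<infinity>k. norm (a k) * wt k)"
  define B where "B = (\<Sum>\<^sub>\<infinity>k. norm (a k))"
  have nn: "0 \<le> L" "0 \<le> B" unfolding L_def B_def
    by (intro infsum_nonneg mult_nonneg_nonneg; auto intro: less_imp_le[OF wt_pos])+
  have "\<bar>real_series a z - real_series a w\<bar> \<le> (L + 2 * B) * dist z w powr \<beta>" for z w
  proof (cases "z = w")
    case False
    then have d: "0 < dist z w" by simp
    have "\<bar>real_series a z - real_series a w\<bar> \<le> norm (fourier_series a z - fourier_series a w)"
      unfolding real_series_def minus_complex.sel[symmetric] by (rule abs_Re_le_cmod)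
    then have 1: "\<bar>real_series a z - real_series a w\<bar> \<le> L * dist z w" and 2: "\<bar>real_series a z - real_series a w\<bar> \<le> 2 * B"
      using fourier_series_lipschitz[OF a, of z w] norm_triangle_ineq4[of "fourier_series a z" "fourier_series a w"]
        norm_fourier_series_le[OF a, of z] norm_fourier_series_le[OF a, of w] by (simp_all add: L_def B_def)
    show ?thesis
    proof (cases "dist z w \<le> 1")
      case True
      have "dist z w = dist z w powr 1" using d by simp
      also have "\<dots> \<le> dist z w powr \<beta>" using d True \<beta> by (intro powr_mono') auto
      finally have "L * dist z w \<le> L * dist z w powr \<beta>" using nn by (intro mult_left_mono)
      also have "\<dots> \<le> (L + 2 * B) * dist z w powr \<beta>" using nn by (intro mult_right_mono) auto
      finally show ?thesis using 1 by linarith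
    next
      case False
      then have "1 \<le> dist z w powr \<beta>" using \<beta> by (intro ge_one_powr_ge_zero) auto
      then have "(L + 2 * B) * 1 \<le> (L + 2 * B) * dist z w powr \<beta>"
        using nn by (intro mult_left_mono) auto
      with 2 nn show ?thesis by (smt (verit) mult.right_neutral)
    qed
  qed simp
  then have "\<exists>C. \<forall>z w. \<bar>real_series a z - real_series a w\<bar> \<le> C * dist z w powr \<beta>" by blast
  moreover have "torus_periodic (real_series a)"
    by (simp add: torus_periodic_def real_series_def fourier_series_periodic)
  ultimately show ?thesis
    using continuous_real_series[OF a, of UNIV] unfolding holder_space_def by blast
qed

lemma fourier_series_eq_real_series:
  assumes a: "smooth_coeffs a"
  shows "fourier_series a z = of_real (real_series a z)"
proof -
  have "cnj (fourier_series a z) = (\<Sum>\<^sub>\<infinity>k. a (- k) * cis (phase (- k) z))"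
    unfolding fourier_series_def infsum_cnj[symmetric]
    by (rule infsum_cong) (simp add: smooth_coeffsD(2)[OF a] cis_cnj phase_def)
  also have "\<dots> = fourier_series a z"
    unfolding fourier_series_def by (rule infsum_reindex_bij_betw) (auto intro!: bij_betwI[of _ _ _ uminus])
  finally show ?thesis
    by (simp add: real_series_def complex_eq_iff)
qed

text \<open>
  Sum and integral may be exchanged because the terms are dominated by \<open>norm (a k)\<close> times a bound
  for \<open>\<phi>\<close>. Dominated exchange is available for sequences, hence the enumeration \<open>e\<close> of the modes.
\<close>

lemma integral_fourier_series:
  assumes a: "rapid a" and \<phi>: "continuous_on UNIV \<phi>"
  shows "(\<integral>z. fourier_series a z * \<phi> z \<partial>torus_measure) = (\<Sum>\<^sub>\<infinity>k. a k * (\<integral>z. cis (phase k z) * \<phi> z \<partial>torus_measure))"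
    and "(\<lambda>k. a k * (\<integral>z. cis (phase k z) * \<phi> z \<partial>torus_measure)) summable_on UNIV"
proof -
  define e where "e = from_nat_into (UNIV :: (int \<times> int) set)"
  have e: "bij_betw e UNIV UNIV"
    unfolding e_def by (rule bij_betw_from_nat_into) (auto simp: finite_prod infinite_UNIV_int)
  let ?t = "\<lambda>k z. a k * cis (phase k z) * \<phi> z"
  obtain B where B: "0 \<le> B" "\<And>z. z \<in> space torus_measure \<Longrightarrow> norm (\<phi> z) \<le> B"
    using continuous_bounded_torus[OF \<phi>] by blast
  have cont: "continuous_on UNIV (\<lambda>z. cis (phase k z))" for k
    by (intro continuous_intros)
  have ti: "integrable torus_measure (?t k)" for k
    by (intro integrable_continuous_torus continuous_intros \<phi>)
  have pb: "norm (\<integral>z. cis (phase k z) * \<phi> z \<partial>torus_measure) \<le> (2 * pi)\<^sup>2 * B" for k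
  proof -
    have "norm (\<integral>z. cis (phase k z) * \<phi> z \<partial>torus_measure) \<le> (\<integral>z. norm (cis (phase k z) * \<phi> z) \<partial>torus_measure)"
      by (rule integral_norm_bound)
    also have "\<dots> \<le> (\<integral>z. B \<partial>torus_measure)"
      by (intro integral_mono integrable_norm integrable_continuous_torus continuous_intros \<phi>)
         (use B in \<open>auto simp: norm_mult\<close>)
    finally show ?thesis by (simp add: measure_torus)
  qed
  show sm: "(\<lambda>k. a k * (\<integral>z. cis (phase k z) * \<phi> z \<partial>torus_measure)) summable_on UNIV"
  proof (rule abs_summable_summable, rule summable_on_comparison_test)
    show "(\<lambda>k. norm (a k) * ((2 * pi)\<^sup>2 * B)) summable_on UNIV"
      by (intro summable_on_cmult_left rapid_abs_summable a)
    fix k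
    show "norm (a k * (\<integral>z. cis (phase k z) * \<phi> z \<partial>torus_measure)) \<le> norm (a k) * ((2 * pi)\<^sup>2 * B)"
      unfolding norm_mult by (intro mult_left_mono pb) simp
  qed simp
  have "(\<lambda>i. norm (a (e i))) summable_on UNIV"
    using rapid_abs_summable[OF a] summable_on_reindex_bij_betw[OF e, of "\<lambda>k. norm (a k)"] by simp
  then have sa: "summable (\<lambda>i. norm (a (e i)))"
    by (rule summable_on_imp_summable)
  have s1: "summable (\<lambda>i. norm (?t (e i) z))" for z
    using summable_mult2[OF sa, of "norm (\<phi> z)"] by (simp add: norm_mult)
  have c1: "fourier_series a z * \<phi> z = (\<Sum>i. ?t (e i) z)" for z
  proof -
    have "((\<lambda>k. a k * cis (phase k z)) has_sum fourier_series a z) UNIV"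
      unfolding fourier_series_def by (intro has_sum_infsum fourier_series_summable a)
    then have "((\<lambda>k. ?t k z) has_sum (fourier_series a z * \<phi> z)) UNIV"
      by (rule has_sum_cmult_left)
    then have "((\<lambda>i. ?t (e i) z) has_sum (fourier_series a z * \<phi> z)) UNIV"
      by (rule has_sum_reindex_bij_betw[OF e, of "\<lambda>k. ?t k z", THEN iffD2])
    then show ?thesis by (intro sums_unique has_sum_imp_sums)
  qed
  have s2: "summable (\<lambda>i. \<integral>z. norm (?t (e i) z) \<partial>torus_measure)"
  proof (rule summable_comparison_test')
    show "summable (\<lambda>i. norm (a (e i)) * ((2 * pi)\<^sup>2 * B))"
      by (intro summable_mult2 sa)
    fix i
    have "(\<integral>z. norm (?t (e i) z) \<partial>torus_measure) \<le> (\<integral>z. norm (a (e i)) * B \<partial>torus_measure)"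
      by (intro integral_mono integrable_norm ti)
         (use B in \<open>auto simp: norm_mult intro!: mult_left_mono\<close>)
    then show "norm (\<integral>z. norm (?t (e i) z) \<partial>torus_measure) \<le> norm (a (e i)) * ((2 * pi)\<^sup>2 * B)"
      by (simp add: measure_torus integral_nonneg_AE mult_ac)
  qed
  have "(\<integral>z. fourier_series a z * \<phi> z \<partial>torus_measure) = (\<Sum>i. \<integral>z. ?t (e i) z \<partial>torus_measure)"
    unfolding c1 by (rule integral_suminf[OF ti AE_I2 s2]) (rule s1)
  also have "\<dots> = (\<Sum>i. a (e i) * (\<integral>z. cis (phase (e i) z) * \<phi> z \<partial>torus_measure))"
    by (simp add: mult.assoc)
  also have "\<dots> = (\<Sum>\<^sub>\<infinity>k. a k * (\<integral>z. cis (phase k z) * \<phi> z \<partial>torus_measure))"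
  proof (rule sums_unique[symmetric], rule has_sum_imp_sums)
    show "((\<lambda>i. a (e i) * (\<integral>z. cis (phase (e i) z) * \<phi> z \<partial>torus_measure)) has_sum
       (\<Sum>\<^sub>\<infinity>k. a k * (\<integral>z. cis (phase k z) * \<phi> z \<partial>torus_measure))) UNIV"
      using has_sum_reindex_bij_betw[OF e, of "\<lambda>k. a k * (\<integral>z. cis (phase k z) * \<phi> z \<partial>torus_measure)"]
        has_sum_infsum[OF sm] by simp
  qed
  finally show "(\<integral>z. fourier_series a z * \<phi> z \<partial>torus_measure) = (\<Sum>\<^sub>\<infinity>k. a k * (\<integral>z. cis (phase k z) * \<phi> z \<partial>torus_measure))" .
qed

definition mode_pairing :: "int \<times> int \<Rightarrow> (plane \<Rightarrow> real) \<Rightarrow> complex" where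
  "mode_pairing k \<phi> = (\<integral>z. cis (phase k z) * of_real (\<phi> z) \<partial>torus_measure)"

lemma mode_pairing_eq:
  assumes "continuous_on UNIV \<phi>"
  shows "mode_pairing k \<phi> = Complex (\<integral>z. cos (phase k z) * \<phi> z \<partial>torus_measure) (\<integral>z. sin (phase k z) * \<phi> z \<partial>torus_measure)"
proof -
  have i: "integrable torus_measure (\<lambda>z. cis (phase k z) * of_real (\<phi> z))"
    by (intro integrable_continuous_torus continuous_intros assms)
  show ?thesis
    unfolding mode_pairing_def complex_eq_iff integral_Re[OF i, symmetric] integral_Im[OF i, symmetric]
    by (simp)
qed

lemma phase_uminus: "phase (- k) z = - phase k z"
  by (simp add: phase_def)

lemma fourier_coeff_dist_of:
  assumes "continuous_on UNIV \<phi>"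
  shows "fourier_coeff (dist_of \<phi>) k = mode_pairing (- k) \<phi> / of_real ((2 * pi)\<^sup>2)"
  by (simp add: fourier_coeff_def dist_of_def mode_pairing_eq[OF assms] phase_uminus mult.commute complex_eq_iff)

text \<open>
  Only trigonometric functions enter, and these are test functions. Consequently all the operators
  of the weak formulation may be computed from any representing series.
\<close>

lemma fourier_coeff_cong: "dist_eq S T \<Longrightarrow> fourier_coeff S = fourier_coeff T"
  by (auto simp: dist_eq_def fourier_coeff_def fun_eq_iff test_cos test_sin)

lemma mode_pairing_dx:
  assumes "\<phi> \<in> test_functions"
  shows "mode_pairing k (dx1 \<phi>) = - \<i> * of_int (fst k) * mode_pairing k \<phi>"
    and "mode_pairing k (dx2 \<phi>) = - \<i> * of_int (snd k) * mode_pairing k \<phi>"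
proof -
  note c = test_continuous[OF assms] test_continuous[OF test_dx1[OF assms]] test_continuous[OF test_dx2[OF assms]]
  have i: "integrable torus_measure (\<lambda>z. cos (phase k z) * v z)"
      "integrable torus_measure (\<lambda>z. sin (phase k z) * v z)"
    if "continuous_on UNIV v" for v :: "plane \<Rightarrow> real"
    by (intro integrable_continuous_torus continuous_intros that)+
  have D: "dx1 (\<lambda>z. cos (phase k z) * \<phi> z) = (\<lambda>z. cos (phase k z) * dx1 \<phi> z - of_int (fst k) * (sin (phase k z) * \<phi> z))"
    "dx2 (\<lambda>z. cos (phase k z) * \<phi> z) = (\<lambda>z. cos (phase k z) * dx2 \<phi> z - of_int (snd k) * (sin (phase k z) * \<phi> z))"
    "dx1 (\<lambda>z. sin (phase k z) * \<phi> z) = (\<lambda>z. sin (phase k z) * dx1 \<phi> z + of_int (fst k) * (cos (phase k z) * \<phi> z))"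
    "dx2 (\<lambda>z. sin (phase k z) * \<phi> z) = (\<lambda>z. sin (phase k z) * dx2 \<phi> z + of_int (snd k) * (cos (phase k z) * \<phi> z))"
    using dx_mult[OF differentiable_cos_sin_phase(1) test_differentiable[OF assms]]
      dx_mult[OF differentiable_cos_sin_phase(2) test_differentiable[OF assms]]
    by (simp_all add: dx_cos_phase dx_sin_phase mult.assoc)
  note z = integral_dx_eq_0[OF test_mult[OF test_cos assms], of k] integral_dx_eq_0[OF test_mult[OF test_sin assms], of k]
  have "(\<integral>z. cos (phase k z) * dx1 \<phi> z \<partial>torus_measure) = of_int (fst k) * (\<integral>z. sin (phase k z) * \<phi> z \<partial>torus_measure)"
    "(\<integral>z. cos (phase k z) * dx2 \<phi> z \<partial>torus_measure) = of_int (snd k) * (\<integral>z. sin (phase k z) * \<phi> z \<partial>torus_measure)"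
    "(\<integral>z. sin (phase k z) * dx1 \<phi> z \<partial>torus_measure) = - of_int (fst k) * (\<integral>z. cos (phase k z) * \<phi> z \<partial>torus_measure)"
    "(\<integral>z. sin (phase k z) * dx2 \<phi> z \<partial>torus_measure) = - of_int (snd k) * (\<integral>z. cos (phase k z) * \<phi> z \<partial>torus_measure)"
    using z unfolding D
    by (simp_all add: i c integrable_mult_right)
  then show "mode_pairing k (dx1 \<phi>) = - \<i> * of_int (fst k) * mode_pairing k \<phi>"
    "mode_pairing k (dx2 \<phi>) = - \<i> * of_int (snd k) * mode_pairing k \<phi>"
    by (simp_all add: mode_pairing_eq c complex_eq_iff)
qed

lemma mode_pairing_1: "mode_pairing k (\<lambda>z. 1) = (if k = 0 then of_real ((2 * pi)\<^sup>2) else 0)"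
proof (cases "k = 0")
  case True
  then show ?thesis by (simp add: mode_pairing_def phase_def measure_torus scaleR_conv_of_real)
next
  case False
  have "mode_pairing k (\<lambda>z. 0) = 0" by (simp add: mode_pairing_def)
  then have "of_int (fst k) * mode_pairing k (\<lambda>z. 1) = 0" "of_int (snd k) * mode_pairing k (\<lambda>z. 1) = 0"
    using mode_pairing_dx[OF test_const, of k 1] by (auto simp: dx_const)
  moreover have "fst k \<noteq> 0 \<or> snd k \<noteq> 0" using False by (auto simp: prod_eq_iff)
  ultimately show ?thesis using False by auto
qed

lemma dist_of_real_series:
  assumes a: "smooth_coeffs a" and \<phi>: "continuous_on UNIV \<phi>"
  shows "dist_of (real_series a) \<phi> = (\<Sum>\<^sub>\<infinity>k. Re (a k * mode_pairing k \<phi>))"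
    and "(\<lambda>k. a k * mode_pairing k \<phi>) summable_on UNIV"
    and "of_real (dist_of (real_series a) \<phi>) = (\<Sum>\<^sub>\<infinity>k. a k * mode_pairing k \<phi>)"
proof -
  have c: "continuous_on UNIV (\<lambda>z. complex_of_real (\<phi> z))" by (intro continuous_intros \<phi>)
  note r = smooth_coeffsD(1)[OF a]
  show s: "(\<lambda>k. a k * mode_pairing k \<phi>) summable_on UNIV"
    unfolding mode_pairing_def by (rule integral_fourier_series(2)[OF r c])
  have "of_real (dist_of (real_series a) \<phi>) = (\<integral>z. fourier_series a z * of_real (\<phi> z) \<partial>torus_measure)"
    by (simp add: dist_of_def fourier_series_eq_real_series[OF a] flip: of_real_mult)
  then show eq: "of_real (dist_of (real_series a) \<phi>) = (\<Sum>\<^sub>\<infinity>k. a k * mode_pairing k \<phi>)"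
    unfolding integral_fourier_series(1)[OF r c] mode_pairing_def .
  have "dist_of (real_series a) \<phi> = Re (\<Sum>\<^sub>\<infinity>k. a k * mode_pairing k \<phi>)"
    unfolding eq[symmetric] by simp
  then show "dist_of (real_series a) \<phi> = (\<Sum>\<^sub>\<infinity>k. Re (a k * mode_pairing k \<phi>))"
    unfolding infsum_Re[OF s] .
qed

text \<open>
  The series of the first factor is integrated term by term and each phase is shifted onto
  \<open>\<psi>\<close>, which stays unexpanded.
\<close>

lemma fourier_coeff_real_series_mult:
  assumes a: "smooth_coeffs a" and \<psi>: "continuous_on UNIV \<psi>"
  shows "fourier_coeff (dist_of (\<lambda>z. real_series a z * \<psi> z)) n = (\<Sum>\<^sub>\<infinity>k. a k * fourier_coeff (dist_of \<psi>) (n - k))"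
proof -
  note r = smooth_coeffsD(1)[OF a]
  have "mode_pairing (- n) (\<lambda>z. real_series a z * \<psi> z) = (\<integral>z. fourier_series a z * (of_real (\<psi> z) * cis (phase (- n) z)) \<partial>torus_measure)"
    by (simp add: mode_pairing_def fourier_series_eq_real_series[OF a] mult_ac)
  also have "\<dots> = (\<Sum>\<^sub>\<infinity>k. a k * (\<integral>z. cis (phase k z) * (of_real (\<psi> z) * cis (phase (- n) z)) \<partial>torus_measure))"
    by (intro integral_fourier_series r continuous_intros \<psi>)
  also have "\<dots> = (\<Sum>\<^sub>\<infinity>k. a k * mode_pairing (- (n - k)) \<psi>)"
    unfolding mode_pairing_def
  proof (intro infsum_cong arg_cong[of _ _ "\<lambda>t. _ * t"] Bochner_Integration.integral_cong refl)
    fix k z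
    have "phase (- (n - k)) z = phase k z + phase (- n) z"
      by (simp add: phase_def algebra_simps)
    then show "cis (phase k z) * (of_real (\<psi> z) * cis (phase (- n) z)) = cis (phase (- (n - k)) z) * of_real (\<psi> z)"
      by (simp add: cis_mult[symmetric])
  qed
  finally have *: "mode_pairing (- n) (\<lambda>z. real_series a z * \<psi> z) = (\<Sum>\<^sub>\<infinity>k. a k * mode_pairing (- (n - k)) \<psi>)" .
  have "continuous_on UNIV (\<lambda>z. real_series a z * \<psi> z)"
    by (intro continuous_intros continuous_real_series r \<psi>)
  then have "fourier_coeff (dist_of (\<lambda>z. real_series a z * \<psi> z)) n = (\<Sum>\<^sub>\<infinity>k. a k * mode_pairing (- (n - k)) \<psi>) * (1 / of_real ((2 * pi)\<^sup>2))"
    by (simp only: fourier_coeff_dist_of * divide_inverse mult_1)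
  also have "\<dots> = (\<Sum>\<^sub>\<infinity>k. a k * fourier_coeff (dist_of \<psi>) (n - k))"
    unfolding infsum_cmult_left'[symmetric] fourier_coeff_dist_of[OF \<psi>] by (simp add: mult_ac)
  finally show ?thesis .
qed

text \<open>
  Uniqueness of the coefficients is the product formula with the constant function 1.
\<close>

lemma fourier_coeff_real_series:
  assumes a: "smooth_coeffs a"
  shows "fourier_coeff (dist_of (real_series a)) n = a n"
proof -
  have "fourier_coeff (dist_of (\<lambda>z. real_series a z * 1)) n = (\<Sum>\<^sub>\<infinity>k. a k * fourier_coeff (dist_of (\<lambda>z. 1)) (n - k))"
    by (rule fourier_coeff_real_series_mult[OF a]) simp
  also have "\<dots> = (\<Sum>\<^sub>\<infinity>k. if k = n then a n else 0)"
    by (intro infsum_cong) (auto simp: fourier_coeff_dist_of mode_pairing_1)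
  also have "\<dots> = a n"
    by (rule infsumI, rule has_sum_finite_neutralI[of "{n}"]) auto
  finally show ?thesis by simp
qed

lemma mode_pairing_real_series:
  assumes "smooth_coeffs a"
  shows "mode_pairing k (real_series a) = of_real ((2 * pi)\<^sup>2) * a (- k)"
  using fourier_coeff_real_series[OF assms, of "- k"]
  by (simp add: fourier_coeff_dist_of continuous_real_series smooth_coeffsD(1)[OF assms] field_simps)

lemma smooth_coeffs_Lam: "smooth_coeffs a \<Longrightarrow> smooth_coeffs (\<lambda>k. of_real (Lam_symbol s k) * a k)"
  by (auto simp: smooth_coeffs_def rapid_Lam)

lemma Lam_dist_eq:
  assumes T: "fourier_coeff T = a" and a: "smooth_coeffs a"
  shows "dist_eq (Lam s T) (dist_of (real_series (\<lambda>k. of_real (Lam_symbol s k) * a k)))"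
  unfolding dist_eq_def
  using dist_of_real_series(1)[OF smooth_coeffs_Lam[OF a] test_continuous]
  by (simp add: Lam_def T mode_pairing_def)

lemma smooth_coeffs_deriv:
  assumes "smooth_coeffs a"
  shows "smooth_coeffs (\<lambda>k. \<i> * of_int (fst k) * a k)" "smooth_coeffs (\<lambda>k. \<i> * of_int (snd k) * a k)"
proof -
  have "rapid (\<lambda>k. \<i> * of_int (fst k) * a k)" "rapid (\<lambda>k. \<i> * of_int (snd k) * a k)"
    by (rule rapid_multiplier[OF smooth_coeffsD(1)[OF assms], of _ 1 1],
        simp add: norm_mult mult_right_mono abs_fst_le_wt abs_snd_le_wt)+
  then show "smooth_coeffs (\<lambda>k. \<i> * of_int (fst k) * a k)" "smooth_coeffs (\<lambda>k. \<i> * of_int (snd k) * a k)"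
    by (simp_all add: smooth_coeffs_def smooth_coeffsD(2)[OF assms] del: split_paired_All)
qed

lemma ddx_dist_eq:
  assumes a: "smooth_coeffs a" and T: "dist_eq T (dist_of (real_series a))"
  shows "dist_eq (ddx1 T) (dist_of (real_series (\<lambda>k. \<i> * of_int (fst k) * a k)))"
    and "dist_eq (ddx2 T) (dist_of (real_series (\<lambda>k. \<i> * of_int (snd k) * a k)))"
proof -
  have "ddx1 T \<phi> = dist_of (real_series (\<lambda>k. \<i> * of_int (fst k) * a k)) \<phi> \<and> ddx2 T \<phi> = dist_of (real_series (\<lambda>k. \<i> * of_int (snd k) * a k)) \<phi>"
    if \<phi>: "\<phi> \<in> test_functions" for \<phi>
  proof -
    note t = test_dx1[OF \<phi>] test_dx2[OF \<phi>]
    have "T (dx1 \<phi>) = dist_of (real_series a) (dx1 \<phi>)" "T (dx2 \<phi>) = dist_of (real_series a) (dx2 \<phi>)"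
      using T t by (auto simp: dist_eq_def)
    then have "ddx1 T \<phi> = - (\<Sum>\<^sub>\<infinity>k. Re (a k * mode_pairing k (dx1 \<phi>)))" "ddx2 T \<phi> = - (\<Sum>\<^sub>\<infinity>k. Re (a k * mode_pairing k (dx2 \<phi>)))"
      by (simp_all add: ddx1_def ddx2_def dist_of_real_series(1)[OF a] test_continuous t)
    then show ?thesis
      unfolding dist_of_real_series(1)[OF smooth_coeffs_deriv(1)[OF a] test_continuous[OF \<phi>]]
        dist_of_real_series(1)[OF smooth_coeffs_deriv(2)[OF a] test_continuous[OF \<phi>]]
      by (simp add: mode_pairing_dx[OF \<phi>] infsum_uminus[symmetric] algebra_simps)
  qed
  then show "dist_eq (ddx1 T) (dist_of (real_series (\<lambda>k. \<i> * of_int (fst k) * a k)))"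
    "dist_eq (ddx2 T) (dist_of (real_series (\<lambda>k. \<i> * of_int (snd k) * a k)))"
    by (auto simp: dist_eq_def)
qed

text \<open>
  Each derivative of \<open>\<phi>\<close> in a variable multiplies the coefficients by the matching component of \<open>k\<close>,
  and the coefficients of every derivative are bounded by its integral norm.
\<close>

lemma smooth_coeffs_test:
  assumes \<phi>: "\<phi> \<in> test_functions"
  shows "smooth_coeffs (fourier_coeff (dist_of \<phi>))"
  unfolding smooth_coeffs_def
proof (intro conjI allI)
  fix k
  show "fourier_coeff (dist_of \<phi>) (- k) = cnj (fourier_coeff (dist_of \<phi>) k)"
    by (simp add: fourier_coeff_dist_of test_continuous[OF \<phi>] mode_pairing_eq phase_uminus complex_eq_iff)
next
  have mode_pairing_bounded: "\<exists>C. \<forall>k. norm (mode_pairing k \<psi>) \<le> C" if \<psi>: "\<psi> \<in> test_functions" for \<psi>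
  proof -
    have "norm (mode_pairing k \<psi>) \<le> (\<integral>z. \<bar>\<psi> z\<bar> \<partial>torus_measure)" for k
      unfolding mode_pairing_def by (rule order_trans[OF integral_norm_bound]) (simp add: norm_mult)
    then show ?thesis by blast
  qed
  \<comment> \<open>The two components of \<open>k\<close> are gained one at a time, from derivatives in one variable each.\<close>
  have bnd: "\<exists>C. \<forall>k. norm (mode_pairing k \<psi>) * (1 + \<bar>of_int (fst k)\<bar>) ^ m * (1 + \<bar>of_int (snd k)\<bar>) ^ n \<le> C"
    if "\<psi> \<in> test_functions" for \<psi> m n
    using that
  proof (induction m arbitrary: \<psi>)
    case 0
    then show ?case
    proof (induction n arbitrary: \<psi>)
      case 0
      then show ?case using mode_pairing_bounded by simp
    next
      case (Suc n)
      obtain C where C: "\<And>k. norm (mode_pairing k \<psi>) * (1 + \<bar>of_int (fst k)\<bar>) ^ 0 * (1 + \<bar>of_int (snd k)\<bar>) ^ n \<le> C"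
        using Suc.IH[OF Suc.prems] by blast
      obtain D where D: "\<And>k. norm (mode_pairing k (dx2 \<psi>)) * (1 + \<bar>of_int (fst k)\<bar>) ^ 0 * (1 + \<bar>of_int (snd k)\<bar>) ^ n \<le> D"
        using Suc.IH[OF test_dx2[OF Suc.prems]] by blast
      show ?case
      proof (intro exI allI)
        fix k
        show "norm (mode_pairing k \<psi>) * (1 + \<bar>of_int (fst k)\<bar>) ^ 0 * (1 + \<bar>of_int (snd k)\<bar>) ^ Suc n \<le> C + D"
          using C[of k] D[of k] by (simp add: mode_pairing_dx[OF Suc.prems] norm_mult algebra_simps)
      qed
    qed
  next
    case (Suc m)
    obtain C where C: "\<And>k. norm (mode_pairing k \<psi>) * (1 + \<bar>of_int (fst k)\<bar>) ^ m * (1 + \<bar>of_int (snd k)\<bar>) ^ n \<le> C"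
      using Suc.IH[OF Suc.prems] by blast
    obtain D where D: "\<And>k. norm (mode_pairing k (dx1 \<psi>)) * (1 + \<bar>of_int (fst k)\<bar>) ^ m * (1 + \<bar>of_int (snd k)\<bar>) ^ n \<le> D"
      using Suc.IH[OF test_dx1[OF Suc.prems]] by blast
    show ?case
    proof (intro exI allI)
      fix k
      show "norm (mode_pairing k \<psi>) * (1 + \<bar>of_int (fst k)\<bar>) ^ Suc m * (1 + \<bar>of_int (snd k)\<bar>) ^ n \<le> C + D"
        using C[of k] D[of k] by (simp add: mode_pairing_dx[OF Suc.prems] norm_mult algebra_simps)
    qed
  qed
  show "rapid (fourier_coeff (dist_of \<phi>))"
    unfolding rapid_def
  proof (intro allI)
    fix N
    obtain C where C: "\<And>k. norm (mode_pairing k \<phi>) * (1 + \<bar>of_int (fst k)\<bar>) ^ N * (1 + \<bar>of_int (snd k)\<bar>) ^ N \<le> C"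
      using bnd[OF \<phi>] by blast
    show "\<exists>C. \<forall>k. norm (fourier_coeff (dist_of \<phi>) k) * wt k ^ N \<le> C"
    proof (intro exI allI)
      fix k
      have w: "wt k \<le> (1 + \<bar>of_int (fst k)\<bar>) * (1 + \<bar>of_int (snd k)\<bar>)"
        by (simp add: wt_def algebra_simps)
      have "norm (mode_pairing (- k) \<phi>) * wt k ^ N \<le> norm (mode_pairing (- k) \<phi>) * ((1 + \<bar>of_int (fst k)\<bar>) * (1 + \<bar>of_int (snd k)\<bar>)) ^ N"
        using wt_pos[of k] w by (intro mult_left_mono power_mono) auto
      also have "\<dots> \<le> C" using C[of "- k"] by (simp add: power_mult_distrib mult.assoc)
      finally have "norm (mode_pairing (- k) \<phi>) * wt k ^ N / (2 * pi)\<^sup>2 \<le> C / (2 * pi)\<^sup>2"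
        by (intro divide_right_mono) auto
      then show "norm (fourier_coeff (dist_of \<phi>) k) * wt k ^ N \<le> C / (2 * pi)\<^sup>2"
        by (simp add: fourier_coeff_dist_of test_continuous[OF \<phi>] norm_divide norm_power norm_mult)
    qed
  qed
qed



section \<open>Uniqueness of representing functions\<close>

text \<open>
  Continuous functions on the closed square do not separate opposite sides when they are periodic.
  Passing to the product of two circles removes this defect, and polynomials in the four real
  coordinates pull back to trigonometric polynomials, which are test functions.
\<close>

definition circle_pair :: "plane \<Rightarrow> complex \<times> complex" where
  "circle_pair z = (cis (fst z), cis (snd z))"

lemma inj_on_circle_pair: "inj_on circle_pair (space torus_measure)"
proof (rule inj_onI)
  fix z w
  assume z: "z \<in> space torus_measure" and w: "w \<in> space torus_measure" and e: "circle_pair z = circle_pair w"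
  have *: "x = y" if "cis x = cis y" "0 \<le> x" "x < 2 * pi" "0 \<le> y" "y < 2 * pi" for x y
  proof -
    obtain n :: int where n: "y = x + 2 * pi * n"
    proof -
      have "sin y = sin x" "cos y = cos x" using \<open>cis x = cis y\<close> by (simp_all add: complex_eq_iff)
      then show thesis using that sin_cos_eq_iff[of y x] by blast
    qed
    have "2 * pi * real_of_int n < 2 * pi * 1" "2 * pi * (- 1) < 2 * pi * real_of_int n"
      using that n by linarith+
    moreover have "0 < 2 * pi" by simp
    ultimately have "real_of_int n < 1" "- 1 < real_of_int n"
      using mult_less_cancel_left_pos by blast+
    then have "n = 0" by linarith
    then show ?thesis using n by simp
  qed
  show "z = w"
    using z w e unfolding circle_pair_def space_torus
    by (auto simp: prod_eq_iff intro: *)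
qed

lemma real_polynomial_circle_pair:
  "real_polynomial_function g \<Longrightarrow> (\<lambda>z. g (circle_pair z)) \<in> test_functions"
proof (induction rule: real_polynomial_function.induct)
  case (linear f)
  then interpret bounded_linear f .
  have "f (circle_pair z) = (cos (phase (1, 0) z) * f (1, 0) + sin (phase (1, 0) z) * f (\<i>, 0))
      + (cos (phase (0, 1) z) * f (0, 1) + sin (phase (0, 1) z) * f (0, \<i>))" for z
  proof -
    have "circle_pair z = (cos (fst z) *\<^sub>R (1, 0) + sin (fst z) *\<^sub>R (\<i>, 0)) + (cos (snd z) *\<^sub>R (0, 1) + sin (snd z) *\<^sub>R (0, \<i>))"
      by (simp add: circle_pair_def complex_eq_iff)
    then show ?thesis
      by (simp only: add scaleR) (simp add: phase_def)
  qed
  then show ?case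
    by (simp only:) (intro test_add test_mult test_cos test_sin test_const)
qed (intro test_add test_mult test_const; assumption)+

text \<open>
  By the Stone-Weierstrass theorem, polynomials approximate \<open>F\<close> uniformly on the torus.
\<close>

lemma integral_mult_continuous_circle_pair:
  fixes u :: "plane \<Rightarrow> real"
  assumes u: "integrable torus_measure u"
    and 0: "\<And>\<phi>. \<phi> \<in> test_functions \<Longrightarrow> (\<integral>z. u z * \<phi> z \<partial>torus_measure) = 0"
    and F: "continuous_on UNIV F"
  shows "(\<integral>z. u z * F (circle_pair z) \<partial>torus_measure) = 0"
proof -
  let ?S = "sphere 0 1 \<times> sphere 0 1 :: (complex \<times> complex) set"
  have cp: "continuous_on UNIV circle_pair"
    unfolding circle_pair_def[abs_def] by (intro continuous_intros)
  have iu: "integrable torus_measure (\<lambda>z. u z * h z)" if h: "continuous_on UNIV h" for h :: "plane \<Rightarrow> real"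
  proof -
    obtain B where B: "0 \<le> B" "\<And>z. z \<in> space torus_measure \<Longrightarrow> norm (h z) \<le> B"
      using continuous_bounded_torus[OF h] by blast
    have "(\<lambda>z. u z * h z) \<in> borel_measurable torus_measure"
      by (intro borel_measurable_times borel_measurable_integrable[OF u] continuous_measurable_torus h)
    then show ?thesis
    proof (rule Bochner_Integration.integrable_bound[OF integrable_mult_left[OF integrable_abs[OF u], of B]])
      show "AE z in torus_measure. norm (u z * h z) \<le> norm (\<bar>u z\<bar> * B)"
        using B by (intro AE_I2) (auto simp: abs_mult intro!: mult_left_mono)
    qed
  qed
  have FE: "continuous_on UNIV (\<lambda>z. F (circle_pair z))"
    by (rule continuous_on_compose2[OF F cp]) simp
  have "\<bar>\<integral>z. u z * F (circle_pair z) \<partial>torus_measure\<bar> \<le> e * (\<integral>z. \<bar>u z\<bar> \<partial>torus_measure)" if e: "0 < e" for e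
  proof -
    obtain g where g: "real_polynomial_function g" "\<And>x. x \<in> ?S \<Longrightarrow> \<bar>F x - g x\<bar> < e"
      by (rule Stone_Weierstrass_real_polynomial_function[of ?S F e])
         (auto intro: compact_Times continuous_on_subset[OF F] e)
    note t = real_polynomial_circle_pair[OF g(1)]
    have "(\<integral>z. u z * F (circle_pair z) \<partial>torus_measure) = (\<integral>z. u z * F (circle_pair z) - u z * g (circle_pair z) \<partial>torus_measure)"
      using 0[OF t] by (simp add: iu FE test_continuous[OF t])
    also have "\<bar>\<dots>\<bar> \<le> (\<integral>z. \<bar>u z * F (circle_pair z) - u z * g (circle_pair z)\<bar> \<partial>torus_measure)"
      by (rule integral_abs_bound)
    also have "\<dots> \<le> (\<integral>z. \<bar>u z\<bar> * e \<partial>torus_measure)"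
    proof (intro integral_mono integrable_abs Bochner_Integration.integrable_diff iu FE test_continuous[OF t] integrable_mult_left u)
      fix z
      have "circle_pair z \<in> ?S" by (simp add: circle_pair_def)
      then show "\<bar>u z * F (circle_pair z) - u z * g (circle_pair z)\<bar> \<le> \<bar>u z\<bar> * e"
        using g(2)[of "circle_pair z"] by (simp add: right_diff_distrib[symmetric] abs_mult mult_left_mono)
    qed
    finally show ?thesis by (simp add: mult.commute)
  qed
  note le = this
  define I J where "I = \<bar>\<integral>z. u z * F (circle_pair z) \<partial>torus_measure\<bar>" and "J = (\<integral>z. \<bar>u z\<bar> \<partial>torus_measure)"
  have "I \<le> 0 + e" if "0 < e" for e
  proof -
    have J: "0 \<le> J" unfolding J_def by simp
    have "I \<le> e / (J + 1) * J"
      using le[of "e / (J + 1)"] that J unfolding I_def J_def[symmetric] by simp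
    also have "\<dots> \<le> e"
      using that J by (simp add: field_simps)
    finally show ?thesis by simp
  qed
  then have "I \<le> 0" by (rule field_le_epsilon)
  then show ?thesis unfolding I_def by simp
qed

text \<open>
  The indicator of the image of \<open>K\<close> is the pointwise limit of the continuous functions
  \<open>max 0 (1 - n * dist)\<close>; injectivity of the embedding on the half-open square identifies the
  pull-back of the limit with the indicator of \<open>K\<close>.
\<close>

lemma integral_compact_0_if_test_integrals_0:
  fixes u :: "plane \<Rightarrow> real"
  assumes u: "integrable torus_measure u"
    and 0: "\<And>\<phi>. \<phi> \<in> test_functions \<Longrightarrow> (\<integral>z. u z * \<phi> z \<partial>torus_measure) = 0"
    and K: "compact K" "K \<subseteq> space torus_measure"
  shows "(\<integral>z. u z * indicator K z \<partial>torus_measure) = 0"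
proof (cases "K = {}")
  case False
  define F where "F n w = max 0 (1 - real n * infdist w (circle_pair ` K))" for n w
  have cF: "continuous_on UNIV (F n)" for n
    unfolding F_def by (intro continuous_intros)
  have cp: "continuous_on UNIV circle_pair"
    unfolding circle_pair_def[abs_def] by (intro continuous_intros)
  have cl: "closed (circle_pair ` K)"
    by (intro compact_imp_closed compact_continuous_image continuous_on_subset[OF cp] K) simp
  have lim: "(\<lambda>n. F n (circle_pair z)) \<longlonglongrightarrow> indicator K z" if z: "z \<in> space torus_measure" for z
  proof (cases "z \<in> K")
    case True
    then show ?thesis by (simp add: F_def)
  next
    case zK: False
    then have "circle_pair z \<notin> circle_pair ` K"
      using inj_on_circle_pair z K(2) by (auto dest: inj_onD)
    then have d: "0 < infdist (circle_pair z) (circle_pair ` K)"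
      using cl False by (simp add: in_closed_iff_infdist_zero infdist_nonneg order_less_le)
    obtain N where N: "1 < real N * infdist (circle_pair z) (circle_pair ` K)"
      using reals_Archimedean3[OF d] by blast
    have "F n (circle_pair z) = 0" if "N \<le> n" for n
    proof -
      have "real N * infdist (circle_pair z) (circle_pair ` K) \<le> real n * infdist (circle_pair z) (circle_pair ` K)"
        using that d by (intro mult_right_mono) auto
      with N show ?thesis by (simp add: F_def)
    qed
    then have "eventually (\<lambda>n. F n (circle_pair z) = indicator K z) sequentially"
      using zK by (auto simp: eventually_sequentially)
    then show ?thesis by (rule tendsto_eventually)
  qed
  have Kb: "K \<in> sets borel" using K by (simp add: compact_imp_closed)
  have "(\<lambda>n. \<integral>z. u z * F n (circle_pair z) \<partial>torus_measure) \<longlonglongrightarrow> (\<integral>z. u z * indicator K z \<partial>torus_measure)"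
  proof (rule integral_dominated_convergence[where w = "\<lambda>z. \<bar>u z\<bar>"])
    show "(\<lambda>z. u z * indicator K z) \<in> borel_measurable torus_measure"
      by (intro borel_measurable_times borel_measurable_integrable[OF u] borel_measurable_torus) (use Kb in simp)
    show "(\<lambda>z. u z * F n (circle_pair z)) \<in> borel_measurable torus_measure" for n
      by (intro borel_measurable_times borel_measurable_integrable[OF u] continuous_measurable_torus
          continuous_on_compose2[OF cF cp]) simp
    show "AE z in torus_measure. (\<lambda>n. u z * F n (circle_pair z)) \<longlonglongrightarrow> u z * indicator K z"
      by (intro AE_I2 tendsto_mult_left lim)
    show "AE z in torus_measure. norm (u z * F n (circle_pair z)) \<le> \<bar>u z\<bar>" for n
    proof (rule AE_I2)
      fix z
      have "\<bar>F n (circle_pair z)\<bar> \<le> 1"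
        by (auto simp: F_def infdist_nonneg abs_le_iff)
      then have "\<bar>u z\<bar> * \<bar>F n (circle_pair z)\<bar> \<le> \<bar>u z\<bar> * 1"
        by (intro mult_left_mono) auto
      then show "norm (u z * F n (circle_pair z)) \<le> \<bar>u z\<bar>" by (simp add: abs_mult)
    qed
  qed (use u in auto)
  moreover have "(\<integral>z. u z * F n (circle_pair z) \<partial>torus_measure) = 0" for n
    by (rule integral_mult_continuous_circle_pair[OF u 0 cF])
  ultimately show ?thesis
    by (simp add: LIMSEQ_const_iff)
qed simp

text \<open>
  If \<open>u\<close> were positive on a set of positive measure, inner regularity would give a compact subset of
  positive measure over which the integral of \<open>u\<close> vanishes.
\<close>

lemma AE_nonpos_if_test_integrals_0:
  fixes u :: "plane \<Rightarrow> real"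
  assumes u: "integrable torus_measure u"
    and 0: "\<And>\<phi>. \<phi> \<in> test_functions \<Longrightarrow> (\<integral>z. u z * \<phi> z \<partial>torus_measure) = 0"
  shows "AE z in torus_measure. u z \<le> 0"
proof -
  define P where "P = {z \<in> space torus_measure. 0 < u z}"
  have Pt: "P \<in> sets torus_measure"
    unfolding P_def using borel_measurable_integrable[OF u] by measurable
  have sub: "A \<in> sets borel" if "A \<in> sets torus_measure" for A
    using that square_borel unfolding torus_measure_def sets_restrict_space by auto
  have id: "(\<lambda>z. z) \<in> measurable torus_measure borel"
    by (rule borel_measurable_torus) simp
  define M where "M = distr torus_measure borel (\<lambda>z. z)"
  have M: "emeasure M A = emeasure torus_measure (A \<inter> space torus_measure)" if "A \<in> sets borel" for A
    unfolding M_def by (subst emeasure_distr[OF id that]) (auto simp: vimage_def Int_def)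
  have "emeasure torus_measure P = 0"
  proof (rule ccontr)
    assume "emeasure torus_measure P \<noteq> 0"
    then have pos: "0 < emeasure M P"
      using M[OF sub[OF Pt]] sets.sets_into_space[OF Pt] by (simp add: Int_absorb2 zero_less_iff_neq_zero)
    have "emeasure M P = (SUP K \<in> {K. K \<subseteq> P \<and> compact K}. emeasure M K)"
      by (rule inner_regular) (auto simp: M_def sub[OF Pt] emeasure_distr[OF id])
    then obtain K where K: "K \<subseteq> P" "compact K" "0 < emeasure M K"
      using pos by (auto simp: less_SUP_iff)
    have Ks: "K \<subseteq> space torus_measure" using K by (auto simp: P_def)
    have Kb: "K \<in> sets borel" using K by (simp add: compact_imp_closed)
    have i: "integrable torus_measure (\<lambda>z. u z * indicator K z)"
    proof (rule Bochner_Integration.integrable_bound[OF u])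
      show "(\<lambda>z. u z * indicator K z) \<in> borel_measurable torus_measure"
        by (intro borel_measurable_times borel_measurable_integrable[OF u] borel_measurable_torus) (use Kb in simp)
    qed (auto simp: indicator_def)
    have "AE z in torus_measure. u z * indicator K z = 0"
    proof (subst integral_nonneg_eq_0_iff_AE[OF i, symmetric])
      show "AE z in torus_measure. 0 \<le> u z * indicator K z"
        using K(1) by (intro AE_I2) (auto simp: P_def indicator_def)
      show "(\<integral>z. u z * indicator K z \<partial>torus_measure) = 0"
        by (rule integral_compact_0_if_test_integrals_0[OF u 0 K(2) Ks])
    qed
    then have "AE z in torus_measure. z \<notin> K"
      by eventually_elim (use K(1) in \<open>auto simp: P_def indicator_def split: if_splits\<close>)
    moreover have "K \<in> sets torus_measure"
      using Kb Ks by (auto simp: torus_measure_def sets_restrict_space space_restrict_space intro!: image_eqI[of _ _ K])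
    ultimately have "emeasure torus_measure K = 0"
      by (subst (asm) AE_iff_measurable[of K]) (use Ks in auto)
    then show False using K(3) M[OF Kb] Ks by (simp add: Int_absorb2)
  qed
  then show ?thesis
    by (subst AE_iff_measurable[OF Pt]) (auto simp: P_def not_le)
qed

lemma AE_0_if_test_integrals_0:
  fixes u :: "plane \<Rightarrow> real"
  assumes u: "integrable torus_measure u"
    and 0: "\<And>\<phi>. \<phi> \<in> test_functions \<Longrightarrow> (\<integral>z. u z * \<phi> z \<partial>torus_measure) = 0"
  shows "AE z in torus_measure. u z = 0"
proof -
  have 1: "AE z in torus_measure. u z \<le> 0"
    by (rule AE_nonpos_if_test_integrals_0[OF u 0])
  have "AE z in torus_measure. - u z \<le> 0"
    by (rule AE_nonpos_if_test_integrals_0) (use u 0 in auto)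
  with 1 show ?thesis by eventually_elim auto
qed

lemma represents_L2_integrable:
  assumes "represents_L2 g T"
  shows "integrable torus_measure g"
proof (rule Bochner_Integration.integrable_bound)
  show "integrable torus_measure (\<lambda>z. 1 + (g z)\<^sup>2)"
    using assms by (simp add: represents_L2_def)
  have "\<bar>x\<bar> \<le> 1 + x\<^sup>2" for x :: real
    using zero_le_power2[of "\<bar>x\<bar> - 1/2"] by (simp add: power2_diff field_simps)
  then show "AE z in torus_measure. norm (g z) \<le> norm (1 + (g z)\<^sup>2)"
    by (intro AE_I2) simp
qed (use assms in \<open>simp add: represents_L2_def\<close>)

lemma represents_L2_unique:
  assumes g: "represents_L2 g T" and h: "represents_L2 h T"
  shows "AE z in torus_measure. g z = h z"
proof -
  note i = represents_L2_integrable[OF g] represents_L2_integrable[OF h]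
  have "AE z in torus_measure. g z - h z = 0"
  proof (rule AE_0_if_test_integrals_0)
    show "integrable torus_measure (\<lambda>z. g z - h z)" using i by simp
    fix \<phi> assume \<phi>: "\<phi> \<in> test_functions"
    obtain B where B: "0 \<le> B" "\<And>z. z \<in> space torus_measure \<Longrightarrow> norm (\<phi> z) \<le> B"
      using continuous_bounded_torus[OF test_continuous[OF \<phi>]] by blast
    have "integrable torus_measure (\<lambda>z. v z * \<phi> z)" if v: "integrable torus_measure v" for v
    proof (rule Bochner_Integration.integrable_bound[OF integrable_mult_left[OF integrable_abs[OF v], of B]])
      show "(\<lambda>z. v z * \<phi> z) \<in> borel_measurable torus_measure"
        by (intro borel_measurable_times borel_measurable_integrable[OF v] continuous_measurable_torus test_continuous \<phi>)
      show "AE z in torus_measure. norm (v z * \<phi> z) \<le> norm (\<bar>v z\<bar> * B)"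
        using B by (intro AE_I2) (auto simp: abs_mult intro!: mult_left_mono)
    qed
    then have "(\<integral>z. (g z - h z) * \<phi> z \<partial>torus_measure) = dist_of g \<phi> - dist_of h \<phi>"
      using i by (simp add: dist_of_def left_diff_distrib)
    also have "\<dots> = 0"
      using g h \<phi> by (simp add: represents_L2_def dist_eq_def)
    finally show "(\<integral>z. (g z - h z) * \<phi> z \<partial>torus_measure) = 0" .
  qed
  then show ?thesis by eventually_elim simp
qed

lemma represents_L2_real_series:
  assumes a: "smooth_coeffs a" and T: "dist_eq T (dist_of (real_series a))"
  shows "represents_L2 (real_series a) T"
proof -
  have c: "continuous_on UNIV (real_series a)" by (rule continuous_real_series[OF smooth_coeffsD(1)[OF a]])
  have "integrable torus_measure (\<lambda>z. (real_series a z)\<^sup>2)"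
    by (intro integrable_continuous_torus continuous_intros c)
  with T show ?thesis
    by (simp add: represents_L2_def continuous_measurable_torus c)
qed

text \<open>
  Parseval's identity. By uniqueness the representing functions chosen in the definition may be
  replaced by the sums of the two series.
\<close>

lemma L2_integral_real_series:
  assumes a: "smooth_coeffs a" "dist_eq S (dist_of (real_series a))"
    and b: "smooth_coeffs b" "dist_eq T (dist_of (real_series b))"
  shows "of_real (L2_integral S T) = of_real ((2 * pi)\<^sup>2) * (\<Sum>\<^sub>\<infinity>k. a k * b (- k))"
proof -
  define g h where "g = (SOME g. represents_L2 g S)" and "h = (SOME h. represents_L2 h T)"
  have g: "represents_L2 g S" and h: "represents_L2 h T"
    unfolding g_def h_def
    by (rule someI[of "\<lambda>g. represents_L2 g S", OF represents_L2_real_series[OF a]],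
        rule someI[of "\<lambda>g. represents_L2 g T", OF represents_L2_real_series[OF b]])
  have m: "g \<in> borel_measurable torus_measure" "h \<in> borel_measurable torus_measure"
    using g h by (auto simp: represents_L2_def)
  have cb: "continuous_on UNIV (real_series b)" and ca: "continuous_on UNIV (real_series a)"
    by (intro continuous_real_series smooth_coeffsD(1) a b)+
  have "L2_integral S T = (\<integral>z. g z * h z \<partial>torus_measure)"
    by (simp add: L2_integral_def g_def h_def)
  also have "\<dots> = dist_of (real_series a) (real_series b)"
    unfolding dist_of_def
  proof (rule integral_cong_AE)
    show "AE z in torus_measure. g z * h z = real_series a z * real_series b z"
      using represents_L2_unique[OF g represents_L2_real_series[OF a]] represents_L2_unique[OF h represents_L2_real_series[OF b]]
      by eventually_elim simp
  qed (intro borel_measurable_times m continuous_measurable_torus ca cb)+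
  finally have "of_real (L2_integral S T) = (\<Sum>\<^sub>\<infinity>k. a k * mode_pairing k (real_series b))"
    using dist_of_real_series(3)[OF a(1) cb] by simp
  also have "\<dots> = (\<Sum>\<^sub>\<infinity>k. of_real ((2 * pi)\<^sup>2) * (a k * b (- k)))"
    unfolding mode_pairing_real_series[OF b(1)] by (simp add: mult_ac)
  finally show ?thesis by (simp only: infsum_cmult_right')
qed



section \<open>The weak formulation in Fourier coefficients\<close>

text \<open>
  The coefficient at \<open>n\<close> of a bilinear Fourier multiplier with symbol \<open>\<kappa>\<close>.
\<close>

definition kernel_conv :: "(int \<times> int \<Rightarrow> int \<times> int \<Rightarrow> complex) \<Rightarrow> (int \<times> int \<Rightarrow> complex) \<Rightarrow> (int \<times> int \<Rightarrow> complex)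
    \<Rightarrow> int \<times> int \<Rightarrow> complex" where
  "kernel_conv \<kappa> a b n = (\<Sum>\<^sub>\<infinity>k. \<kappa> k (n - k) * a k * b (n - k))"

text \<open>
  Linear growth in each frequency covers all symbols of order one that occur, and the symmetry
  ensures that real functions are mapped to real functions.
\<close>

definition good_kernel :: "(int \<times> int \<Rightarrow> int \<times> int \<Rightarrow> complex) \<Rightarrow> bool" where
  "good_kernel \<kappa> \<longleftrightarrow> (\<exists>C. \<forall>k l. norm (\<kappa> k l) \<le> C * wt k * wt l) \<and> (\<forall>k l. \<kappa> (- k) (- l) = cnj (\<kappa> k l))"

lemma good_kernel_hermitian: "good_kernel \<kappa> \<Longrightarrow> \<kappa> (- k) (- l) = cnj (\<kappa> k l)"
  unfolding good_kernel_def by (elim conjE allE)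

lemma good_kernel_bound: "good_kernel \<kappa> \<Longrightarrow> \<exists>C. \<forall>k l. norm (\<kappa> k l) \<le> C * wt k ^ 1 * wt l ^ 1"
  unfolding good_kernel_def power_one_right by (elim conjE)

lemma kernel_conv_has_sum:
  assumes "good_kernel \<kappa>" "rapid a" "rapid b"
  shows "((\<lambda>k. \<kappa> k (n - k) * a k * b (n - k)) has_sum kernel_conv \<kappa> a b n) UNIV"
proof -
  obtain C where "\<forall>k l. norm (\<kappa> k l) \<le> C * wt k ^ 1 * wt l ^ 1"
    using good_kernel_bound[OF assms(1)] by (elim exE)
  note C = this[THEN spec, THEN spec]
  show ?thesis
    unfolding kernel_conv_def
    by (rule has_sum_infsum[OF abs_summable_summable[OF rapid_convolution(2)[OF assms(2,3) C]]])
qed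

lemma smooth_coeffs_kernel_conv:
  assumes \<kappa>: "good_kernel \<kappa>" and a: "smooth_coeffs a" and b: "smooth_coeffs b"
  shows "smooth_coeffs (kernel_conv \<kappa> a b)"
  unfolding smooth_coeffs_def
proof (intro conjI allI)
  obtain C where "\<forall>k l. norm (\<kappa> k l) \<le> C * wt k ^ 1 * wt l ^ 1"
    using good_kernel_bound[OF \<kappa>] by (elim exE)
  note C = this[THEN spec, THEN spec]
  show "rapid (kernel_conv \<kappa> a b)"
    unfolding kernel_conv_def[abs_def]
    by (rule rapid_convolution(1)[OF smooth_coeffsD(1)[OF a] smooth_coeffsD(1)[OF b] C])
  fix n
  have e: "\<kappa> (- k) (- n - - k) * a (- k) * b (- n - - k) = cnj (\<kappa> k (n - k) * a k * b (n - k))" for k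
  proof -
    have "- n - - k = - (n - k)" by simp
    then show ?thesis
      by (simp only: good_kernel_hermitian[OF \<kappa>] smooth_coeffsD(2)[OF a] smooth_coeffsD(2)[OF b] complex_cnj_mult)
  qed
  have "cnj (kernel_conv \<kappa> a b n) = (\<Sum>\<^sub>\<infinity>k. \<kappa> (- k) (- n - - k) * a (- k) * b (- n - - k))"
    unfolding kernel_conv_def e infsum_cnj ..
  also have "\<dots> = kernel_conv \<kappa> a b (- n)"
    unfolding kernel_conv_def
    by (rule infsum_reindex_bij_betw[of uminus UNIV UNIV "\<lambda>k. \<kappa> k (- n - k) * a k * b (- n - k)"])
       (auto intro!: bij_betwI[of _ _ _ uminus])
  finally show "kernel_conv \<kappa> a b (- n) = cnj (kernel_conv \<kappa> a b n)" ..
qed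

lemma fourier_coeff_mult:
  assumes a: "smooth_coeffs a" and T: "dist_eq T (dist_of (real_series a))" and \<psi>: "\<psi> \<in> test_functions"
  shows "fourier_coeff (dist_mult \<psi> T) n = (\<Sum>\<^sub>\<infinity>k. a k * fourier_coeff (dist_of \<psi>) (n - k))"
proof -
  have "dist_eq (dist_mult \<psi> T) (dist_of (\<lambda>z. real_series a z * \<psi> z))"
    using T test_mult[OF \<psi>] by (auto simp: dist_eq_def dist_mult_def dist_of_def mult.assoc)
  from fourier_coeff_cong[OF this] fourier_coeff_real_series_mult[OF a test_continuous[OF \<psi>]] show ?thesis by simp
qed

lemma fourier_coeff_dx:
  assumes "\<psi> \<in> test_functions"
  shows "fourier_coeff (dist_of (dx1 \<psi>)) l = \<i> * of_int (fst l) * fourier_coeff (dist_of \<psi>) l"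
    "fourier_coeff (dist_of (dx2 \<psi>)) l = \<i> * of_int (snd l) * fourier_coeff (dist_of \<psi>) l"
  by (simp_all add: fourier_coeff_dist_of test_continuous test_dx1 test_dx2 mode_pairing_dx assms)

definition cross :: "int \<times> int \<Rightarrow> int \<times> int \<Rightarrow> real" where
  "cross k l = of_int (fst k) * of_int (snd l) - of_int (snd k) * of_int (fst l)"

lemma abs_cross_le: "\<bar>cross k l\<bar> \<le> 2 * wt k * wt l"
proof -
  have "\<bar>cross k l\<bar> \<le> \<bar>of_int (fst k)\<bar> * \<bar>of_int (snd l)\<bar> + \<bar>of_int (snd k)\<bar> * \<bar>of_int (fst l)\<bar>"
    unfolding cross_def by (rule order_trans[OF abs_triangle_ineq4]) (simp add: abs_mult)
  also have "\<dots> \<le> wt k * wt l + wt k * wt l"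
    by (intro add_mono mult_mono abs_fst_le_wt abs_snd_le_wt less_imp_le[OF wt_pos]) auto
  finally show ?thesis by simp
qed

lemma cross_uminus [simp]: "cross (- k) l = - cross k l" "cross k (- l) = - cross k l"
  by (simp_all add: cross_def)

lemma good_kernel_derivs:
  "good_kernel (\<lambda>k l. \<i> * of_int (fst l))" "good_kernel (\<lambda>k l. \<i> * of_int (snd l))"
proof -
  have "\<bar>of_int (fst l)\<bar> \<le> wt k * wt l" "\<bar>of_int (snd l)\<bar> \<le> wt k * wt l" for k l
  proof -
    have "1 * wt l \<le> wt k * wt l"
      using wt_ge_1[of k] wt_pos[of l] by (intro mult_right_mono) auto
    then show "\<bar>of_int (fst l)\<bar> \<le> wt k * wt l" "\<bar>of_int (snd l)\<bar> \<le> wt k * wt l"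
      using abs_fst_le_wt[of l] abs_snd_le_wt[of l] by linarith+
  qed
  then show "good_kernel (\<lambda>k l. \<i> * of_int (fst l))" "good_kernel (\<lambda>k l. \<i> * of_int (snd l))"
    unfolding good_kernel_def by (auto simp: norm_mult intro!: exI[of _ 1] simp del: split_paired_All split_paired_Ex)
qed

lemma good_kernel_cross:
  assumes "\<And>k l. \<bar>\<rho> k l\<bar> \<le> 1" "\<And>k l. \<rho> (- k) (- l) = \<rho> k l"
  shows "good_kernel (\<lambda>k l. of_real (cross k l * \<rho> k l))"
  unfolding good_kernel_def
proof (intro conjI exI allI)
  fix k l
  have "\<bar>cross k l\<bar> * \<bar>\<rho> k l\<bar> \<le> (2 * wt k * wt l) * 1"
    using wt_pos[of k] wt_pos[of l] by (intro mult_mono abs_cross_le assms) auto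
  then show "norm (of_real (cross k l * \<rho> k l) :: complex) \<le> 2 * wt k * wt l"
    unfolding norm_of_real abs_mult by simp
qed (simp add: assms(2))

lemma Lam_symbol_neg1_diff: "\<bar>Lam_symbol (-1) k - Lam_symbol (-1) l\<bar> \<le> 1"
  using Lam_symbol_nonneg[of "-1" k] Lam_symbol_nonneg[of "-1" l] Lam_symbol_neg1_le[of k] Lam_symbol_neg1_le[of l]
  by linarith

text \<open>
  The symbol of \<open>[\<nabla>\<^sup>\<bottom>\<Lambda>\<^sup>-\<^sup>1, \<nabla>\<psi>]\<theta>\<close>, with \<open>k\<close> the frequency of \<open>\<theta>\<close> and \<open>l\<close> that of \<open>\<psi>\<close>.
\<close>

definition comm_kernel :: "int \<times> int \<Rightarrow> int \<times> int \<Rightarrow> complex" where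
  "comm_kernel k l = of_real (cross k l * (Lam_symbol (-1) k - Lam_symbol (-1) (k + l)))"

text \<open>
  The symbol of the symmetrized nonlinearity \<open>u\<^sub>a \<cdot> \<nabla>b + u\<^sub>b \<cdot> \<nabla>a\<close>. It vanishes when \<open>k\<close> and \<open>l\<close> are parallel
  or of equal length, as for shear flows and for eigenfunctions of the Laplacian.
\<close>

definition sqg_kernel :: "int \<times> int \<Rightarrow> int \<times> int \<Rightarrow> complex" where
  "sqg_kernel k l = of_real (cross k l * (Lam_symbol (-1) l - Lam_symbol (-1) k))"

lemma good_comm_kernel: "good_kernel comm_kernel"
proof -
  have "Lam_symbol (-1) (- k + - l) = Lam_symbol (-1) (k + l)" for k l
    using Lam_symbol_uminus[of "-1" "k + l"] by simp
  then show ?thesis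
    unfolding comm_kernel_def[abs_def] by (intro good_kernel_cross Lam_symbol_neg1_diff) simp
qed

lemma good_sqg_kernel: "good_kernel sqg_kernel"
  unfolding sqg_kernel_def[abs_def] by (intro good_kernel_cross Lam_symbol_neg1_diff) simp

text \<open>
  All four terms of the commutator are bilinear multipliers in \<open>\<theta>\<close> and \<open>\<psi>\<close>. The component of
  \<open>\<nabla>\<psi>\<close> contributes the factor \<open>\<i> l\<close>, and \<open>\<nabla>\<^sup>\<bottom>\<Lambda>\<^sup>-\<^sup>1\<close> acts at the output frequency \<open>n = k + l\<close> in the
  first two terms and at \<open>k\<close> in the last two. The numerators agree because
  \<open>cross k n = cross k l\<close>.
\<close>

lemma fourier_coeff_commutator:
  assumes a: "smooth_coeffs a" and \<theta>: "dist_eq \<theta> (dist_of (real_series a))" and \<psi>: "\<psi> \<in> test_functions"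
  shows "fourier_coeff (commutator \<psi> \<theta>) = kernel_conv comm_kernel a (fourier_coeff (dist_of \<psi>))"
proof
  fix n
  define b where "b = fourier_coeff (dist_of \<psi>)"
  let ?L = "\<lambda>k. complex_of_real (Lam_symbol (-1) k)"
  let ?La = "\<lambda>k. ?L k * a k"
  have b: "smooth_coeffs b" unfolding b_def by (rule smooth_coeffs_test[OF \<psi>])
  note ra = smooth_coeffsD(1)[OF a] and rb = smooth_coeffsD(1)[OF b]
  have La: "smooth_coeffs ?La" by (rule smooth_coeffs_Lam[OF a])
  have mult: "fourier_coeff (dist_mult (dx1 \<psi>) T) = kernel_conv (\<lambda>k l. \<i> * of_int (fst l)) c b"
    "fourier_coeff (dist_mult (dx2 \<psi>) T) = kernel_conv (\<lambda>k l. \<i> * of_int (snd l)) c b"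
    if "smooth_coeffs c" "dist_eq T (dist_of (real_series c))" for c T
    using fourier_coeff_mult[OF that test_dx1[OF \<psi>]] fourier_coeff_mult[OF that test_dx2[OF \<psi>]]
    by (simp_all add: fun_eq_iff kernel_conv_def fourier_coeff_dx[OF \<psi>] b_def[symmetric] mult_ac del: split_paired_All)
  let ?c1 = "kernel_conv (\<lambda>k l. \<i> * of_int (fst l)) a b" and ?c2 = "kernel_conv (\<lambda>k l. \<i> * of_int (snd l)) a b"
  have c: "smooth_coeffs ?c1" "smooth_coeffs ?c2"
    by (intro smooth_coeffs_kernel_conv good_kernel_derivs a b)+
  have A: "dist_eq (ddx2 (Lam (-1) (dist_mult (dx1 \<psi>) \<theta>))) (dist_of (real_series (\<lambda>k. \<i> * of_int (snd k) * (?L k * ?c1 k))))"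
    and B: "dist_eq (ddx1 (Lam (-1) (dist_mult (dx2 \<psi>) \<theta>))) (dist_of (real_series (\<lambda>k. \<i> * of_int (fst k) * (?L k * ?c2 k))))"
    by (intro ddx_dist_eq smooth_coeffs_Lam c Lam_dist_eq mult a \<theta>)+
  have fA: "fourier_coeff (ddx2 (Lam (-1) (dist_mult (dx1 \<psi>) \<theta>))) n = \<i> * of_int (snd n) * (?L n * ?c1 n)"
    and fB: "fourier_coeff (ddx1 (Lam (-1) (dist_mult (dx2 \<psi>) \<theta>))) n = \<i> * of_int (fst n) * (?L n * ?c2 n)"
    unfolding fourier_coeff_cong[OF A] fourier_coeff_cong[OF B]
    by (intro fourier_coeff_real_series smooth_coeffs_deriv smooth_coeffs_Lam c)+
  have fa: "fourier_coeff \<theta> = a"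
    using fourier_coeff_cong[OF \<theta>] fourier_coeff_real_series[OF a] by auto
  have C: "dist_eq (ddx2 (Lam (-1) \<theta>)) (dist_of (real_series (\<lambda>k. \<i> * of_int (snd k) * ?La k)))"
    and D: "dist_eq (ddx1 (Lam (-1) \<theta>)) (dist_of (real_series (\<lambda>k. \<i> * of_int (fst k) * ?La k)))"
    by (intro ddx_dist_eq La Lam_dist_eq fa a)+
  have fC: "fourier_coeff (dist_mult (dx1 \<psi>) (ddx2 (Lam (-1) \<theta>))) n
      = kernel_conv (\<lambda>k l. \<i> * of_int (fst l)) (\<lambda>k. \<i> * of_int (snd k) * ?La k) b n"
    and fD: "fourier_coeff (dist_mult (dx2 \<psi>) (ddx1 (Lam (-1) \<theta>))) n
      = kernel_conv (\<lambda>k l. \<i> * of_int (snd l)) (\<lambda>k. \<i> * of_int (fst k) * ?La k) b n"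
    by (simp_all only: mult(1)[OF smooth_coeffs_deriv(2)[OF La] C] mult(2)[OF smooth_coeffs_deriv(1)[OF La] D])
  have "fourier_coeff (commutator \<psi> \<theta>) n =
      (- fourier_coeff (ddx2 (Lam (-1) (dist_mult (dx1 \<psi>) \<theta>))) n + fourier_coeff (ddx1 (Lam (-1) (dist_mult (dx2 \<psi>) \<theta>))) n)
    - (- fourier_coeff (dist_mult (dx1 \<psi>) (ddx2 (Lam (-1) \<theta>))) n + fourier_coeff (dist_mult (dx2 \<psi>) (ddx1 (Lam (-1) \<theta>))) n)"
    unfolding fourier_coeff_def commutator_def
    by (simp add: complex_eq_iff diff_divide_distrib add_divide_distrib)
  also have "\<dots> = (- (\<i> * of_int (snd n) * ?L n) * ?c1 n + (\<i> * of_int (fst n) * ?L n) * ?c2 n)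
    + (kernel_conv (\<lambda>k l. \<i> * of_int (fst l)) (\<lambda>k. \<i> * of_int (snd k) * ?La k) b n
    + - kernel_conv (\<lambda>k l. \<i> * of_int (snd l)) (\<lambda>k. \<i> * of_int (fst k) * ?La k) b n)"
    unfolding fA fB fC fD by (simp add: mult_ac)
  finally have F: "fourier_coeff (commutator \<psi> \<theta>) n = \<dots>" .
  have "((\<lambda>k. (- (\<i> * of_int (snd n) * ?L n) * (\<i> * of_int (fst (n - k)) * a k * b (n - k))
       + (\<i> * of_int (fst n) * ?L n) * (\<i> * of_int (snd (n - k)) * a k * b (n - k)))
     + ((\<i> * of_int (fst (n - k))) * (\<i> * of_int (snd k) * ?La k) * b (n - k)
       + - ((\<i> * of_int (snd (n - k))) * (\<i> * of_int (fst k) * ?La k) * b (n - k)))) has_sum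
       fourier_coeff (commutator \<psi> \<theta>) n) UNIV"
    unfolding F
    by (intro has_sum_add has_sum_cmult_right has_sum_uminusI kernel_conv_has_sum good_kernel_derivs ra rb
        smooth_coeffsD(1)[OF smooth_coeffs_deriv(1)[OF La]] smooth_coeffsD(1)[OF smooth_coeffs_deriv(2)[OF La]])
  moreover have "(- (\<i> * of_int (snd n) * ?L n) * (\<i> * of_int (fst (n - k)) * a k * b (n - k))
       + (\<i> * of_int (fst n) * ?L n) * (\<i> * of_int (snd (n - k)) * a k * b (n - k)))
     + ((\<i> * of_int (fst (n - k))) * (\<i> * of_int (snd k) * ?La k) * b (n - k)
       + - ((\<i> * of_int (snd (n - k))) * (\<i> * of_int (fst k) * ?La k) * b (n - k)))
     = comm_kernel k (n - k) * a k * b (n - k)" for k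
  proof -
    have i: "\<i> * (\<i> * x) = - x" for x by (simp flip: mult.assoc)
    show ?thesis
      by (simp add: comm_kernel_def cross_def) (simp add: algebra_simps i)
  qed
  ultimately have "((\<lambda>k. comm_kernel k (n - k) * a k * b (n - k)) has_sum fourier_coeff (commutator \<psi> \<theta>) n) UNIV"
    by simp
  then show "fourier_coeff (commutator \<psi> \<theta>) n = kernel_conv comm_kernel a (fourier_coeff (dist_of \<psi>)) n"
    using kernel_conv_has_sum[OF good_comm_kernel ra rb, of n] unfolding b_def by (rule has_sum_unique)
qed

text \<open>
  The Fourier coefficients of \<open>u \<cdot> \<nabla>\<theta> + \<nu> \<Lambda>\<^sup>\<gamma>\<theta>\<close> for \<open>\<theta>\<close> with coefficients \<open>a\<close>.
\<close>

definition sqg_force :: "real \<Rightarrow> real \<Rightarrow> (int \<times> int \<Rightarrow> complex) \<Rightarrow> int \<times> int \<Rightarrow> complex" where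
  "sqg_force \<nu> \<gamma> a n = 1/2 * kernel_conv sqg_kernel a a n + of_real (\<nu> * Lam_symbol \<gamma> n) * a n"

lemma smooth_coeffs_force:
  assumes "smooth_coeffs a" shows "smooth_coeffs (sqg_force \<nu> \<gamma> a)"
proof -
  note c = smooth_coeffs_kernel_conv[OF good_sqg_kernel assms assms] and L = smooth_coeffs_Lam[OF assms, of \<gamma>]
  have "rapid (\<lambda>n. 1/2 * kernel_conv sqg_kernel a a n + of_real \<nu> * (of_real (Lam_symbol \<gamma> n) * a n))"
    by (intro rapid_add rapid_cmult smooth_coeffsD(1)[OF c] smooth_coeffsD(1)[OF L])
  then show ?thesis
    unfolding smooth_coeffs_def
    by (auto simp: sqg_force_def[abs_def] smooth_coeffsD(2)[OF c] smooth_coeffsD(2)[OF assms] mult.assoc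
        simp del: split_paired_All)
qed

lemma sqg_kernel_comm: "sqg_kernel l k = sqg_kernel k l"
  by (simp add: sqg_kernel_def cross_def algebra_simps)

text \<open>
  This is the identity behind the weak formulation: testing the commutator against \<open>\<theta>\<close> equals
  testing the nonlinearity against \<open>\<psi>\<close>. In frequency, both sides are the sum of
  \<open>H k j = sqg_kernel k j * a k * a j * b (- (k + j))\<close> over all pairs \<open>(k, j)\<close>, parametrized by the
  pair itself on the left and by \<open>(k, k + j)\<close> on the right.
\<close>

lemma force_pairing:
  assumes a: "smooth_coeffs a" and b: "smooth_coeffs b"
  shows "(\<Sum>\<^sub>\<infinity>n. a n * kernel_conv comm_kernel a b (- n)) = (\<Sum>\<^sub>\<infinity>n. kernel_conv sqg_kernel a a n * b (- n))"
proof -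
  note ra = smooth_coeffsD(1)[OF a] and rb = smooth_coeffsD(1)[OF b]
  define H where "H k j = sqg_kernel k j * a k * a j * b (- (k + j))" for k j
  obtain C where C': "\<forall>k l. norm (sqg_kernel k l) \<le> C * wt k ^ 1 * wt l ^ 1"
    using good_kernel_bound[OF good_sqg_kernel] by (elim exE)
  have C: "norm (sqg_kernel k l) \<le> C * wt k * wt l" for k l
    using C'[THEN spec, THEN spec, of k l] by (simp only: power_one_right)
  obtain B where B: "0 \<le> B" "\<And>k. norm (b k) * wt k ^ 0 \<le> B"
    using rapidE[OF rb, of 0] by blast
  have "(\<lambda>(k, j). (norm (a k) * wt k ^ 1) * (norm (a j) * wt j ^ 1)) summable_on UNIV \<times> UNIV"
    by (intro summable_on_product_nonneg rapid_summable ra) (auto intro!: mult_nonneg_nonneg less_imp_le[OF wt_pos])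
  then have s0: "(\<lambda>p. C * B * ((norm (a (fst p)) * wt (fst p)) * (norm (a (snd p)) * wt (snd p)))) summable_on UNIV"
    by (intro summable_on_cmult_right) (simp add: case_prod_unfold)
  have sH: "(\<lambda>p. H (fst p) (snd p)) summable_on UNIV"
  proof (rule abs_summable_summable, rule summable_on_comparison_test[OF s0])
    fix p :: "(int \<times> int) \<times> (int \<times> int)"
    obtain k j where p: "p = (k, j)" by (cases p)
    have "norm (H k j) = norm (sqg_kernel k j) * (norm (a k) * norm (a j)) * norm (b (- (k + j)))"
      unfolding H_def norm_mult by simp
    also have "\<dots> \<le> (C * wt k * wt j) * (norm (a k) * norm (a j)) * B"
      using C[of k j] B(2)[of "- (k + j)"] B(1) order_trans[OF norm_ge_zero C[of k j]]
      by (intro mult_mono) (auto intro: mult_nonneg_nonneg[of "C * wt k * wt j"])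
    finally show "norm (H (fst p) (snd p)) \<le> C * B * ((norm (a (fst p)) * wt (fst p)) * (norm (a (snd p)) * wt (snd p)))"
      by (simp add: p mult_ac)
  qed simp
  \<comment> \<open>The right-hand side is indexed by the output frequency \<open>n = k + j\<close> and by \<open>k\<close>.\<close>
  have bij: "bij_betw (\<lambda>(n, k). (k, n - k)) UNIV (UNIV :: ((int \<times> int) \<times> (int \<times> int)) set)"
    by (rule bij_betwI[of _ _ _ "\<lambda>(k, j). (k + j, k)"]) auto
  have sH1: "(\<lambda>(n, k). H k n) summable_on UNIV \<times> UNIV"
    using summable_on_reindex_bij_betw[of prod.swap UNIV UNIV "\<lambda>p. H (fst p) (snd p)"] sH
    by (simp add: case_prod_unfold bij_swap)
  have sH2: "(\<lambda>(n, k). H k (n - k)) summable_on UNIV \<times> UNIV"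
    using summable_on_reindex_bij_betw[OF bij, of "\<lambda>p. H (fst p) (snd p)"] sH
    by (simp add: case_prod_unfold)
  have "(\<Sum>\<^sub>\<infinity>n. a n * kernel_conv comm_kernel a b (- n)) = (\<Sum>\<^sub>\<infinity>n. \<Sum>\<^sub>\<infinity>k. H k n)"
  proof (rule infsum_cong)
    fix n
    have "a n * kernel_conv comm_kernel a b (- n) = (\<Sum>\<^sub>\<infinity>k. a n * (comm_kernel k (- n - k) * a k * b (- n - k)))"
      unfolding kernel_conv_def by (rule infsum_cmult_right'[symmetric])
    also have "\<dots> = (\<Sum>\<^sub>\<infinity>k. H k n)"
    proof (rule infsum_cong)
      fix k
      have e: "- n - k = - (k + n)" "k + - (k + n) = - n" by (simp_all add: prod_eq_iff)
      have "comm_kernel k (- (k + n)) = sqg_kernel k n"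
        unfolding comm_kernel_def sqg_kernel_def e(2) by (simp add: cross_def algebra_simps)
      then show "a n * (comm_kernel k (- n - k) * a k * b (- n - k)) = H k n"
        unfolding H_def e(1) by (simp add: mult_ac)
    qed
    finally show "a n * kernel_conv comm_kernel a b (- n) = (\<Sum>\<^sub>\<infinity>k. H k n)" .
  qed
  also have "\<dots> = (\<Sum>\<^sub>\<infinity>k. \<Sum>\<^sub>\<infinity>n. H k n)"
    by (rule infsum_swap_banach[OF sH1])
  also have "\<dots> = (\<Sum>\<^sub>\<infinity>k. \<Sum>\<^sub>\<infinity>n. H k (n - k))"
  proof (rule infsum_cong)
    fix k
    show "(\<Sum>\<^sub>\<infinity>n. H k n) = (\<Sum>\<^sub>\<infinity>n. H k (n - k))"
      by (rule infsum_reindex_bij_betw[of "\<lambda>n. n - k", symmetric]) (auto intro!: bij_betwI[of _ _ _ "\<lambda>n. n + k"])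
  qed
  also have "\<dots> = (\<Sum>\<^sub>\<infinity>n. \<Sum>\<^sub>\<infinity>k. H k (n - k))"
    by (rule infsum_swap_banach[OF sH2, symmetric])
  also have "\<dots> = (\<Sum>\<^sub>\<infinity>n. kernel_conv sqg_kernel a a n * b (- n))"
    unfolding kernel_conv_def H_def infsum_cmult_left'[symmetric] by simp
  finally show ?thesis .
qed

lemma torus_distribution_real_series:
  assumes a: "smooth_coeffs a" and T: "dist_eq T (dist_of (real_series a))"
  shows "torus_distribution T"
  unfolding torus_distribution_def
proof (intro conjI ballI allI)
  have c: "continuous_on UNIV (real_series a)" by (intro continuous_real_series smooth_coeffsD(1) a)
  have i: "integrable torus_measure (\<lambda>z. real_series a z * \<phi> z)" if "\<phi> \<in> test_functions" for \<phi>
    by (intro integrable_continuous_torus continuous_intros c test_continuous that)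
  have TD: "T \<phi> = (\<integral>z. real_series a z * \<phi> z \<partial>torus_measure)" if "\<phi> \<in> test_functions" for \<phi>
    using T that by (simp add: dist_eq_def dist_of_def)
  show "T (\<lambda>z. \<phi> z + \<psi> z) = T \<phi> + T \<psi>" if "\<phi> \<in> test_functions" "\<psi> \<in> test_functions" for \<phi> \<psi>
    using that by (simp add: TD test_add i distrib_left)
  show "T (\<lambda>z. c * \<psi> z) = c * T \<psi>" if "\<psi> \<in> test_functions" for c \<psi>
  proof -
    have "T (\<lambda>z. c * \<psi> z) = (\<integral>z. c * (real_series a z * \<psi> z) \<partial>torus_measure)"
      unfolding TD[OF test_cmult[OF that]] by (rule Bochner_Integration.integral_cong) (simp_all add: mult_ac)
    then show ?thesis by (simp add: TD that)
  qed
  have bd: "\<bar>T \<psi>\<bar> \<le> (\<integral>z. \<bar>real_series a z\<bar> \<partial>torus_measure) * M"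
    if \<psi>: "\<psi> \<in> test_functions" and M: "\<And>z. \<bar>\<psi> z\<bar> \<le> M" for \<psi> M
  proof -
    have "\<bar>T \<psi>\<bar> \<le> (\<integral>z. \<bar>real_series a z * \<psi> z\<bar> \<partial>torus_measure)"
      unfolding TD[OF \<psi>] by (rule integral_abs_bound)
    also have "\<dots> \<le> (\<integral>z. \<bar>real_series a z\<bar> * M \<partial>torus_measure)"
      by (intro integral_mono integrable_abs i \<psi> integrable_mult_left integrable_continuous_torus c)
         (auto simp: abs_mult intro!: mult_left_mono M)
    finally show ?thesis by simp
  qed
  show "\<exists>C N. \<forall>\<psi>\<in>test_functions. \<forall>M.
        (\<forall>a b z. a + b \<le> N \<longrightarrow> \<bar>(dx1 ^^ a) ((dx2 ^^ b) \<psi>) z\<bar> \<le> M) \<longrightarrow> \<bar>T \<psi>\<bar> \<le> C * M"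
  proof (intro exI ballI allI impI)
    fix \<psi> M
    assume \<psi>: "\<psi> \<in> test_functions" and M: "\<forall>a b z. a + b \<le> (0::nat) \<longrightarrow> \<bar>(dx1 ^^ a) ((dx2 ^^ b) \<psi>) z\<bar> \<le> M"
    show "\<bar>T \<psi>\<bar> \<le> (\<integral>z. \<bar>real_series a z\<bar> \<partial>torus_measure) * M"
      by (rule bd[OF \<psi>]) (use M[rule_format, of 0 0] in simp)
  qed
qed

lemma Hdot_real_series:
  assumes a: "smooth_coeffs a" and T: "dist_eq T (dist_of (real_series a))" and 0: "a 0 = 0"
  shows "T \<in> Hdot s"
proof -
  have fa: "fourier_coeff T = a"
    using fourier_coeff_cong[OF T] fourier_coeff_real_series[OF a] by auto
  have "T (\<lambda>z. 1) / (2 * pi)\<^sup>2 = Re (fourier_coeff T 0)"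
    by (simp add: fourier_coeff_def phase_def)
  then have "T (\<lambda>z. 1) = 0"
    by (simp add: fa 0)
  moreover have "represents_L2 (real_series (\<lambda>k. of_real (Lam_symbol s k) * a k)) (Lam s T)"
    by (rule represents_L2_real_series[OF smooth_coeffs_Lam[OF a] Lam_dist_eq[OF fa a]])
  ultimately show ?thesis
    unfolding Hdot_def using torus_distribution_real_series[OF a T] by blast
qed

lemma L2_integral_Lam:
  assumes S: "fourier_coeff S = a" "smooth_coeffs a" and T: "fourier_coeff T = b" "smooth_coeffs b"
  shows "of_real (L2_integral (Lam s S) (Lam t T))
    = of_real ((2 * pi)\<^sup>2) * (\<Sum>\<^sub>\<infinity>k. of_real (Lam_symbol (s + t) k) * (a k * b (- k)))"
  unfolding L2_integral_real_series[OF smooth_coeffs_Lam[OF S(2)] Lam_dist_eq[OF S] smooth_coeffs_Lam[OF T(2)] Lam_dist_eq[OF T]]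
  by (simp add: Lam_symbol_mult[symmetric] mult_ac)

lemma Lam_symbol_2: "Lam_symbol (-2) k * ((of_int (fst k))\<^sup>2 + (of_int (snd k))\<^sup>2) = Lam_symbol 0 k"
proof (cases "k = 0")
  case False
  have "Lam_symbol 2 k = (of_int (fst k))\<^sup>2 + (of_int (snd k))\<^sup>2"
    using False modulus_bounds(1)[OF False] by (simp add: Lam_symbol_def powr_numeral)
  then show ?thesis
    using Lam_symbol_mult[of "-2" k 2] by simp
qed simp

lemma laplacian_real_series:
  assumes F: "smooth_coeffs F" and 0: "F 0 = 0"
  defines "g \<equiv> \<lambda>k. of_real (- Lam_symbol (-2) k) * F k"
  shows "smooth_coeffs g" "dist_eq (dist_laplacian (dist_of (real_series g))) (dist_of (real_series F))"
proof -
  have "smooth_coeffs (\<lambda>k. -1 * (of_real (Lam_symbol (-2) k) * F k))"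
    using smooth_coeffs_Lam[OF F, of "-2"] rapid_cmult[of "\<lambda>k. of_real (Lam_symbol (-2) k) * F k" "-1"]
    by (simp add: smooth_coeffs_def del: split_paired_All)
  then show g: "smooth_coeffs g" by (simp add: g_def)
  have refl: "dist_eq (dist_of (real_series g)) (dist_of (real_series g))" by (simp add: dist_eq_def)
  let ?g1 = "\<lambda>k. \<i> * of_int (fst k) * (\<i> * of_int (fst k) * g k)"
  let ?g2 = "\<lambda>k. \<i> * of_int (snd k) * (\<i> * of_int (snd k) * g k)"
  have s: "smooth_coeffs ?g1" "smooth_coeffs ?g2"
    by (intro smooth_coeffs_deriv g)+
  have d: "dist_eq (ddx1 (ddx1 (dist_of (real_series g)))) (dist_of (real_series ?g1))"
    "dist_eq (ddx2 (ddx2 (dist_of (real_series g)))) (dist_of (real_series ?g2))"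
    by (intro ddx_dist_eq smooth_coeffs_deriv g refl)+
  have Fk: "?g1 k + ?g2 k = F k" for k
  proof -
    have "?g1 k + ?g2 k = of_real (Lam_symbol (-2) k * ((of_int (fst k))\<^sup>2 + (of_int (snd k))\<^sup>2)) * F k"
      unfolding g_def by (simp add: power2_eq_square algebra_simps)
    also have "\<dots> = F k" unfolding Lam_symbol_2
      by (cases "k = 0") (simp_all add: 0 Lam_symbol_zero)
    finally show ?thesis .
  qed
  show "dist_eq (dist_laplacian (dist_of (real_series g))) (dist_of (real_series F))"
    unfolding dist_eq_def
  proof
    fix \<phi> assume \<phi>: "\<phi> \<in> test_functions"
    note c = test_continuous[OF \<phi>]
    have "complex_of_real (dist_laplacian (dist_of (real_series g)) \<phi>) = of_real (dist_of (real_series ?g1) \<phi>) + of_real (dist_of (real_series ?g2) \<phi>)"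
      using d \<phi> by (simp add: dist_laplacian_def dist_eq_def)
    also have "\<dots> = (\<Sum>\<^sub>\<infinity>k. ?g1 k * mode_pairing k \<phi> + ?g2 k * mode_pairing k \<phi>)"
      unfolding dist_of_real_series(3)[OF s(1) c] dist_of_real_series(3)[OF s(2) c]
      by (rule infsum_add[symmetric]) (intro dist_of_real_series s c)+
    also have "\<dots> = of_real (dist_of (real_series F) \<phi>)"
      unfolding dist_of_real_series(3)[OF F c] distrib_right[symmetric] Fk ..
    finally show "dist_laplacian (dist_of (real_series g)) \<phi> = dist_of (real_series F) \<phi>" by simp
  qed
qed

lemma force_0: "sqg_force \<nu> \<gamma> a 0 = 0"
proof -
  have "sqg_kernel k (0 - k) = 0" for k
    by (simp add: sqg_kernel_def)
  then show ?thesis by (simp add: sqg_force_def kernel_conv_def)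
qed

text \<open>
  Every \<open>r\<close> leads to the same pairing of \<open>f\<close> with \<open>\<psi>\<close>; here \<open>r = 0\<close> is used, for which
  \<open>Lam\<close> only removes the mean value.
\<close>

lemma weak_solution_real_series:
  assumes a: "smooth_coeffs a" "a 0 = 0" and F: "sqg_force \<nu> \<gamma> a = F"
    and f: "dist_eq f (dist_of (real_series F))"
  shows "stationary_weak_solution \<nu> \<gamma> f (dist_of (real_series a))"
  unfolding stationary_weak_solution_def
proof (intro conjI exI[of _ 0] ballI)
  have refl: "dist_eq (dist_of (real_series a)) (dist_of (real_series a))" by (simp add: dist_eq_def)
  have sF: "smooth_coeffs F" and F0: "F 0 = 0"
    unfolding F[symmetric] by (rule smooth_coeffs_force[OF a(1)], rule force_0)
  show "dist_of (real_series a) \<in> Hdot (-1/2)" by (rule Hdot_real_series[OF a(1) refl a(2)])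
  show "f \<in> Hdot (- 0)" by (rule Hdot_real_series[OF sF f F0])
  fix \<psi> assume \<psi>: "\<psi> \<in> test_functions"
  define b where "b = fourier_coeff (dist_of \<psi>)"
  have b: "smooth_coeffs b" unfolding b_def by (rule smooth_coeffs_test[OF \<psi>])
  have fa: "fourier_coeff (dist_of (real_series a)) = a" using fourier_coeff_real_series[OF a(1)] by auto
  have fF: "fourier_coeff f = F" using fourier_coeff_cong[OF f] fourier_coeff_real_series[OF sF] by auto
  have fc: "fourier_coeff (commutator \<psi> (dist_of (real_series a))) = kernel_conv comm_kernel a b"
    unfolding b_def by (rule fourier_coeff_commutator[OF a(1) refl \<psi>])
  have sc: "smooth_coeffs (kernel_conv comm_kernel a b)" by (rule smooth_coeffs_kernel_conv[OF good_comm_kernel a(1) b])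
  have sq: "smooth_coeffs (kernel_conv sqg_kernel a a)" by (rule smooth_coeffs_kernel_conv[OF good_sqg_kernel a(1) a(1)])
  have L0: "of_real (Lam_symbol 0 k) * (c k * d) = c k * d" if "c 0 = 0" for c :: "int \<times> int \<Rightarrow> complex" and d k
    using that by (cases "k = 0") (simp_all add: Lam_symbol_zero)
  let ?P = "complex_of_real ((2 * pi)\<^sup>2)"
  have 1: "of_real (L2_integral (Lam (-1/2) (dist_of (real_series a))) (Lam (1/2) (commutator \<psi> (dist_of (real_series a)))))
      = ?P * (\<Sum>\<^sub>\<infinity>n. kernel_conv sqg_kernel a a n * b (- n))"
    using L2_integral_Lam[OF fa a(1) fc sc, of "-1/2" "1/2"]
    by (simp add: L0[of a, OF a(2)] force_pairing[OF a(1) b])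
  have 2: "of_real (L2_integral (Lam (-1/2) (dist_of (real_series a))) (Lam (\<gamma> + 1/2) (dist_of \<psi>)))
      = ?P * (\<Sum>\<^sub>\<infinity>n. of_real (Lam_symbol \<gamma> n) * a n * b (- n))"
    using L2_integral_Lam[OF fa a(1) b_def[symmetric] b, of "-1/2" "\<gamma> + 1/2"]
    by (simp add: mult.assoc)
  have 3: "of_real (L2_integral (Lam (- 0) f) (Lam 0 (dist_of \<psi>))) = ?P * (\<Sum>\<^sub>\<infinity>n. F n * b (- n))"
    using L2_integral_Lam[OF fF sF b_def[symmetric] b, of "- 0" 0] by (simp add: L0[of F, OF F0])
  have sum: "(\<lambda>n. c n * b (- n)) summable_on UNIV" if c: "smooth_coeffs c" for c
  proof -
    have "(\<lambda>n. (c n * (?P * b (- n))) * (1 / ?P)) summable_on UNIV"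
      using dist_of_real_series(2)[OF c continuous_real_series[OF smooth_coeffsD(1)[OF b]]]
      unfolding mode_pairing_real_series[OF b] by (rule summable_on_cmult_left)
    moreover have "(c n * (?P * b (- n))) * (1 / ?P) = c n * b (- n)" for n
      by simp
    ultimately show ?thesis by (simp only:)
  qed
  have "(\<Sum>\<^sub>\<infinity>n. F n * b (- n)) = (\<Sum>\<^sub>\<infinity>n. 1/2 * (kernel_conv sqg_kernel a a n * b (- n)) + of_real \<nu> * (of_real (Lam_symbol \<gamma> n) * a n * b (- n)))"
    by (rule infsum_cong) (simp add: F[symmetric] sqg_force_def algebra_simps)
  also have "\<dots> = 1/2 * (\<Sum>\<^sub>\<infinity>n. kernel_conv sqg_kernel a a n * b (- n)) + of_real \<nu> * (\<Sum>\<^sub>\<infinity>n. of_real (Lam_symbol \<gamma> n) * a n * b (- n))"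
    unfolding infsum_cmult_right'[symmetric]
    by (intro infsum_add summable_on_cmult_right sum sq smooth_coeffs_Lam a(1))
  finally have "complex_of_real (1/2 * L2_integral (Lam (-1/2) (dist_of (real_series a))) (Lam (1/2) (commutator \<psi> (dist_of (real_series a))))
      + \<nu> * L2_integral (Lam (-1/2) (dist_of (real_series a))) (Lam (\<gamma> + 1/2) (dist_of \<psi>)))
      = of_real (L2_integral (Lam (- 0) f) (Lam 0 (dist_of \<psi>)))"
    unfolding of_real_add of_real_mult 1 2 3 by (simp add: algebra_simps)
  then show "1/2 * L2_integral (Lam (-1/2) (dist_of (real_series a))) (Lam (1/2) (commutator \<psi> (dist_of (real_series a))))
      + \<nu> * L2_integral (Lam (-1/2) (dist_of (real_series a))) (Lam (\<gamma> + 1/2) (dist_of \<psi>))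
      = L2_integral (Lam (- 0) f) (Lam 0 (dist_of \<psi>))"
    by (simp only: of_real_eq_iff)
qed

lemma dist_in_holder_real_series:
  assumes a: "smooth_coeffs a" and T: "dist_eq T (dist_of (real_series a))" and \<beta>: "0 \<le> \<beta>" "\<beta> \<le> 1"
  shows "dist_in_holder \<beta> (Lam s T)"
proof -
  have "fourier_coeff T = a"
    using fourier_coeff_cong[OF T] fourier_coeff_real_series[OF a] by auto
  then show ?thesis
    unfolding dist_in_holder_def
    using Lam_dist_eq[OF _ a] real_series_holder[OF smooth_coeffsD(1)[OF smooth_coeffs_Lam[OF a]] \<beta>] by blast
qed

text \<open>
  The forcings of \<open>p + m\<close> and \<open>p - m\<close> differ by twice the left-hand side of the equation, because the
  terms that are quadratic in \<open>p\<close> or in \<open>m\<close> cancel.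
\<close>

lemma two_solutions_if_difference_equation:
  assumes p: "smooth_coeffs p" "p 0 = 0" and m: "smooth_coeffs m" "m 0 = 0" "m k0 \<noteq> 0"
    and eq: "\<And>n. kernel_conv sqg_kernel p m n + of_real (\<nu> * Lam_symbol \<gamma> n) * m n = 0"
    and \<alpha>: "0 \<le> \<alpha>" "\<alpha> \<le> 1" and \<beta>: "0 \<le> \<beta>" "\<beta> \<le> 1"
  shows "\<exists>G \<in> holder_space \<beta>. \<exists>\<theta> \<theta>'.
      stationary_weak_solution \<nu> \<gamma> (dist_laplacian (dist_of G)) \<theta> \<and>
      stationary_weak_solution \<nu> \<gamma> (dist_laplacian (dist_of G)) \<theta>' \<and>
      \<not> dist_eq \<theta> \<theta>' \<and>
      dist_in_holder \<alpha> (Lam (-1) \<theta>) \<and>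
      dist_in_holder \<alpha> (Lam (-1) \<theta>')"
proof -
  define a a' where "a k = p k + m k" and "a' k = p k - m k" for k
  note rp = smooth_coeffsD(1)[OF p(1)] and rm = smooth_coeffsD(1)[OF m(1)]
  have a: "smooth_coeffs a" and a': "smooth_coeffs a'"
    using rapid_add[OF rp rm] rapid_diff[OF rp rm] smooth_coeffsD(2)[OF p(1)] smooth_coeffsD(2)[OF m(1)]
    by (simp_all add: smooth_coeffs_def a_def[abs_def] a'_def[abs_def] del: split_paired_All)
  have "sqg_force \<nu> \<gamma> a n = sqg_force \<nu> \<gamma> a' n" for n
  proof -
    have 1: "((\<lambda>k. sqg_kernel k (n - k) * a k * a (n - k) - sqg_kernel k (n - k) * a' k * a' (n - k)) has_sum
        (kernel_conv sqg_kernel a a n - kernel_conv sqg_kernel a' a' n)) UNIV"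
      using has_sum_add[OF kernel_conv_has_sum[OF good_sqg_kernel smooth_coeffsD(1)[OF a] smooth_coeffsD(1)[OF a], of n]
        has_sum_uminusI[OF kernel_conv_has_sum[OF good_sqg_kernel smooth_coeffsD(1)[OF a'] smooth_coeffsD(1)[OF a'], of n]]]
      by simp
    have pm: "((\<lambda>k. sqg_kernel k (n - k) * p k * m (n - k)) has_sum kernel_conv sqg_kernel p m n) UNIV"
      by (rule kernel_conv_has_sum[OF good_sqg_kernel rp rm])
    have bij: "bij_betw (\<lambda>k. n - k) UNIV UNIV" by (rule bij_betwI[of _ _ _ "\<lambda>k. n - k"]) auto
    have mp: "((\<lambda>k. sqg_kernel k (n - k) * p (n - k) * m k) has_sum kernel_conv sqg_kernel p m n) UNIV"
      using has_sum_reindex_bij_betw[OF bij, of "\<lambda>k. sqg_kernel k (n - k) * p k * m (n - k)"] pm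
      by (simp add: sqg_kernel_comm[of "n - _"])
    have "((\<lambda>k. 2 * (sqg_kernel k (n - k) * p k * m (n - k) + sqg_kernel k (n - k) * p (n - k) * m k)) has_sum
        (2 * (kernel_conv sqg_kernel p m n + kernel_conv sqg_kernel p m n))) UNIV"
      by (intro has_sum_cmult_right has_sum_add pm mp)
    moreover have "2 * (sqg_kernel k (n - k) * p k * m (n - k) + sqg_kernel k (n - k) * p (n - k) * m k)
        = sqg_kernel k (n - k) * a k * a (n - k) - sqg_kernel k (n - k) * a' k * a' (n - k)" for k
      by (simp add: a_def a'_def algebra_simps)
    ultimately have "2 * (kernel_conv sqg_kernel p m n + kernel_conv sqg_kernel p m n) = kernel_conv sqg_kernel a a n - kernel_conv sqg_kernel a' a' n"
      using has_sum_unique[OF 1] by simp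
    then have "sqg_force \<nu> \<gamma> a n - sqg_force \<nu> \<gamma> a' n = 2 * (kernel_conv sqg_kernel p m n + of_real (\<nu> * Lam_symbol \<gamma> n) * m n)"
      by (simp add: sqg_force_def a_def a'_def algebra_simps)
    then show ?thesis unfolding eq by simp
  qed
  then have F: "sqg_force \<nu> \<gamma> a' = sqg_force \<nu> \<gamma> a" by auto
  define g where "g = (\<lambda>k. of_real (- Lam_symbol (-2) k) * sqg_force \<nu> \<gamma> a k)"
  note lap = laplacian_real_series[OF smooth_coeffs_force[OF a, of \<nu> \<gamma>] force_0[of \<nu> \<gamma> a], folded g_def]
  have ne: "\<not> dist_eq (dist_of (real_series a)) (dist_of (real_series a'))"
  proof
    assume "dist_eq (dist_of (real_series a)) (dist_of (real_series a'))"
    then have "a k0 = a' k0"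
      using fourier_coeff_cong fourier_coeff_real_series[OF a] fourier_coeff_real_series[OF a'] by metis
    then show False using m(3) by (simp add: a_def a'_def)
  qed
  have refl: "dist_eq T T" for T by (simp add: dist_eq_def)
  have z: "a 0 = 0" "a' 0 = 0" using p(2) m(2) by (simp_all add: a_def a'_def)
  show ?thesis
  proof (rule bexI[of _ "real_series g"], rule exI[of _ "dist_of (real_series a)"], rule exI[of _ "dist_of (real_series a')"], intro conjI ne)
    show "stationary_weak_solution \<nu> \<gamma> (dist_laplacian (dist_of (real_series g))) (dist_of (real_series a))"
      by (rule weak_solution_real_series[OF a z(1) _ lap(2)]) simp
    show "stationary_weak_solution \<nu> \<gamma> (dist_laplacian (dist_of (real_series g))) (dist_of (real_series a'))"
      by (rule weak_solution_real_series[OF a' z(2) F lap(2)])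
    show "real_series g \<in> holder_space \<beta>"
      by (rule real_series_holder[OF smooth_coeffsD(1)[OF lap(1)] \<beta>])
  qed (rule dist_in_holder_real_series[OF a refl \<alpha>] dist_in_holder_real_series[OF a' refl \<alpha>])+
qed



section \<open>A three-term recurrence with a decaying solution\<close>

text \<open>
  The continued fraction \<open>1 / (t d\<^sub>i + 1 / (t d\<^sub>i\<^sub>+\<^sub>1 + ...))\<close> with \<open>n\<close> levels. It is the ratio of
  consecutive terms of a solution of the recurrence below that vanishes \<open>n\<close> steps later.
\<close>

primrec cfrac :: "(nat \<Rightarrow> real) \<Rightarrow> nat \<Rightarrow> nat \<Rightarrow> real \<Rightarrow> real" where
  "cfrac d 0 i t = 0"
| "cfrac d (Suc n) i t = 1 / (t * d i + cfrac d n (Suc i) t)"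

lemma cfrac_nonneg:
  assumes "\<And>i. 1 \<le> i \<Longrightarrow> 0 < d i" "0 < t" "1 \<le> i"
  shows "0 \<le> cfrac d n i t"
  using assms(3)
proof (induction n arbitrary: i)
  case (Suc n)
  then have "0 \<le> cfrac d n (Suc i) t" by simp
  moreover have "0 \<le> t * d i" using assms(1)[OF Suc.prems] assms(2) by simp
  ultimately show ?case by simp
qed simp

lemma continuous_on_cfrac:
  assumes "\<And>i. 1 \<le> i \<Longrightarrow> 0 < d i" "\<And>t. t \<in> S \<Longrightarrow> 0 < t" "1 \<le> i"
  shows "continuous_on S (cfrac d n i)"
  using assms(3)
proof (induction n arbitrary: i)
  case 0
  then show ?case by (simp add: continuous_on_const)
next
  case (Suc n)
  then have c: "continuous_on S (cfrac d n (Suc i))" by simp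
  have "t * d i + cfrac d n (Suc i) t \<noteq> 0" if t: "t \<in> S" for t
  proof -
    have "0 \<le> cfrac d n (Suc i) t" by (rule cfrac_nonneg[OF assms(1) assms(2)[OF t]]) simp_all
    moreover have "0 < t * d i" using assms(1)[OF Suc.prems] assms(2)[OF t] by simp
    ultimately show ?thesis by linarith
  qed
  then have "continuous_on S (\<lambda>t. 1 / (t * d i + cfrac d n (Suc i) t))"
    by (intro continuous_on_divide continuous_on_add continuous_on_mult continuous_on_id continuous_on_const c) auto
  then show ?case by (simp add: cfrac.simps(2)[abs_def])
qed

fun shoot :: "(nat \<Rightarrow> real) \<Rightarrow> real \<Rightarrow> nat \<Rightarrow> real" where
  "shoot d t 0 = 1"
| "shoot d t (Suc 0) = t / 2"
| "shoot d t (Suc (Suc j)) = shoot d t j - t * d (Suc j) * shoot d t (Suc j)"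

lemma continuous_shoot: "isCont (\<lambda>t. shoot d t j) t"
proof (induction j rule: less_induct)
  case (less j)
  consider "j = 0" | "j = 1" | i where "j = Suc (Suc i)"
    by (metis One_nat_def not0_implies_Suc)
  then show ?case
  proof cases
    case 3
    have "isCont (\<lambda>t. shoot d t i - t * d (Suc i) * shoot d t (Suc i)) t"
      by (intro continuous_intros less) (auto simp: 3)
    then show ?thesis by (simp add: 3)
  qed auto
qed

text \<open>
  The initial ratio \<open>t / 2\<close> is the continued fraction itself, and the recurrence turns the ratio with
  \<open>n\<close> levels into the one with \<open>n - 1\<close> levels. All ratios up to the cut-off are thus nonnegative.
\<close>

lemma shoot_cfrac:
  assumes d: "\<And>i. 1 \<le> i \<Longrightarrow> 0 < d i" and t: "0 < t" and root: "cfrac d N 1 t = t / 2"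
  shows "j \<le> N \<Longrightarrow> 0 \<le> shoot d t j \<and> (j < N \<longrightarrow> shoot d t (Suc j) = cfrac d (N - j) (Suc j) t * shoot d t j)"
proof (induction j)
  case 0
  then show ?case using root by simp
next
  case (Suc j)
  then have IH: "0 \<le> shoot d t j" "shoot d t (Suc j) = cfrac d (N - j) (Suc j) t * shoot d t j" by auto
  have nn: "0 \<le> shoot d t (Suc j)"
    unfolding IH(2) using IH(1) by (intro mult_nonneg_nonneg cfrac_nonneg[OF d t]) auto
  have "shoot d t (Suc (Suc j)) = cfrac d (N - Suc j) (Suc (Suc j)) t * shoot d t (Suc j)" if "Suc j < N"
  proof -
    let ?K = "cfrac d (N - Suc j) (Suc (Suc j)) t"
    have "N - j = Suc (N - Suc j)" using that by simp
    then have x: "shoot d t (Suc j) = 1 / (t * d (Suc j) + ?K) * shoot d t j"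
      using IH(2) by simp
    have "0 \<le> ?K" by (rule cfrac_nonneg[OF d t]) auto
    moreover have "0 < t * d (Suc j)" using d[of "Suc j"] t by simp
    ultimately have "0 < t * d (Suc j) + ?K" by linarith
    then have "shoot d t j = shoot d t (Suc j) * (t * d (Suc j) + ?K)"
      unfolding x by simp
    then show ?thesis by (simp add: algebra_simps)
  qed
  with nn show ?case by simp
qed

text \<open>
  On the interval from \<open>a = 1 / sqrt (d 1)\<close> to \<open>b = sqrt (2 / d 1)\<close>, two-sided bounds for continued
  fractions show that \<open>K(t) - t / 2\<close> changes sign whatever the number of levels: at \<open>b\<close> the upper bound
  \<open>1 / (b d\<^sub>1) = b / 2\<close> applies, at \<open>a\<close> the lower bound \<open>1 / (a d\<^sub>1 + 1 / (a d\<^sub>2))\<close>, which is at least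
  \<open>a / 2\<close> as \<open>d\<^sub>2 \<ge> 1\<close>. Every term of the recurrence is continuous in \<open>t\<close>, so nonnegativity of the first
  terms survives in a limit point of the roots as the number of levels grows.
\<close>

lemma exists_positive_shoot:
  fixes d :: "nat \<Rightarrow> real"
  assumes d: "\<And>i. 1 \<le> i \<Longrightarrow> 0 < d i" and d2: "1 \<le> d 2"
  obtains t where "0 < t" "\<And>j. 0 \<le> shoot d t j"
proof -
  define a b where "a = 1 / sqrt (d 1)" and "b = sqrt 2 / sqrt (d 1)"
  have d1: "0 < d 1" using d by simp
  then have a: "0 < a" "a\<^sup>2 * d 1 = 1" and b: "b\<^sup>2 * d 1 = 2" and ab: "a \<le> b"
    by (simp_all add: a_def b_def power_divide divide_right_mono)
  have b0: "0 < b" using a ab by linarith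
  \<comment> \<open>At least two levels, because the lower bound at \<open>a\<close> unfolds two of them.\<close>
  have root: "\<exists>t. a \<le> t \<and> t \<le> b \<and> cfrac d (Suc (Suc N)) 1 t = t / 2" for N
  proof -
    let ?f = "\<lambda>t. cfrac d (Suc (Suc N)) 1 t - t / 2"
    have "continuous_on {a..b} ?f"
      by (intro continuous_on_diff continuous_on_cfrac d continuous_on_divide continuous_on_id continuous_on_const)
         (use a in auto)
    moreover have "?f b \<le> 0"
    proof -
      have "0 \<le> cfrac d (Suc N) (Suc 1) b" by (rule cfrac_nonneg[OF d b0]) auto
      moreover have "0 < b * d 1" using b0 d1 by simp
      ultimately have "cfrac d (Suc (Suc N)) 1 b \<le> 1 / (b * d 1)"
        by (subst cfrac.simps(2)) (rule frac_le; linarith)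
      also have "\<dots> = b / 2"
        using b b0 d1 by (simp add: field_simps power2_eq_square)
      finally show ?thesis by simp
    qed
    moreover have "0 \<le> ?f a"
    proof -
      have K0: "0 \<le> cfrac d (Suc N) 2 a" by (rule cfrac_nonneg[OF d a(1)]) auto
      have "0 \<le> cfrac d N (Suc 2) a" by (rule cfrac_nonneg[OF d a(1)]) auto
      moreover have ad2: "a * 1 \<le> a * d 2" using a(1) d2 by (intro mult_left_mono) auto
      ultimately have "cfrac d (Suc N) 2 a \<le> 1 / a"
        using a(1) by (subst cfrac.simps(2)) (intro divide_left_mono mult_pos_pos; linarith)
      moreover have "a * d 1 = 1 / a"
        using a by (simp add: field_simps power2_eq_square)
      ultimately have "a * d 1 + cfrac d (Suc N) 2 a \<le> 2 / a" by simp
      moreover have "0 < a * d 1 + cfrac d (Suc N) 2 a" using a(1) d1 K0 by (intro add_pos_nonneg) auto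
      ultimately have "1 / (2 / a) \<le> 1 / (a * d 1 + cfrac d (Suc N) 2 a)"
        using a(1) by (intro divide_left_mono mult_pos_pos) auto
      then show ?thesis by (simp add: numeral_2_eq_2)
    qed
    ultimately obtain t where "a \<le> t" "t \<le> b" "?f t = 0"
      using IVT2'[of ?f b 0 a] ab by auto
    then show ?thesis by auto
  qed
  then obtain T where T: "\<And>N. a \<le> T N \<and> T N \<le> b \<and> cfrac d (Suc (Suc N)) 1 (T N) = T N / 2"
    by metis
  have "\<forall>N. T N \<in> {a..b}" using T by simp
  then obtain t r where t: "t \<in> {a..b}" and r: "strict_mono r" "(T \<circ> r) \<longlonglongrightarrow> t"
    using compact_Icc[of a b] unfolding compact_def by metis
  have "0 \<le> shoot d t j" for j
  proof (rule tendsto_lowerbound)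
    show "(\<lambda>n. shoot d ((T \<circ> r) n) j) \<longlonglongrightarrow> shoot d t j"
      by (rule isCont_tendsto_compose[OF continuous_shoot r(2)])
    have "0 \<le> shoot d ((T \<circ> r) n) j" if "j \<le> n" for n
    proof -
      have "j \<le> Suc (Suc (r n))" using that seq_suble[OF r(1), of n] by linarith
      moreover have "0 < T (r n)" using T[of "r n"] a(1) by linarith
      ultimately show ?thesis
        using shoot_cfrac[of d "T (r n)" "Suc (Suc (r n))" j, OF d] T[of "r n"] by simp
    qed
    then show "\<forall>\<^sub>F n in sequentially. 0 \<le> shoot d ((T \<circ> r) n) j"
      unfolding eventually_sequentially by blast
  qed simp
  then show thesis using that[of t] t a(1) by auto
qed

text \<open>
  Nonnegativity of \<open>x\<^sub>j\<^sub>+\<^sub>1\<close> means \<open>x\<^sub>j \<le> x\<^sub>j\<^sub>-\<^sub>1 / (t d\<^sub>j)\<close>. The ratio of consecutive terms thus tends to zero,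
  whereas the ratio of consecutive weights stays below \<open>2 ^ N\<close>.
\<close>

lemma shoot_decay:
  assumes t: "0 < t" and nn: "\<And>j. 0 \<le> shoot d t j"
    and lim: "\<And>M. \<exists>J. \<forall>j\<ge>J. M \<le> d j"
  obtains C where "0 \<le> C" "\<And>j. shoot d t j * (1 + real j) ^ N \<le> C"
proof -
  define y where "y j = shoot d t j * (1 + real j) ^ N" for j
  have y0: "0 \<le> y j" for j unfolding y_def using nn by simp
  obtain J where J: "\<And>j. J \<le> j \<Longrightarrow> 2 ^ N / t \<le> d j"
    using lim[of "2 ^ N / t"] by blast
  have step: "y (Suc j) \<le> y j" if "J \<le> j" for j
  proof -
    have "t * (2 ^ N / t) \<le> t * d (Suc j)"
      using J[of "Suc j"] that t by (intro mult_left_mono) auto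
    then have "2 ^ N * shoot d t (Suc j) \<le> t * d (Suc j) * shoot d t (Suc j)"
      using t nn by (intro mult_right_mono) auto
    also have "\<dots> \<le> shoot d t j"
      using nn[of "Suc (Suc j)"] by simp
    finally have 1: "2 ^ N * shoot d t (Suc j) \<le> shoot d t j" .
    have "y (Suc j) \<le> shoot d t (Suc j) * (2 * (1 + real j)) ^ N"
      unfolding y_def using nn by (intro mult_left_mono power_mono) auto
    also have "\<dots> = 2 ^ N * shoot d t (Suc j) * (1 + real j) ^ N"
      by (simp only: power_mult_distrib mult_ac)
    also have "\<dots> \<le> y j"
      unfolding y_def using 1 by (intro mult_right_mono) auto
    finally show ?thesis .
  qed
  have le: "y j \<le> (\<Sum>i\<le>J. y i)" for j
  proof (cases "j \<le> J")
    case True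
    then show ?thesis by (intro member_le_sum) (auto simp: y0)
  next
    case False
    then have "J \<le> j" by simp
    then have "y j \<le> y J"
      by (induction j rule: dec_induct) (auto intro: order_trans[OF step])
    also have "\<dots> \<le> (\<Sum>i\<le>J. y i)" by (intro member_le_sum) (auto simp: y0)
    finally show ?thesis .
  qed
  show thesis
    by (rule that[of "\<Sum>i\<le>J. y i"]) (auto simp: sum_nonneg y0 le y_def[symmetric])
qed

section \<open>The Kolmogorov flow and its neutral mode\<close>

text \<open>
  The length of the mode \<open>(1, 2 j)\<close>.
\<close>

definition mode_length :: "int \<Rightarrow> real" where
  "mode_length j = sqrt (1 + 4 * (of_int j)\<^sup>2)"

text \<open>
  The dissipation symbol divided by the factor \<open>1 - 2 / |k|\<close> with which the interaction with
  the background mode \<open>(0, 2)\<close> acts on the mode \<open>k = (1, 2 j)\<close>.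
\<close>

definition damping :: "real \<Rightarrow> int \<Rightarrow> real" where
  "damping \<gamma> j = mode_length j powr \<gamma> / (1 - 2 / mode_length j)"

lemma mode_length_uminus [simp]: "mode_length (- j) = mode_length j"
  by (simp add: mode_length_def)

lemma damping_uminus [simp]: "damping \<gamma> (- j) = damping \<gamma> j"
  by (simp add: damping_def)

lemma mode_length_0: "mode_length 0 = 1" "damping \<gamma> 0 = -1"
  by (simp_all add: mode_length_def damping_def)

lemma mode_length_pos: "0 < mode_length j"
  by (simp add: mode_length_def add_pos_nonneg)

lemma mode_length_gt:
  assumes "1 \<le> j" shows "11 / 5 < mode_length j" "of_int j \<le> mode_length j"
proof -
  have "(1::real) \<le> of_int j" using assms by simp
  then have j: "1 \<le> (real_of_int j)\<^sup>2" by (simp add: one_le_power)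
  have "sqrt ((11 / 5)\<^sup>2) < mode_length j"
    unfolding mode_length_def by (rule real_sqrt_less_mono) (use j in \<open>simp add: power2_eq_square\<close>)
  then show "11 / 5 < mode_length j" by simp
  have "sqrt ((of_int j)\<^sup>2) \<le> mode_length j"
    unfolding mode_length_def by (rule real_sqrt_le_mono) simp
  then show "of_int j \<le> mode_length j" using assms by simp
qed

lemma damping_ge:
  assumes "1 \<le> j" shows "mode_length j powr \<gamma> \<le> damping \<gamma> j"
proof -
  have "0 < 1 - 2 / mode_length j" "1 - 2 / mode_length j \<le> 1"
    using mode_length_gt(1)[OF assms] by (simp_all add: field_simps)
  then have "mode_length j powr \<gamma> / 1 \<le> mode_length j powr \<gamma> / (1 - 2 / mode_length j)"
    by (intro divide_left_mono) auto
  then show ?thesis by (simp add: damping_def)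
qed

text \<open>
  For \<open>j \<noteq> 0\<close> the length is at least \<open>sqrt 5 > 11 / 5\<close>, so \<open>1 - 2 / |k|\<close> exceeds \<open>1 / 11\<close>; at \<open>j = 0\<close> it
  equals \<open>- 1\<close>.
\<close>

lemma mode_length_ne_2: "1 - 2 / mode_length j \<noteq> 0" "\<bar>1 / (1 - 2 / mode_length j)\<bar> \<le> 11"
proof -
  have "1 - 2 / mode_length j \<noteq> 0 \<and> \<bar>1 / (1 - 2 / mode_length j)\<bar> \<le> 11"
  proof (cases "j = 0")
    case False
    then have "1 \<le> \<bar>j\<bar>" by simp
    then have "11 / 5 < mode_length \<bar>j\<bar>" by (rule mode_length_gt)
    also have "mode_length \<bar>j\<bar> = mode_length j" by (simp add: mode_length_def)
    finally have v: "1 / 11 \<le> 1 - 2 / mode_length j" by (simp add: field_simps)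
    have "v \<noteq> 0 \<and> \<bar>1 / v\<bar> \<le> 11" if "1 / 11 \<le> v" for v :: real
      using that by (auto simp: field_simps)
    from this[OF v] show ?thesis .
  qed (simp add: mode_length_0)
  then show "1 - 2 / mode_length j \<noteq> 0" "\<bar>1 / (1 - 2 / mode_length j)\<bar> \<le> 11" by auto
qed

lemma damping_unbounded:
  assumes "0 < \<gamma>" shows "\<exists>J. \<forall>j\<ge>J. M \<le> damping \<gamma> (int j)"
proof (intro exI allI impI)
  define B where "B = \<bar>M\<bar> + 1"
  fix j assume j: "Suc (nat \<lceil>B powr (1 / \<gamma>)\<rceil>) \<le> j"
  then have "B powr (1 / \<gamma>) \<le> real j" by linarith
  then have "(B powr (1 / \<gamma>)) powr \<gamma> \<le> real j powr \<gamma>"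
    using assms by (intro powr_mono2) auto
  then have "B \<le> real j powr \<gamma>"
    using assms by (simp add: powr_powr B_def)
  also have "\<dots> \<le> mode_length (int j) powr \<gamma>"
    using assms j mode_length_gt(2)[of "int j"] by (intro powr_mono2) auto
  also have "\<dots> \<le> damping \<gamma> (int j)" using j by (intro damping_ge) simp
  finally show "M \<le> damping \<gamma> (int j)" by (simp add: B_def)
qed

text \<open>
  The one-sided solution \<open>x\<close> is extended by \<open>c\<^sub>j = (-1)\<^sup>j x\<^sub>j\<close> and \<open>c\<^sub>-\<^sub>j = x\<^sub>j\<close> for \<open>j \<ge> 0\<close>. The equation at \<open>0\<close>
  then reads \<open>- 2 x\<^sub>1 = t D\<^sub>0 x\<^sub>0 = - t\<close>, which explains the initial value \<open>x\<^sub>1 = t / 2\<close>.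
\<close>

lemma exists_two_sided_sequence:
  assumes \<gamma>: "0 < \<gamma>"
  obtains t and c :: "int \<Rightarrow> real"
  where "0 < t" "c 0 = 1" "\<And>j. c (j + 1) - c (j - 1) = t * damping \<gamma> j * c j"
    "\<And>N. \<exists>C. \<forall>j. \<bar>c j\<bar> * (1 + \<bar>of_int j\<bar>) ^ N \<le> C"
proof -
  define d where "d i = damping \<gamma> (int i)" for i
  have d: "0 < d i" if "1 \<le> i" for i
  proof -
    have "0 < mode_length (int i) powr \<gamma>" using mode_length_pos[of "int i"] by simp
    also have "\<dots> \<le> d i" unfolding d_def by (rule damping_ge) (use that in simp)
    finally show ?thesis .
  qed
  have "1 \<le> mode_length 2 powr \<gamma>" using mode_length_gt(1)[of 2] \<gamma> by (intro ge_one_powr_ge_zero) auto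
  also have "\<dots> \<le> d 2" unfolding d_def using damping_ge[of 2 \<gamma>] by simp
  finally have d2: "1 \<le> d 2" .
  obtain t where t: "0 < t" and nn: "\<And>j. 0 \<le> shoot d t j"
    using exists_positive_shoot[of d, OF d d2] by blast
  define x where "x = shoot d t"
  have x: "x 0 = 1" "x 1 = t / 2" "\<And>j. x (Suc (Suc j)) = x j - t * d (Suc j) * x (Suc j)"
    by (simp_all add: x_def)
  define c where "c j = (if 0 \<le> j then (-1) ^ nat j * x (nat j) else x (nat (- j)))" for j :: int
  have cpos: "c (int i) = (-1) ^ i * x i" for i by (simp add: c_def)
  have cneg: "c (- int i) = x i" for i by (simp add: c_def x)
  have rec: "c (j + 1) - c (j - 1) = t * damping \<gamma> j * c j" for j
  proof -
    consider "j = 0" | i where "j = int (Suc i)" | i where "j = - int (Suc i)"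
      by (metis int_cases3 not0_implies_Suc of_nat_0_less_iff less_irrefl)
    then show ?thesis
    proof cases
      case 1
      then show ?thesis using cpos[of 1] cneg[of 1] cpos[of 0] x by (simp add: mode_length_0)
    next
      case 2
      have e: "j + 1 = int (Suc (Suc i))" "j - 1 = int i" using 2 by simp_all
      show ?thesis
        unfolding e unfolding 2 cpos by (simp add: x(3) d_def algebra_simps)
    next
      case 3
      have e: "j + 1 = - int i" "j - 1 = - int (Suc (Suc i))" using 3 by simp_all
      have "damping \<gamma> j = d (Suc i)" unfolding 3 d_def damping_uminus ..
      then show ?thesis
        unfolding e cneg using cneg[of "Suc i"] 3 by (simp add: x(3))
    qed
  qed
  have dec: "\<exists>C. \<forall>j. \<bar>c j\<bar> * (1 + \<bar>of_int j\<bar>) ^ N \<le> C" for N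
  proof -
    obtain C where C: "\<And>j. shoot d t j * (1 + real j) ^ N \<le> C"
      by (rule shoot_decay[OF t nn, of N]) (use damping_unbounded[OF \<gamma>] in \<open>auto simp: d_def\<close>)
    have "\<bar>c j\<bar> * (1 + \<bar>of_int j\<bar>) ^ N \<le> C" for j
    proof -
      have "\<bar>c j\<bar> = shoot d t (nat \<bar>j\<bar>)"
        using nn by (auto simp: c_def x_def abs_mult)
      then show ?thesis using C[of "nat \<bar>j\<bar>"] by simp
    qed
    then show ?thesis by blast
  qed
  show thesis
    by (rule that[of t c]) (use t rec dec cpos[of 0] x in auto)
qed

lemma Lam_symbol_mode:
  assumes "\<bar>q\<bar> = 1"
  shows "Lam_symbol s (q, 2 * j) = mode_length j powr s"
proof -
  have "(real_of_int q)\<^sup>2 = 1" using assms by (metis of_int_1 of_int_abs power2_abs power_one)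
  moreover have "(q, 2 * j) \<noteq> 0" using assms by (auto simp: zero_prod_def)
  ultimately show ?thesis by (simp add: Lam_symbol_def mode_length_def power_mult_distrib)
qed

text \<open>
  The factor \<open>1 - 2 / |k|\<close> is divided out because the recurrence is written for \<open>c\<close>. The argument
  \<open>fst k * (snd k div 2)\<close> takes the value \<open>j\<close> at \<open>(1, 2 j)\<close> and at \<open>(-1, - 2 j)\<close>, which makes the function real.
\<close>

definition kolmogorov_mode :: "(int \<Rightarrow> real) \<Rightarrow> int \<times> int \<Rightarrow> complex" where
  "kolmogorov_mode c k = (if \<bar>fst k\<bar> = 1 \<and> even (snd k)
     then of_real (c (fst k * (snd k div 2)) / (1 - 2 / mode_length (snd k div 2))) else 0)"

text \<open>
  The coefficients of \<open>2 A cos (2 x\<^sub>2)\<close>.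
\<close>

definition shear :: "real \<Rightarrow> int \<times> int \<Rightarrow> complex" where
  "shear A k = (if fst k = 0 \<and> \<bar>snd k\<bar> = 2 then of_real A else 0)"

lemma smooth_coeffs_shear: "smooth_coeffs (shear A)"
  unfolding smooth_coeffs_def rapid_def
proof (intro conjI allI exI)
  fix N :: nat and k :: "int \<times> int"
  have "\<bar>snd k\<bar> = 2 \<Longrightarrow> \<bar>real_of_int (snd k)\<bar> = 2"
    by (metis of_int_abs of_int_numeral)
  then show "norm (shear A k) * wt k ^ N \<le> \<bar>A\<bar> * 3 ^ N"
    by (auto simp: shear_def wt_def)
qed (simp add: shear_def)

lemma smooth_coeffs_kolmogorov_mode:
  assumes c: "\<And>N. \<exists>C. \<forall>j. \<bar>c j\<bar> * (1 + \<bar>of_int j\<bar>) ^ N \<le> C"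
  shows "smooth_coeffs (kolmogorov_mode c)"
  unfolding smooth_coeffs_def
proof (intro conjI allI)
  show "rapid (kolmogorov_mode c)"
    unfolding rapid_def
  proof
    fix N
    obtain C where C: "\<And>j. \<bar>c j\<bar> * (1 + \<bar>of_int j\<bar>) ^ N \<le> C" using c by blast
    have C0: "0 \<le> C" using C[of 0] abs_ge_zero[of "c 0"] by simp
    have "norm (kolmogorov_mode c k) * wt k ^ N \<le> 11 * 2 ^ N * C" for k
    proof (cases "\<bar>fst k\<bar> = 1 \<and> even (snd k)")
      case True
      define j where "j = snd k div 2"
      have k: "snd k = 2 * j" using True by (simp add: j_def)
      let ?i = "fst k * j"
      have ij: "\<bar>real_of_int ?i\<bar> = \<bar>real_of_int j\<bar>"
        using True by (metis abs_mult mult_1 of_int_abs)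
      have w: "wt k = 2 * (1 + \<bar>real_of_int ?i\<bar>)"
        unfolding ij wt_def k using True by (simp add: abs_mult flip: of_int_abs)
      have "kolmogorov_mode c k = of_real (c ?i * (1 / (1 - 2 / mode_length j)))"
        using True by (simp add: kolmogorov_mode_def j_def)
      then have "norm (kolmogorov_mode c k) = \<bar>c ?i\<bar> * \<bar>1 / (1 - 2 / mode_length j)\<bar>"
        by (simp only: norm_of_real abs_mult)
      also have "\<dots> \<le> \<bar>c ?i\<bar> * 11"
        by (intro mult_left_mono mode_length_ne_2) simp
      finally have "norm (kolmogorov_mode c k) * wt k ^ N \<le> (\<bar>c ?i\<bar> * 11) * wt k ^ N"
        using wt_pos[of k] by (intro mult_right_mono) auto
      also have "\<dots> = 11 * 2 ^ N * (\<bar>c ?i\<bar> * (1 + \<bar>of_int ?i\<bar>) ^ N)"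
        unfolding w by (simp only: power_mult_distrib mult_ac)
      also have "\<dots> \<le> 11 * 2 ^ N * C"
        by (intro mult_left_mono C) simp
      finally show ?thesis .
    qed (use C0 in \<open>auto simp: kolmogorov_mode_def\<close>)
    then show "\<exists>C. \<forall>k. norm (kolmogorov_mode c k) * wt k ^ N \<le> C" by blast
  qed
  fix k :: "int \<times> int"
  have "even (snd k) \<Longrightarrow> - snd k div 2 = - (snd k div 2)" by auto
  then show "kolmogorov_mode c (- k) = cnj (kolmogorov_mode c k)"
    by (simp add: kolmogorov_mode_def)
qed

text \<open>
  The background consists of two modes, so the convolution has the two terms \<open>k = (0, 2)\<close> and
  \<open>k = (0, - 2)\<close>. They couple \<open>(q, 2 j)\<close> with \<open>(q, 2 (j - 1))\<close> and \<open>(q, 2 (j + 1))\<close>, and the symbol absorbs the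
  denominator \<open>1 - 2 / |k|\<close>, leaving the recurrence for \<open>c\<close>.
\<close>

lemma kolmogorov_equation:
  assumes t: "0 < t" and rec: "\<And>j. c (j + 1) - c (j - 1) = t * damping \<gamma> j * c j"
  shows "kernel_conv sqg_kernel (shear (\<nu> / t)) (kolmogorov_mode c) n + of_real (\<nu> * Lam_symbol \<gamma> n) * kolmogorov_mode c n = 0"
proof -
  define m where "m = kolmogorov_mode c"
  let ?p = "shear (\<nu> / t)"
  have "((\<lambda>k. sqg_kernel k (n - k) * ?p k * m (n - k)) has_sum
      (\<Sum>k\<in>{(0, 2), (0, - 2)}. sqg_kernel k (n - k) * ?p k * m (n - k))) UNIV"
    by (rule has_sum_finite_neutralI[of "{(0, 2), (0, - 2)}"]) (auto simp: shear_def prod_eq_iff)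
  then have cv: "kernel_conv sqg_kernel ?p m n = sqg_kernel (0, 2) (n - (0, 2)) * ?p (0, 2) * m (n - (0, 2))
      + sqg_kernel (0, - 2) (n - (0, - 2)) * ?p (0, - 2) * m (n - (0, - 2))"
    unfolding kernel_conv_def by (simp add: infsumI)
  show ?thesis
  proof (cases "\<bar>fst n\<bar> = 1 \<and> even (snd n)")
    case False
    then have "m n = 0" "m (n - (0, 2)) = 0" "m (n - (0, - 2)) = 0"
      by (auto simp: m_def kolmogorov_mode_def)
    then show ?thesis unfolding cv[unfolded m_def] m_def by simp
  next
    case True
    define q j where "q = fst n" and "j = snd n div 2"
    have n: "n = (q, 2 * j)" and q: "\<bar>q\<bar> = 1" using True by (auto simp: q_def j_def prod_eq_iff)
    have nm: "n - (0, 2) = (q, 2 * (j - 1))" "n - (0, - 2) = (q, 2 * (j + 1))"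
      by (simp_all add: n)
    have mq: "m (q, 2 * i) = of_real (c (q * i) / (1 - 2 / mode_length i))" for i
      using q by (simp add: m_def kolmogorov_mode_def)
    have L2: "Lam_symbol (-1) (0, 2) = 1 / 2" "Lam_symbol (-1) (0, - 2) = 1 / 2"
      by (simp_all add: Lam_symbol_def zero_prod_def powr_minus divide_simps)
    have Lq: "Lam_symbol (-1) (q, 2 * i) = 1 / mode_length i" for i
      using Lam_symbol_mode[OF q, of "-1" i] mode_length_pos[of i] by (simp add: powr_minus_divide)
    have K: "sqg_kernel (0, 2) (q, 2 * i) * m (q, 2 * i) = of_real (of_int q * c (q * i))"
      "sqg_kernel (0, - 2) (q, 2 * i) * m (q, 2 * i) = - of_real (of_int q * c (q * i))" for i
    proof -
      have "2 * (1 / 2 - 1 / mode_length i) * (c (q * i) / (1 - 2 / mode_length i)) = c (q * i)"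
        using mode_length_ne_2(1)[of i] by (simp add: right_diff_distrib)
      then have e: "of_int q * (2 * (1 / 2 - 1 / mode_length i)) * (c (q * i) / (1 - 2 / mode_length i)) = of_int q * c (q * i)"
        by (simp only: mult.assoc)
      have "sqg_kernel (0, 2) (q, 2 * i) = of_real (of_int q * (2 * (1 / 2 - 1 / mode_length i)))"
        "sqg_kernel (0, - 2) (q, 2 * i) = - of_real (of_int q * (2 * (1 / 2 - 1 / mode_length i)))"
        unfolding sqg_kernel_def L2 Lq cross_def by (simp_all add: algebra_simps)
      then show "sqg_kernel (0, 2) (q, 2 * i) * m (q, 2 * i) = of_real (of_int q * c (q * i))"
        "sqg_kernel (0, - 2) (q, 2 * i) * m (q, 2 * i) = - of_real (of_int q * c (q * i))"
        unfolding mq by (simp_all only: e of_real_mult[symmetric] mult_minus_left)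
    qed
    have p: "?p (0, 2) = of_real (\<nu> / t)" "?p (0, - 2) = of_real (\<nu> / t)"
      by (simp_all add: shear_def)
    have "kernel_conv sqg_kernel ?p m n = of_real (\<nu> / t) * (sqg_kernel (0, 2) (q, 2 * (j - 1)) * m (q, 2 * (j - 1)))
        + of_real (\<nu> / t) * (sqg_kernel (0, - 2) (q, 2 * (j + 1)) * m (q, 2 * (j + 1)))"
      unfolding cv nm p by (simp only: mult_ac)
    also have "\<dots> = of_real (- (\<nu> / t) * (of_int q * (c (q * (j + 1)) - c (q * (j - 1)))))"
      unfolding K by (simp add: algebra_simps)
    also have "of_int q * (c (q * (j + 1)) - c (q * (j - 1))) = t * damping \<gamma> j * c (q * j)"
    proof -
      consider "q = 1" | "q = - 1" using q by linarith
      then show ?thesis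
      proof cases
        case 2
        have "- j + 1 = - (j - 1)" "- j - 1 = - (j + 1)" by simp_all
        then show ?thesis using rec[of "- j"] 2 by simp
      qed (use rec[of j] in simp)
    qed
    also have "- (\<nu> / t) * (t * damping \<gamma> j * c (q * j)) = - (\<nu> * (damping \<gamma> j * c (q * j)))"
      using t by simp
    finally have cv': "kernel_conv sqg_kernel ?p m n = of_real (- (\<nu> * (damping \<gamma> j * c (q * j))))" .
    have "of_real (\<nu> * Lam_symbol \<gamma> n) * m n = of_real (\<nu> * (damping \<gamma> j * c (q * j)))"
      unfolding n mq Lam_symbol_mode[OF q] of_real_mult[symmetric] damping_def by (simp add: mult.assoc)
    then show ?thesis unfolding m_def[symmetric] cv' by simp
  qed
qed

theorem theorem1p2:
  fixes \<nu> \<alpha> \<gamma> :: real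
  assumes "0 \<le> \<nu>"
    and "1/2 \<le> \<alpha>" and "\<alpha> < 3/4"
    and "0 < \<gamma>" and "\<gamma> < 2 - \<alpha>"
  shows "\<exists>G \<in> holder_space (2 * \<alpha> - 1). \<exists>\<theta> \<theta>'.
      stationary_weak_solution \<nu> \<gamma> (dist_laplacian (dist_of G)) \<theta> \<and>
      stationary_weak_solution \<nu> \<gamma> (dist_laplacian (dist_of G)) \<theta>' \<and>
      \<not> dist_eq \<theta> \<theta>' \<and>
      dist_in_holder \<alpha> (Lam (-1) \<theta>) \<and>
      dist_in_holder \<alpha> (Lam (-1) \<theta>')"
proof -
  obtain t and c :: "int \<Rightarrow> real" where t: "0 < t" and c0: "c 0 = 1"
    and rec: "\<And>j. c (j + 1) - c (j - 1) = t * damping \<gamma> j * c j"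
    and dec: "\<And>N. \<exists>C. \<forall>j. \<bar>c j\<bar> * (1 + \<bar>of_int j\<bar>) ^ N \<le> C"
    using exists_two_sided_sequence[OF assms(4)] by blast
  show ?thesis
  proof (rule two_solutions_if_difference_equation)
    show "smooth_coeffs (shear (\<nu> / t))" by (rule smooth_coeffs_shear)
    show "smooth_coeffs (kolmogorov_mode c)" by (rule smooth_coeffs_kolmogorov_mode[OF dec])
    show "shear (\<nu> / t) 0 = 0" "kolmogorov_mode c 0 = 0"
      by (simp_all add: shear_def kolmogorov_mode_def)
    show "kolmogorov_mode c (1, 0) \<noteq> 0"
      by (simp add: kolmogorov_mode_def c0 mode_length_0)
    show "kernel_conv sqg_kernel (shear (\<nu> / t)) (kolmogorov_mode c) n
        + of_real (\<nu> * Lam_symbol \<gamma> n) * kolmogorov_mode c n = 0" for n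
      by (rule kolmogorov_equation[OF t rec])
  qed (use assms in auto)
qed

end
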